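(* Let $(\Omega,\mathcal A,\mathbb A=(\mathcal A_t)_{t\le T},R)$ be a standard filtered probability space. Let $U$ be an $\mathbb A$-adapted pure jump process of integrable variation with accessible jump times only. Then its $(R,\mathbb A)$-compensator $B^U$ admits the representation $$B^U_t=\sum_{n\in\mathbb N}\sum_{m\in\mathbb N}E^R\left[\Delta U_{\eta_{n,m}}\,\mathbb I_{\eta_n=\eta_{n,m}}\mid\mathcal A_{\eta_{n,m}^-}\right]\mathbb I_{\eta_{n,m}\le t},\qquad t\in[0,T],$$ where $\{\eta_n\}_{n\in\mathbb N}$ is the sequence of the jump times of $U$ and, for each $n\in\mathbb N$, $\{\eta_{n,m}\}_{m\in\mathbb N}$ is an enveloping sequence of $\eta_n$.
   Context: Standard filtration: right-continuous and complete. Pure jump process: $U_t=\sum_{s\le t}\Delta U_s$. A jump time of a càdlàg process $X$ is a random time $\eta$ with values in $[0,T]\cup\{+\infty\}$ such that $R(X_\eta\ne X_{\eta^-},\eta<\infty)=R(\eta<\infty)$; $\Delta X_\eta=X_\eta-X_{\eta^-}$, with $\Delta X_\eta=0$ on $\{\eta=+\infty\}$. "The sequence of the jump times of $U$" is a sequence of stopping times with pairwise disjoint graphs exhausting the jumps of $U$, so that $U_t=\sum_n\Delta U_{\eta_n}\mathbb I_{\eta_n\le t}$. A stopping time $\eta$ is accessible if $[[\eta]]\subset\bigcup_m[[\eta_m]]$ for some sequence of predictable stopping times $\eta_m$; an enveloping sequence of an accessible $\eta$ is any such sequence of predictable stopping times with pairwise disjoint graphs. The $(R,\mathbb A)$-compensator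 of an adapted process of (locally) integrable variation is its dual predictable projection, i.e. the unique predictable process $B^U$ of finite variation such that $U-B^U$ is a local martingale. *)

theory Defs
  imports "HOL-Probability.Probability"
begin

text \<open>
  Processes are functions \<open>X t \<omega>\<close> of which only the values for \<open>t \<in> {0..T}\<close> and \<open>\<omega> \<in> space M\<close>
  matter.  The library locale \<open>filtration\<close> and its stopping times are indexed by a whole type,
  so the notions for the index set \<open>[0, T]\<close>, with times valued in \<open>[0, T] \<union> {\<infinity>}\<close>, are given here.
  Of the measures \<open>F t\<close> only space and sigma-algebra are used.
\<close>

definition standard_filtered_prob_space ::
    "'a measure \<Rightarrow> (real \<Rightarrow> 'a measure) \<Rightarrow> real \<Rightarrow> bool" where
  "standard_filtered_prob_space M F T \<longleftrightarrow>
     prob_space M \<and> complete_measure M \<and> 0 < T \<and>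
     (\<forall>t\<in>{0..T}. subalgebra M (F t)) \<and>
     (\<forall>s\<in>{0..T}. \<forall>t\<in>{0..T}. s \<le> t \<longrightarrow> sets (F s) \<subseteq> sets (F t)) \<and>
     (\<forall>t\<in>{0..<T}. sets (F t) = (\<Inter>s\<in>{t<..T}. sets (F s))) \<and>
     null_sets M \<subseteq> sets (F 0)"

subsection \<open>Processes and their paths\<close>

definition adapted_process ::
    "(real \<Rightarrow> 'a measure) \<Rightarrow> real \<Rightarrow> (real \<Rightarrow> 'a \<Rightarrow> real) \<Rightarrow> bool" where
  "adapted_process F T X \<longleftrightarrow> (\<forall>t\<in>{0..T}. X t \<in> borel_measurable (F t))"

definition cadlag_process :: "'a measure \<Rightarrow> real \<Rightarrow> (real \<Rightarrow> 'a \<Rightarrow> real) \<Rightarrow> bool" where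
  "cadlag_process M T X \<longleftrightarrow> (\<forall>\<omega>\<in>space M.
     (\<forall>t\<in>{0..<T}. ((\<lambda>s. X s \<omega>) \<longlongrightarrow> X t \<omega>) (at_right t)) \<and>
     (\<forall>t\<in>{0<..T}. \<exists>l. ((\<lambda>s. X s \<omega>) \<longlongrightarrow> l) (at_left t)))"

text \<open>
  Convention \<open>X\<^sub>0\<^sub>- = 0\<close>, hence \<open>\<Delta>X\<^sub>0 = X\<^sub>0\<close>.  A pure jump process for the other usual
  convention \<open>X\<^sub>0\<^sub>- = X\<^sub>0\<close> satisfies \<open>X\<^sub>0 = 0\<close>, so it is also covered, with the same jumps.
\<close>

definition left_limit :: "(real \<Rightarrow> 'a \<Rightarrow> real) \<Rightarrow> real \<Rightarrow> 'a \<Rightarrow> real" where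
  "left_limit X t \<omega> = (if t = 0 then 0 else Lim (at_left t) (\<lambda>s. X s \<omega>))"

definition jump :: "(real \<Rightarrow> 'a \<Rightarrow> real) \<Rightarrow> real \<Rightarrow> 'a \<Rightarrow> real" where
  "jump X t \<omega> = X t \<omega> - left_limit X t \<omega>"

definition jump_at :: "(real \<Rightarrow> 'a \<Rightarrow> real) \<Rightarrow> ('a \<Rightarrow> ereal) \<Rightarrow> 'a \<Rightarrow> real" where
  "jump_at X \<eta> \<omega> = (if \<eta> \<omega> = \<infinity> then 0 else jump X (real_of_ereal (\<eta> \<omega>)) \<omega>)"

definition pure_jump_process :: "'a measure \<Rightarrow> real \<Rightarrow> (real \<Rightarrow> 'a \<Rightarrow> real) \<Rightarrow> bool" where
  "pure_jump_process M T U \<longleftrightarrow> cadlag_process M T U \<and>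
     (AE \<omega> in M. \<forall>t\<in>{0..T}. ((\<lambda>s. jump U s \<omega>) has_sum U t \<omega>) {0..t})"

definition path_variation :: "real \<Rightarrow> (real \<Rightarrow> real) \<Rightarrow> ennreal" where
  "path_variation T f = (SUP ts\<in>{ts. sorted ts \<and> set ts \<subseteq> {0..T}}.
     \<Sum>i<length ts - 1. ennreal \<bar>f (ts ! Suc i) - f (ts ! i)\<bar>)"

text \<open>In keeping with \<open>X\<^sub>0\<^sub>- = 0\<close>, the initial value counts towards the variation.\<close>

definition integrable_variation :: "'a measure \<Rightarrow> real \<Rightarrow> (real \<Rightarrow> 'a \<Rightarrow> real) \<Rightarrow> bool" where
  "integrable_variation M T X \<longleftrightarrow>
     (\<integral>\<^sup>+ \<omega>. (ennreal \<bar>X 0 \<omega>\<bar> + path_variation T (\<lambda>t. X t \<omega>)) \<partial>M) < \<infinity>"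

definition finite_variation :: "'a measure \<Rightarrow> real \<Rightarrow> (real \<Rightarrow> 'a \<Rightarrow> real) \<Rightarrow> bool" where
  "finite_variation M T X \<longleftrightarrow> (AE \<omega> in M. path_variation T (\<lambda>t. X t \<omega>) < \<infinity>)"

subsection \<open>Random times\<close>

definition random_time :: "'a measure \<Rightarrow> real \<Rightarrow> ('a \<Rightarrow> ereal) \<Rightarrow> bool" where
  "random_time M T \<eta> \<longleftrightarrow> \<eta> \<in> borel_measurable M \<and>
     (\<forall>\<omega>\<in>space M. \<eta> \<omega> \<in> ereal ` {0..T} \<union> {\<infinity>})"

definition stop_time ::
    "'a measure \<Rightarrow> (real \<Rightarrow> 'a measure) \<Rightarrow> real \<Rightarrow> ('a \<Rightarrow> ereal) \<Rightarrow> bool" where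
  "stop_time M F T \<tau> \<longleftrightarrow> random_time M T \<tau> \<and>
     (\<forall>t\<in>{0..T}. {\<omega>\<in>space M. \<tau> \<omega> \<le> ereal t} \<in> sets (F t))"

definition time_graph :: "'a measure \<Rightarrow> ('a \<Rightarrow> ereal) \<Rightarrow> (real \<times> 'a) set" where
  "time_graph M \<tau> = {(t, \<omega>). \<omega> \<in> space M \<and> \<tau> \<omega> = ereal t}"

definition predictable_sigma ::
    "'a measure \<Rightarrow> (real \<Rightarrow> 'a measure) \<Rightarrow> real \<Rightarrow> (real \<times> 'a) measure" where
  "predictable_sigma M F T = sigma ({0..T} \<times> space M)
     ({{0} \<times> A |A. A \<in> sets (F 0)} \<union>
      {{s<..t} \<times> A |s t A. 0 \<le> s \<and> s < t \<and> t \<le> T \<and> A \<in> sets (F s)})"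

definition predictable_process ::
    "'a measure \<Rightarrow> (real \<Rightarrow> 'a measure) \<Rightarrow> real \<Rightarrow> (real \<Rightarrow> 'a \<Rightarrow> real) \<Rightarrow> bool" where
  "predictable_process M F T X \<longleftrightarrow> (\<lambda>(t, \<omega>). X t \<omega>) \<in> borel_measurable (predictable_sigma M F T)"

text \<open>A stopping time \<open>\<tau>\<close> is predictable if the stochastic interval \<open>[[0, \<tau>[[\<close> is a predictable set.\<close>

definition predictable_time ::
    "'a measure \<Rightarrow> (real \<Rightarrow> 'a measure) \<Rightarrow> real \<Rightarrow> ('a \<Rightarrow> ereal) \<Rightarrow> bool" where
  "predictable_time M F T \<tau> \<longleftrightarrow> stop_time M F T \<tau> \<and>
     {(t, \<omega>). t \<in> {0..T} \<and> \<omega> \<in> space M \<and> ereal t < \<tau> \<omega>} \<in> sets (predictable_sigma M F T)"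

definition accessible_time ::
    "'a measure \<Rightarrow> (real \<Rightarrow> 'a measure) \<Rightarrow> real \<Rightarrow> ('a \<Rightarrow> ereal) \<Rightarrow> bool" where
  "accessible_time M F T \<eta> \<longleftrightarrow> stop_time M F T \<eta> \<and>
     (\<exists>\<sigma> :: nat \<Rightarrow> 'a \<Rightarrow> ereal. (\<forall>m. predictable_time M F T (\<sigma> m)) \<and>
        time_graph M \<eta> \<subseteq> (\<Union>m. time_graph M (\<sigma> m)))"

definition enveloping_sequence ::
    "'a measure \<Rightarrow> (real \<Rightarrow> 'a measure) \<Rightarrow> real \<Rightarrow> ('a \<Rightarrow> ereal) \<Rightarrow> (nat \<Rightarrow> 'a \<Rightarrow> ereal) \<Rightarrow> bool" where
  "enveloping_sequence M F T \<eta> \<sigma> \<longleftrightarrow> (\<forall>m. predictable_time M F T (\<sigma> m)) \<and>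
     disjoint_family (\<lambda>m. time_graph M (\<sigma> m)) \<and>
     time_graph M \<eta> \<subseteq> (\<Union>m. time_graph M (\<sigma> m))"

text \<open>The sigma-algebra of events strictly before \<open>\<tau>\<close>.\<close>

definition sigma_before ::
    "'a measure \<Rightarrow> (real \<Rightarrow> 'a measure) \<Rightarrow> real \<Rightarrow> ('a \<Rightarrow> ereal) \<Rightarrow> 'a measure" where
  "sigma_before M F T \<tau> = sigma (space M)
     (sets (F 0) \<union> {{\<omega>\<in>A. ereal t < \<tau> \<omega>} |t A. t \<in> {0..T} \<and> A \<in> sets (F t)})"

subsection \<open>Jump times\<close>

definition jump_time :: "'a measure \<Rightarrow> real \<Rightarrow> (real \<Rightarrow> 'a \<Rightarrow> real) \<Rightarrow> ('a \<Rightarrow> ereal) \<Rightarrow> bool" where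
  "jump_time M T X \<eta> \<longleftrightarrow> random_time M T \<eta> \<and>
     measure M {\<omega>\<in>space M. X (real_of_ereal (\<eta> \<omega>)) \<omega> \<noteq> left_limit X (real_of_ereal (\<eta> \<omega>)) \<omega>
                          \<and> \<eta> \<omega> < \<infinity>}
       = measure M {\<omega>\<in>space M. \<eta> \<omega> < \<infinity>}"

definition accessible_jump_times_only ::
    "'a measure \<Rightarrow> (real \<Rightarrow> 'a measure) \<Rightarrow> real \<Rightarrow> (real \<Rightarrow> 'a \<Rightarrow> real) \<Rightarrow> bool" where
  "accessible_jump_times_only M F T X \<longleftrightarrow>
     (\<forall>\<eta>. stop_time M F T \<eta> \<and> jump_time M T X \<eta> \<longrightarrow> accessible_time M F T \<eta>)"

text \<open>A finite sequence of jump times is padded with times identically \<open>\<infinity>\<close>.\<close>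

definition jump_time_sequence ::
    "'a measure \<Rightarrow> (real \<Rightarrow> 'a measure) \<Rightarrow> real \<Rightarrow> (real \<Rightarrow> 'a \<Rightarrow> real) \<Rightarrow> (nat \<Rightarrow> 'a \<Rightarrow> ereal) \<Rightarrow> bool" where
  "jump_time_sequence M F T X \<eta> \<longleftrightarrow>
     (\<forall>n. stop_time M F T (\<eta> n) \<and> jump_time M T X (\<eta> n)) \<and>
     disjoint_family (\<lambda>n. time_graph M (\<eta> n)) \<and>
     (AE \<omega> in M. \<forall>t\<in>{0..T}. X t \<omega> \<noteq> left_limit X t \<omega> \<longrightarrow> (\<exists>n. \<eta> n \<omega> = ereal t))"

subsection \<open>Local martingales and compensators\<close>

definition cadlag_martingale ::
    "'a measure \<Rightarrow> (real \<Rightarrow> 'a measure) \<Rightarrow> real \<Rightarrow> (real \<Rightarrow> 'a \<Rightarrow> real) \<Rightarrow> bool" where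
  "cadlag_martingale M F T X \<longleftrightarrow> adapted_process F T X \<and> cadlag_process M T X \<and>
     (\<forall>t\<in>{0..T}. integrable M (X t)) \<and>
     (\<forall>s\<in>{0..T}. \<forall>t\<in>{0..T}. s \<le> t \<longrightarrow> (AE \<omega> in M. real_cond_exp M (F s) (X t) \<omega> = X s \<omega>))"

definition stopped_process ::
    "(real \<Rightarrow> 'a \<Rightarrow> real) \<Rightarrow> ('a \<Rightarrow> ereal) \<Rightarrow> real \<Rightarrow> 'a \<Rightarrow> real" where
  "stopped_process X \<tau> t \<omega> = X (real_of_ereal (min (ereal t) (\<tau> \<omega>))) \<omega>"

definition local_martingale ::
    "'a measure \<Rightarrow> (real \<Rightarrow> 'a measure) \<Rightarrow> real \<Rightarrow> (real \<Rightarrow> 'a \<Rightarrow> real) \<Rightarrow> bool" where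
  "local_martingale M F T X \<longleftrightarrow> adapted_process F T X \<and> cadlag_process M T X \<and>
     (\<exists>\<sigma> :: nat \<Rightarrow> 'a \<Rightarrow> ereal.
        (\<forall>k. stop_time M F T (\<sigma> k)) \<and>
        (AE \<omega> in M. incseq (\<lambda>k. \<sigma> k \<omega>) \<and> (\<exists>k. ereal T \<le> \<sigma> k \<omega>)) \<and>
        (\<forall>k. cadlag_martingale M F T (stopped_process X (\<sigma> k))))"

text \<open>
  The requirement \<open>B\<^sub>0 = U\<^sub>0\<close> is the normalisation that makes the compensator unique up to
  indistinguishability; it reads \<open>B\<^sub>0 = 0\<close> if \<open>U\<^sub>0 = 0\<close>.
\<close>

definition is_compensator ::
    "'a measure \<Rightarrow> (real \<Rightarrow> 'a measure) \<Rightarrow> real \<Rightarrow> (real \<Rightarrow> 'a \<Rightarrow> real) \<Rightarrow> (real \<Rightarrow> 'a \<Rightarrow> real) \<Rightarrow> bool" where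
  "is_compensator M F T U B \<longleftrightarrow>
     predictable_process M F T B \<and> cadlag_process M T B \<and> finite_variation M T B \<and>
     (AE \<omega> in M. B 0 \<omega> = U 0 \<omega>) \<and>
     local_martingale M F T (\<lambda>t \<omega>. U t \<omega> - B t \<omega>)"

end

theory Submission
  imports Defs
begin

text \<open>
  Write \<open>U\<close> as the series of the single jumps \<open>Z 1(\<tau> \<le> t)\<close> with \<open>Z = \<Delta>U\<^sub>\<tau> 1(\<eta> = \<tau>)\<close>, where \<open>\<tau>\<close> runs through
  all members of the enveloping sequences.  Since \<open>A \<inter> {s < \<tau> \<le> t}\<close> with \<open>A\<close> in \<open>F s\<close> lies in the
  sigma-algebra before \<open>\<tau>\<close>, replacing each \<open>Z\<close> by its conditional expectation compensates \<open>U\<close>;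
  the variation of \<open>U\<close> dominates the series of the \<open>|Z|\<close>, and predictability of \<open>\<tau>\<close> makes the
  compensating series predictable.

  Uniqueness: a predictable local martingale \<open>D\<close> of finite variation with \<open>D\<^sub>0 = 0\<close> vanishes.  After
  stopping, \<open>D\<close> has integrable variation, and \<open>E \<integral> H dD = 0\<close> for bounded predictable \<open>H\<close> by a
  monotone class argument.  With \<open>f x = sqrt (1 + x\<^sup>2)\<close>, \<open>H\<close> the difference quotient of \<open>f\<close> between
  \<open>D\<^sub>-\<close> and \<open>D\<close>, which is bounded and predictable because \<open>D\<close> is, the integral is
  \<open>f D\<^sub>T - f 0\<close>.  So \<open>f D\<^sub>T \<ge> 1\<close> has expectation \<open>1\<close>, and \<open>D\<^sub>T = 0\<close>.
\<close>

subsection \<open>Variation of a path along rational partitions\<close>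

text \<open>The convex function has to meet three demands: a bounded difference quotient, at most
  linear growth, and a minimum attained only at 0. \<open>sqrt (1 + x\<^sup>2)\<close> meets them,
  whereas the square would ask for second moments that nothing here provides. The obstacle is that
  the difference quotient over a grid cell looks at the right end of the cell, so at a fixed mesh
  the martingale property does not apply to it. Only the limit, formed from \<open>D\<^sub>-\<close>
  and \<open>D\<close> at the same instant, is a predictable integrand. Therefore the stopped
  \<open>D\<close> is written as a difference of increasing processes whose measures agree on
  predictable sets, and the Riemann sums against both are driven to one limit. Stopping controls the
  variation strictly before the stopping time only; the last jump is estimated through the stopped
  value itself, whose integrability comes from optional stopping. Of the two compensated processes
  compared, the one built from the series is a true martingale, so a single localising sequence has
  to be handled.\<close>

fun list_var :: "(real \<Rightarrow> real) \<Rightarrow> real list \<Rightarrow> real" where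
  "list_var f (a # b # ts) = \<bar>f b - f a\<bar> + list_var f (b # ts)"
| "list_var f ts = 0"

lemma list_var_sum:
  "list_var f ts = (\<Sum>i<length ts - 1. \<bar>f (ts ! Suc i) - f (ts ! i)\<bar>)"
  by (induction f ts rule: list_var.induct) (auto simp: sum.lessThan_Suc_shift simp del: sum.lessThan_Suc)

lemma list_var_nonneg: "0 \<le> list_var f ts"
  by (induction f ts rule: list_var.induct) auto

lemma list_var_snoc: "list_var f (ts @ [a, b]) = list_var f (ts @ [a]) + \<bar>f b - f a\<bar>"
proof (induction ts)
  case (Cons x ts)
  then show ?case by (cases ts) auto
qed simp

lemma list_var_map: "list_var f (map h ts) = list_var (\<lambda>t. f (h t)) ts"
  by (induction "\<lambda>t. f (h t)" ts rule: list_var.induct) auto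

lemma list_var_cong: "(\<And>t. t \<in> set ts \<Longrightarrow> f t = g t) \<Longrightarrow> list_var f ts = list_var g ts"
  by (induction f ts rule: list_var.induct) auto

lemma list_var_diff: "list_var (\<lambda>t. f t - g t) ts \<le> list_var f ts + list_var g ts"
proof (induction f ts rule: list_var.induct)
  case (1 f a b ts)
  have "\<bar>f b - g b - (f a - g a)\<bar> \<le> \<bar>f b - f a\<bar> + \<bar>g b - g a\<bar>" by linarith
  with 1 show ?case by simp
qed auto

lemma list_var_le_path_variation:
  assumes "sorted ts" "set ts \<subseteq> {0..T}"
  shows "ennreal (list_var f ts) \<le> path_variation T f"
proof -
  have "ennreal (list_var f ts) = (\<Sum>i<length ts - 1. ennreal \<bar>f (ts ! Suc i) - f (ts ! i)\<bar>)"
    by (simp add: list_var_sum sum_ennreal)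
  also have "\<dots> \<le> path_variation T f"
    unfolding path_variation_def using assms by (intro SUP_upper) auto
  finally show ?thesis .
qed

lemma path_variation_le:
  assumes "\<And>ts. sorted ts \<Longrightarrow> set ts \<subseteq> {0..T} \<Longrightarrow> list_var f ts \<le> K"
  shows "path_variation T f \<le> ennreal K"
  unfolding path_variation_def
proof (rule SUP_least)
  fix ts assume "ts \<in> {ts. sorted ts \<and> set ts \<subseteq> {0..T}}"
  then have "list_var f ts \<le> K" using assms by auto
  then show "(\<Sum>i<length ts - 1. ennreal \<bar>f (ts ! Suc i) - f (ts ! i)\<bar>) \<le> ennreal K"
    by (subst sum_ennreal) (auto simp: list_var_sum ennreal_leI)
qed

text \<open>The bounds on the single steps telescope. The intended \<open>w\<close> is an increasing
  function that dominates all increments of \<open>f\<close>.\<close>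

lemma list_var_le_increment:
  assumes "\<And>s t. s \<in> S \<Longrightarrow> t \<in> S \<Longrightarrow> s \<le> t \<Longrightarrow> \<bar>f t - f s\<bar> \<le> w t - w s"
    and "sorted (a # ts)" "set (a # ts) \<subseteq> S"
  shows "list_var f (a # ts) \<le> w (last (a # ts)) - w a"
  using assms(2,3)
proof (induction ts arbitrary: a)
  case (Cons b ts)
  have "list_var f (b # ts) \<le> w (last (b # ts)) - w b"
    using Cons by auto
  moreover have "\<bar>f b - f a\<bar> \<le> w b - w a"
    using Cons.prems by (intro assms(1)) auto
  ultimately show ?case by auto
qed simp

abbreviation bounded_list_var :: "real \<Rightarrow> (real \<Rightarrow> real) \<Rightarrow> bool" where
  "bounded_list_var T f \<equiv> \<exists>K. \<forall>ts. sorted ts \<longrightarrow> set ts \<subseteq> {0..T} \<longrightarrow> list_var f ts \<le> K"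

text \<open>Rational points keep the supremum in \<open>rat_var\<close> countable, hence measurable
  when the path is random. No horizon is built in: the paths to which this is applied are continued
  as constants.\<close>

definition rat_lists :: "real \<Rightarrow> real list set" where
  "rat_lists q = {ts. sorted ts \<and> set ts \<subseteq> \<rat> \<inter> {0..q}}"

definition rat_var :: "(real \<Rightarrow> real) \<Rightarrow> real \<Rightarrow> real" where
  "rat_var f q = (SUP ts\<in>rat_lists q. list_var f ts)"

text \<open>The right-continuous regularisation of the variation function. As a function of its end
  point, \<open>rat_var\<close> itself need not be right-continuous, nor does it see increments
  between irrational times.\<close>

definition right_var :: "(real \<Rightarrow> real) \<Rightarrow> real \<Rightarrow> real" where
  "right_var f t = (INF q\<in>\<rat> \<inter> {t<..}. rat_var f q)"

lemma countable_rat_lists: "countable (rat_lists q)"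
proof -
  have "countable (lists \<rat> :: real list set)"
    by (intro countable_lists countable_rat)
  then show ?thesis
    by (rule countable_subset[rotated]) (auto simp: rat_lists_def)
qed

lemma Nil_in_rat_lists [simp]: "[] \<in> rat_lists q"
  by (simp add: rat_lists_def)

lemma rat_lists_mono: "s \<le> t \<Longrightarrow> rat_lists s \<subseteq> rat_lists t"
  by (auto simp: rat_lists_def)

lemma rats_above_nonempty: "\<rat> \<inter> {t<..} \<noteq> ({} :: real set)"
  using Rats_dense_in_real[of t "t + 1"] by auto

lemma rat_seq_above:
  obtains p :: "nat \<Rightarrow> real" where "\<And>n. p n \<in> \<rat>" "\<And>n. t < p n" "p \<longlonglongrightarrow> t"
proof -
  have "\<forall>n::nat. \<exists>p\<in>\<rat>. t < p \<and> p < t + inverse (real (Suc n))"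
    by (intro allI Rats_dense_in_real) simp
  then obtain p :: "nat \<Rightarrow> real" where p: "\<And>n. p n \<in> \<rat>" "\<And>n. t < p n"
      "\<And>n. p n < t + inverse (real (Suc n))"
    by metis
  have "p \<longlonglongrightarrow> t"
  proof (rule tendsto_sandwich[where f = "\<lambda>_. t" and h = "\<lambda>n. t + inverse (real (Suc n))"])
    show "(\<lambda>n. t + inverse (real (Suc n))) \<longlonglongrightarrow> t"
      using tendsto_add[OF tendsto_const LIMSEQ_inverse_real_of_nat, of t] by simp
    show "(\<lambda>n. t) \<longlonglongrightarrow> t" by simp
    show "\<forall>\<^sub>F n in sequentially. t \<le> p n"
      "\<forall>\<^sub>F n in sequentially. p n \<le> t + inverse (real (Suc n))"
      using p(2,3) by (simp_all add: less_imp_le del: of_nat_Suc)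
  qed
  with p that show ?thesis by blast
qed

lemma tendsto_at_right_compose:
  fixes f :: "real \<Rightarrow> real"
  assumes "(f \<longlongrightarrow> l) (at_right t)" "\<And>n. t < p n" "p \<longlonglongrightarrow> t"
  shows "(\<lambda>n. f (p n)) \<longlonglongrightarrow> l"
proof -
  have "filterlim p (at_right t) sequentially"
    using assms(2,3) by (intro tendsto_imp_filterlim_at_right) (auto intro: always_eventually)
  then show ?thesis by (rule filterlim_compose[OF assms(1)])
qed

context
  fixes f :: "real \<Rightarrow> real" and K :: real
  assumes bound: "\<And>q ts. ts \<in> rat_lists q \<Longrightarrow> list_var f ts \<le> K"
begin

lemma bdd_rat_var: "bdd_above (list_var f ` rat_lists q)"
  using bound by (auto simp: bdd_above_def)

lemma rat_var_upper: "ts \<in> rat_lists q \<Longrightarrow> list_var f ts \<le> rat_var f q"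
  unfolding rat_var_def by (intro cSUP_upper bdd_rat_var)

lemma rat_var_least: "(\<And>ts. ts \<in> rat_lists q \<Longrightarrow> list_var f ts \<le> c) \<Longrightarrow> rat_var f q \<le> c"
  unfolding rat_var_def by (rule cSUP_least) (auto intro: exI[of _ "[]"] simp: rat_lists_def)

lemma rat_var_nonneg: "0 \<le> rat_var f q"
  using rat_var_upper[of "[]" q] by simp

lemma rat_var_mono: "s \<le> t \<Longrightarrow> rat_var f s \<le> rat_var f t"
  using rat_lists_mono by (blast intro: rat_var_least rat_var_upper)

text \<open>A rational list in \<open>{0..s}\<close> can be prolonged by \<open>s\<close> and
  \<open>t\<close>; the step from \<open>s\<close> to \<open>t\<close> then adds exactly the
  increment.\<close>

lemma rat_var_increment:
  assumes "s \<in> \<rat>" "t \<in> \<rat>" "0 \<le> s" "s \<le> t"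
  shows "rat_var f s + \<bar>f t - f s\<bar> \<le> rat_var f t"
proof -
  have "rat_var f s \<le> rat_var f t - \<bar>f t - f s\<bar>"
  proof (rule rat_var_least)
    fix ts assume ts: "ts \<in> rat_lists s"
    have "list_var f ts \<le> list_var f (ts @ [s])"
      by (induction f ts rule: list_var.induct) auto
    moreover have "list_var f (ts @ [s, t]) \<le> rat_var f t"
      using ts assms by (intro rat_var_upper) (force simp: rat_lists_def sorted_append)
    ultimately show "list_var f ts \<le> rat_var f t - \<bar>f t - f s\<bar>"
      by (simp add: list_var_snoc)
  qed
  then show ?thesis by simp
qed

lemma bdd_right_var: "bdd_below (rat_var f ` A)"
  using rat_var_nonneg by (auto simp: bdd_below_def)

lemma right_var_lower: "q \<in> \<rat> \<Longrightarrow> t < q \<Longrightarrow> right_var f t \<le> rat_var f q"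
  unfolding right_var_def by (intro cINF_lower bdd_right_var) auto

lemma right_var_greatest: "(\<And>q. q \<in> \<rat> \<Longrightarrow> t < q \<Longrightarrow> c \<le> rat_var f q) \<Longrightarrow> c \<le> right_var f t"
  unfolding right_var_def by (intro cINF_greatest rats_above_nonempty) auto

lemma right_var_bounds: "0 \<le> right_var f t" "right_var f t \<le> K"
proof -
  show "0 \<le> right_var f t" by (intro right_var_greatest rat_var_nonneg)
  obtain q where "q \<in> \<rat>" "t < q" using rats_above_nonempty[of t] by auto
  then have "right_var f t \<le> rat_var f q" by (rule right_var_lower)
  also have "\<dots> \<le> K" using bound by (intro rat_var_least)
  finally show "right_var f t \<le> K" .
qed

lemma right_var_mono: "s \<le> t \<Longrightarrow> right_var f s \<le> right_var f t"
  by (rule right_var_greatest) (auto intro: right_var_lower)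

text \<open>A rational \<open>q > t\<close> whose \<open>rat_var\<close> is close to the infimum
  bounds \<open>right_var\<close> on the whole interval between \<open>t\<close> and
  \<open>q\<close>.\<close>

lemma right_var_right_continuous: "(right_var f \<longlongrightarrow> right_var f t) (at_right t)"
proof (rule tendstoI)
  fix e :: real assume "0 < e"
  have "\<exists>q\<in>\<rat> \<inter> {t<..}. rat_var f q < right_var f t + e"
    using \<open>0 < e\<close> rats_above_nonempty[of t]
    unfolding right_var_def by (subst cINF_less_iff[symmetric]) (auto intro: bdd_right_var)
  then obtain q where q: "q \<in> \<rat>" "t < q" "rat_var f q < right_var f t + e" by auto
  have "dist (right_var f s) (right_var f t) < e" if "t < s" "s < q" for s
    using right_var_mono[of t s] right_var_lower[of q s] that q by (simp add: dist_real_def)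
  then show "\<forall>\<^sub>F s in at_right t. dist (right_var f s) (right_var f t) < e"
    using q(2) by (auto simp: eventually_at_right[of t q] intro!: exI[of _ q])
qed

text \<open>Increments between rationals are controlled by \<open>rat_var_increment\<close>.
  Right-continuity of \<open>f\<close> carries this to real times, by rationals decreasing to
  \<open>s\<close> with the upper time rational, and by rationals decreasing to \<open>t\<close>
  afterwards.\<close>

lemma right_var_increment:
  assumes rc: "\<And>t. 0 \<le> t \<Longrightarrow> (f \<longlongrightarrow> f t) (at_right t)" and st: "0 \<le> s" "s \<le> t"
  shows "\<bar>f t - f s\<bar> \<le> right_var f t - right_var f s"
proof -
  have 1: "right_var f s + \<bar>f q - f s\<bar> \<le> rat_var f q" if q: "q \<in> \<rat>" "t < q" for q
  proof -
    obtain p where p: "\<And>n. p n \<in> \<rat>" "\<And>n. s < p n" "p \<longlonglongrightarrow> s"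
      using rat_seq_above by blast
    have ev: "\<forall>\<^sub>F n in sequentially. p n < q"
      using order_tendstoD(2)[OF p(3)] st q by auto
    have "(\<lambda>n. right_var f s + \<bar>f q - f (p n)\<bar>) \<longlonglongrightarrow> right_var f s + \<bar>f q - f s\<bar>"
      using st by (intro tendsto_intros tendsto_at_right_compose[OF rc p(2,3)])
    then show ?thesis
    proof (rule tendsto_upperbound)
      show "\<forall>\<^sub>F n in sequentially. right_var f s + \<bar>f q - f (p n)\<bar> \<le> rat_var f q"
        using ev
      proof eventually_elim
        case (elim n)
        have "right_var f s \<le> rat_var f (p n)" by (intro right_var_lower p)
        with rat_var_increment[OF p(1)[of n] q(1)] elim p(2)[of n] st show ?case by simp
      qed
    qed simp
  qed
  have "right_var f s + \<bar>f t - f s\<bar> \<le> right_var f t"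
  proof (rule right_var_greatest)
    fix q assume q: "q \<in> \<rat>" "t < q"
    obtain p where p: "\<And>n. p n \<in> \<rat>" "\<And>n. t < p n" "p \<longlonglongrightarrow> t"
      using rat_seq_above by blast
    have ev: "\<forall>\<^sub>F n in sequentially. p n < q"
      using order_tendstoD(2)[OF p(3)] q by auto
    have "(\<lambda>n. right_var f s + \<bar>f (p n) - f s\<bar>) \<longlonglongrightarrow> right_var f s + \<bar>f t - f s\<bar>"
      using st by (intro tendsto_intros tendsto_at_right_compose[OF rc p(2,3)]) simp
    then show "right_var f s + \<bar>f t - f s\<bar> \<le> rat_var f q"
    proof (rule tendsto_upperbound)
      show "\<forall>\<^sub>F n in sequentially. right_var f s + \<bar>f (p n) - f s\<bar> \<le> rat_var f q"
        using ev
      proof eventually_elim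
        case (elim n)
        show ?case using 1[OF p(1,2)[of n]] rat_var_mono[of "p n" q] elim by simp
      qed
    qed simp
  qed
  then show ?thesis by simp
qed

text \<open>Beyond \<open>r\<close> the path adds no variation, so list points may be pulled back.
  They are pulled to a rational \<open>q > r\<close>, since \<open>r\<close> may be irrational and
  would leave \<open>rat_lists\<close>.\<close>

lemma right_var_flat:
  assumes flat: "\<And>t. r \<le> t \<Longrightarrow> f t = f r" and "0 \<le> r" "r \<le> t"
  shows "right_var f t = right_var f r"
proof (rule antisym)
  show "right_var f t \<le> right_var f r"
  proof (rule right_var_greatest)
    fix q assume q: "q \<in> \<rat>" "r < q"
    obtain q' where q': "q' \<in> \<rat>" "t < q'" using rats_above_nonempty[of t] by auto
    have "rat_var f q' \<le> rat_var f q"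
    proof (rule rat_var_least)
      fix ts assume ts: "ts \<in> rat_lists q'"
      \<comment> \<open>All points from \<open>q\<close> on carry the value \<open>f r\<close>, so
        cutting them at \<open>q\<close> changes no term.\<close>
      have "list_var f ts = list_var (\<lambda>t. f (min q t)) ts"
      proof (rule list_var_cong)
        fix x
        have "f x = f q" if "q \<le> x" using flat[of x] flat[of q] q that by linarith
        then show "f x = f (min q x)" by (simp add: min_def)
      qed
      also have "\<dots> = list_var f (map (min q) ts)" by (simp add: list_var_map)
      also have "\<dots> \<le> rat_var f q"
      proof (rule rat_var_upper)
        have "sorted (map (min q) ts)"
          using ts by (auto simp: rat_lists_def intro!: sorted_map_mono mono_onI)
        moreover have "min q x \<in> \<rat> \<inter> {0..q}" if "x \<in> set ts" for x
          using ts that q assms(2) by (auto simp: rat_lists_def min_def)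
        ultimately show "map (min q) ts \<in> rat_lists q" by (auto simp: rat_lists_def)
      qed
      finally show "list_var f ts \<le> rat_var f q" .
    qed
    with right_var_lower[OF q'] show "right_var f t \<le> rat_var f q" by simp
  qed
qed (use assms(3) in \<open>rule right_var_mono\<close>)

end

text \<open>Strictly before \<open>r\<close> the variation is at most \<open>k\<close>. The one step
  that may land on \<open>r\<close> costs at most \<open>\<bar>f r\<bar> + \<bar>f a\<bar>\<close>,
  and \<open>\<bar>f a\<bar> \<le> k\<close> because the path starts at 0. Nothing is assumed on the
  jump at \<open>r\<close>, so the value there has to stay in the bound.\<close>

lemma list_var_stopped_le:
  fixes f :: "real \<Rightarrow> real"
  assumes before: "\<And>ts. sorted ts \<Longrightarrow> set ts \<subseteq> \<rat> \<inter> {0..<r} \<Longrightarrow> list_var f ts \<le> k"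
    and "0 \<le> r" "f 0 = 0" "sorted ts" "set ts \<subseteq> \<rat> \<inter> {0..}"
  shows "list_var (\<lambda>t. f (min t r)) ts \<le> 2 * k + \<bar>f r\<bar>"
proof -
  have k: "0 \<le> k" using before[of "[]"] by simp
  have val: "\<bar>f a\<bar> \<le> k" if "a \<in> \<rat>" "0 \<le> a" "a < r" for a
    using before[of "[0, a]"] that assms(3) by simp
  \<comment> \<open>After cutting at \<open>r\<close> the points are rationals below
    \<open>r\<close> or \<open>r\<close> itself, which may be irrational. Steps from
    \<open>r\<close> to \<open>r\<close> contribute nothing.\<close>
  have main: "list_var f us \<le> 2 * k + \<bar>f r\<bar>"
    if "sorted us" "set us \<subseteq> \<rat> \<inter> {0..<r} \<union> {r}" for us
    using that
  proof (induction us rule: rev_induct)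
    case Nil
    show ?case using k by simp
  next
    case (snoc b us)
    show ?case
    proof (cases us rule: rev_cases)
      case Nil
      then show ?thesis using k by simp
    next
      case (snoc vs a)
      have sorted: "sorted (vs @ [a, b])" and set: "set (vs @ [a, b]) \<subseteq> \<rat> \<inter> {0..<r} \<union> {r}"
        using snoc.prems snoc by auto
      have IH: "list_var f (vs @ [a]) \<le> 2 * k + \<bar>f r\<bar>"
        using snoc.IH snoc.prems snoc by (auto simp: sorted_append)
      consider "b \<noteq> r" | "a = r" "b = r" | "a \<noteq> r" "b = r" by blast
      then show ?thesis
      proof cases
        case 1
        then have "b < r" using set by auto
        have "set (vs @ [a, b]) \<subseteq> \<rat> \<inter> {0..<r}"
        proof
          fix x assume "x \<in> set (vs @ [a, b])"
          moreover from this have "x \<le> b" using sorted by (auto simp: sorted_append)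
          ultimately show "x \<in> \<rat> \<inter> {0..<r}" using set \<open>b < r\<close> by fastforce
        qed
        then have "list_var f (vs @ [a, b]) \<le> k" using sorted by (intro before)
        then show ?thesis using k snoc by simp
      next
        case 2
        then show ?thesis using IH snoc by (simp add: list_var_snoc)
      next
        case 3
        then have "a < r" using set by auto
        have "set (vs @ [a]) \<subseteq> \<rat> \<inter> {0..<r}"
        proof
          fix x assume "x \<in> set (vs @ [a])"
          moreover from this have "x \<le> a" using sorted by (auto simp: sorted_append)
          ultimately show "x \<in> \<rat> \<inter> {0..<r}" using set \<open>a < r\<close> by fastforce
        qed
        then have "list_var f (vs @ [a]) \<le> k" "\<bar>f a\<bar> \<le> k"
          using sorted by (auto simp: sorted_append intro!: before val)
        then show ?thesis using snoc 3 by (simp add: list_var_snoc)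
      qed
    qed
  qed
  have "sorted (map (\<lambda>t. min t r) ts)"
    using assms by (auto intro!: sorted_map_mono mono_onI)
  moreover have "set (map (\<lambda>t. min t r) ts) \<subseteq> \<rat> \<inter> {0..<r} \<union> {r}"
    using assms by (auto simp: min_def)
  ultimately have "list_var f (map (\<lambda>t. min t r) ts) \<le> 2 * k + \<bar>f r\<bar>" by (rule main)
  then show ?thesis by (simp add: list_var_map)
qed

subsection \<open>Predictable processes\<close>

abbreviation after :: "('a \<Rightarrow> ereal) \<Rightarrow> real \<Rightarrow> 'a \<Rightarrow> real" where
  "after \<tau> t w \<equiv> of_bool (\<tau> w \<le> ereal t)"

text \<open>Ceiling minus one, and not the floor, so that for \<open>t > 0\<close> the mesh point is
  strictly below \<open>t\<close> even when \<open>t\<close> lies on the mesh; only then does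
  sampling there produce the left limit.\<close>

definition left_grid :: "nat \<Rightarrow> real \<Rightarrow> real" where
  "left_grid n t = (real_of_int \<lceil>t * Suc n\<rceil> - 1) / Suc n"

definition right_grid :: "real \<Rightarrow> nat \<Rightarrow> real \<Rightarrow> real" where
  "right_grid T n t = min T (real_of_int \<lceil>t * Suc n\<rceil> / Suc n)"

lemma left_grid_bounds:
  assumes "0 < t"
  shows "0 \<le> left_grid n t" "left_grid n t < t" "t - inverse (Suc n) \<le> left_grid n t"
proof -
  have "0 < t * Suc n" using assms by simp
  then have "1 \<le> \<lceil>t * Suc n\<rceil>" by linarith
  then show "0 \<le> left_grid n t" by (simp add: left_grid_def)
  have "real_of_int \<lceil>t * Suc n\<rceil> - 1 < t * Suc n" by linarith
  then show "left_grid n t < t" by (simp add: left_grid_def divide_less_eq)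
  have "t * Suc n \<le> real_of_int \<lceil>t * Suc n\<rceil>" by linarith
  then show "t - inverse (Suc n) \<le> left_grid n t"
    by (simp add: left_grid_def field_simps del: of_nat_Suc)
qed

lemma right_grid_bounds:
  assumes "0 \<le> t" "t \<le> T"
  shows "t \<le> right_grid T n t" "right_grid T n t \<le> T" "right_grid T n t \<le> t + inverse (Suc n)"
proof -
  have "t * Suc n \<le> real_of_int \<lceil>t * Suc n\<rceil>" by linarith
  then have "t \<le> real_of_int \<lceil>t * Suc n\<rceil> / Suc n" by (simp add: le_divide_eq)
  with assms show "t \<le> right_grid T n t" by (simp add: right_grid_def)
  show "right_grid T n t \<le> T" by (simp add: right_grid_def)
  have "real_of_int \<lceil>t * Suc n\<rceil> \<le> t * Suc n + 1" by linarith
  then have "real_of_int \<lceil>t * Suc n\<rceil> / Suc n \<le> t + inverse (Suc n)"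
    by (simp add: field_simps del: of_nat_Suc)
  then show "right_grid T n t \<le> t + inverse (Suc n)" by (simp add: right_grid_def)
qed

lemma left_grid_at_left:
  assumes "0 < t" shows "filterlim (\<lambda>n. left_grid n t) (at_left t) sequentially"
proof (rule tendsto_imp_filterlim_at_left)
  show "(\<lambda>n. left_grid n t) \<longlonglongrightarrow> t"
  proof (rule tendsto_sandwich[where f = "\<lambda>n. t - inverse (Suc n)" and h = "\<lambda>_. t"])
    show "(\<lambda>n. t - inverse (real (Suc n))) \<longlonglongrightarrow> t"
      using tendsto_diff[OF tendsto_const LIMSEQ_inverse_real_of_nat, of t] by simp
  qed (use left_grid_bounds[OF assms] in \<open>simp_all add: less_imp_le del: of_nat_Suc\<close>)
qed (use left_grid_bounds[OF assms] in auto)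

lemma right_grid_tendsto:
  assumes "0 \<le> t" "t \<le> T" shows "(\<lambda>n. right_grid T n t) \<longlonglongrightarrow> t"
proof (rule tendsto_sandwich[where f = "\<lambda>_. t" and h = "\<lambda>n. t + inverse (Suc n)"])
  show "(\<lambda>n. t + inverse (real (Suc n))) \<longlonglongrightarrow> t"
    using tendsto_add[OF tendsto_const LIMSEQ_inverse_real_of_nat, of t] by simp
qed (use right_grid_bounds[OF assms] in \<open>auto simp del: of_nat_Suc\<close>)

text \<open>\<open>at_right t\<close> leaves out \<open>t\<close>, but a sequence of mesh points may
  hit it; right-continuity at \<open>t\<close> allows the value there.\<close>

lemma tendsto_at_right_compose_le:
  fixes f :: "real \<Rightarrow> real"
  assumes "(f \<longlongrightarrow> f t) (at_right t)" "\<And>n. t \<le> p n" "p \<longlonglongrightarrow> t"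
  shows "(\<lambda>n. f (p n)) \<longlonglongrightarrow> f t"
proof -
  have "{t..} - {t} = {t<..} - {t}" by auto
  then have "at t within {t..} = at_right t" by (simp add: at_within_def)
  then have "continuous (at t within {t..}) f" using assms(1) by (simp add: continuous_within)
  then show ?thesis
    using assms(2,3) by (intro continuous_within_tendsto_compose[of t "{t..}" f p]) auto
qed

lemma cadlag_right:
  assumes "cadlag_process M T X" "w \<in> space M" "0 \<le> t" "t < T"
  shows "((\<lambda>s. X s w) \<longlongrightarrow> X t w) (at_right t)"
  using assms by (auto simp: cadlag_process_def)

lemma cadlag_left:
  assumes "cadlag_process M T X" "w \<in> space M" "0 < t" "t \<le> T"
  shows "((\<lambda>s. X s w) \<longlongrightarrow> left_limit X t w) (at_left t)"
proof -
  have "\<exists>l. ((\<lambda>s. X s w) \<longlongrightarrow> l) (at_left t)"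
    using assms by (simp add: cadlag_process_def)
  then obtain l where l: "((\<lambda>s. X s w) \<longlongrightarrow> l) (at_left t)" ..
  then have "Lim (at_left t) (\<lambda>s. X s w) = l"
    by (intro tendsto_Lim) simp_all
  then show ?thesis using l assms(3) by (simp add: left_limit_def)
qed

lemma cadlag_left_grid:
  assumes "cadlag_process M T X" "w \<in> space M" "0 < t" "t \<le> T"
  shows "(\<lambda>n. X (left_grid n t) w) \<longlonglongrightarrow> left_limit X t w"
  using filterlim_compose[OF cadlag_left[OF assms] left_grid_at_left] assms(3) by simp

lemma cadlag_right_grid:
  assumes "cadlag_process M T X" "w \<in> space M" "0 \<le> t" "t \<le> T"
  shows "(\<lambda>n. X (right_grid T n t) w) \<longlonglongrightarrow> X t w"
proof (cases "t < T")
  case True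
  then show ?thesis
    using assms right_grid_bounds[of t T]
    by (intro tendsto_at_right_compose_le[where f = "\<lambda>s. X s w"] cadlag_right right_grid_tendsto) auto
next
  case False
  then have "right_grid T n t = t" for n using right_grid_bounds[of t T n] assms by auto
  then show ?thesis by simp
qed

lemma cadlag_diff:
  assumes "cadlag_process M T X" "cadlag_process M T Y"
  shows "cadlag_process M T (\<lambda>t w. X t w - Y t w)"
  using assms unfolding cadlag_process_def by (fast intro: tendsto_diff)

lemma cadlag_mult_const:
  assumes "cadlag_process M T X"
  shows "cadlag_process M T (\<lambda>t w. X t w * h w)"
  using assms unfolding cadlag_process_def by (fast intro: tendsto_mult_right)

section \<open>The predictable sigma-algebra of a standard filtration\<close>

locale standard_filtration =
  fixes M :: "'a measure" and F :: "real \<Rightarrow> 'a measure" and T :: real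
  assumes standard: "standard_filtered_prob_space M F T"

sublocale standard_filtration \<subseteq> prob_space M
  using standard by (simp add: standard_filtered_prob_space_def)

context standard_filtration
begin

abbreviation "Pred \<equiv> predictable_sigma M F T"
abbreviation "stopping \<equiv> stop_time M F T"
abbreviation "predictable \<equiv> predictable_process M F T"
abbreviation "martingale \<equiv> cadlag_martingale M F T"
abbreviation "before \<equiv> sigma_before M F T"

abbreviation before_gen :: "('a \<Rightarrow> ereal) \<Rightarrow> 'a set set" where
  "before_gen \<tau> \<equiv> sets (F 0) \<union> {{w\<in>A. ereal t < \<tau> w} |t A. t \<in> {0..T} \<and> A \<in> sets (F t)}"

abbreviation int_on :: "'a set \<Rightarrow> ('a \<Rightarrow> real) \<Rightarrow> real" where
  "int_on A X \<equiv> (LINT w|M. indicator A w * X w)"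

lemma T_pos: "0 < T"
  using standard by (simp add: standard_filtered_prob_space_def)

lemma subalgebra_F: "t \<in> {0..T} \<Longrightarrow> subalgebra M (F t)"
  using standard by (simp add: standard_filtered_prob_space_def)

lemma space_F: "t \<in> {0..T} \<Longrightarrow> space (F t) = space M"
  using subalgebra_F by (auto simp: subalgebra_def)

lemma sets_F: "t \<in> {0..T} \<Longrightarrow> A \<in> sets (F t) \<Longrightarrow> A \<in> sets M"
  using subalgebra_F by (auto simp: subalgebra_def)

lemma sets_F_mono: "0 \<le> s \<Longrightarrow> s \<le> t \<Longrightarrow> t \<le> T \<Longrightarrow> A \<in> sets (F s) \<Longrightarrow> A \<in> sets (F t)"
  using standard unfolding standard_filtered_prob_space_def by (meson atLeastAtMost_iff order_trans subsetD)

lemma sets_F_right: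
  assumes "0 \<le> t" "t < T" "\<And>s. t < s \<Longrightarrow> s \<le> T \<Longrightarrow> A \<in> sets (F s)"
  shows "A \<in> sets (F t)"
proof -
  have "sets (F t) = (\<Inter>s\<in>{t<..T}. sets (F s))"
    using standard assms by (simp add: standard_filtered_prob_space_def)
  then show ?thesis using assms by auto
qed

lemma null_sets_F0: "N \<in> null_sets M \<Longrightarrow> N \<in> sets (F 0)"
  using standard by (auto simp: standard_filtered_prob_space_def)

lemma null_sets_subset: "N \<in> null_sets M \<Longrightarrow> A \<subseteq> N \<Longrightarrow> A \<in> null_sets M"
  using standard by (simp add: standard_filtered_prob_space_def complete_measure.complete2)

lemma AE_null_set: "(AE w in M. P w) \<Longrightarrow> {w\<in>space M. \<not> P w} \<in> null_sets M"
  by (erule AE_E) (auto intro: null_sets_subset null_setsI)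

lemma measurable_F_M: "t \<in> {0..T} \<Longrightarrow> h \<in> borel_measurable (F t) \<Longrightarrow> h \<in> borel_measurable M"
  by (rule measurable_from_subalg[OF subalgebra_F])

lemma measurable_F_mono:
  assumes "0 \<le> s" "s \<le> t" "t \<le> T" "h \<in> borel_measurable (F s)"
  shows "h \<in> borel_measurable (F t)"
proof -
  have "subalgebra (F t) (F s)"
    using assms sets_F_mono[of s t] space_F by (auto simp: subalgebra_def)
  then show ?thesis using assms(4) by (rule measurable_from_subalg)
qed

lemma finite_measure_subalgebra_F: "t \<in> {0..T} \<Longrightarrow> finite_measure_subalgebra M (F t)"
  by (intro finite_measure_subalgebra.intro finite_measure_subalgebra_axioms.intro
      finite_measure_axioms subalgebra_F)

definition pred_gen :: "(real \<times> 'a) set set" where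
  "pred_gen = {{0} \<times> A |A. A \<in> sets (F 0)} \<union>
      {{s<..t} \<times> A |s t A. 0 \<le> s \<and> s < t \<and> t \<le> T \<and> A \<in> sets (F s)}"

lemma pred_gen_subset: "pred_gen \<subseteq> Pow ({0..T} \<times> space M)"
proof -
  have "A \<subseteq> space M" if "t \<in> {0..T}" "A \<in> sets (F t)" for t A
    using sets.sets_into_space[OF that(2)] space_F[OF that(1)] by simp
  then show ?thesis using T_pos by (fastforce simp: pred_gen_def)
qed

lemma space_Pred [simp]: "space Pred = {0..T} \<times> space M"
  and sets_Pred: "sets Pred = sigma_sets ({0..T} \<times> space M) pred_gen"
  using pred_gen_subset by (auto simp: predictable_sigma_def pred_gen_def)

lemma Pred_Compl: "A \<in> sets Pred \<Longrightarrow> {0..T} \<times> space M - A \<in> sets Pred"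
  using sets.compl_sets[of A Pred] by simp

lemma Pred_rect:
  assumes "0 \<le> s" "t \<le> T" "A \<in> sets (F s)"
  shows "{s<..t} \<times> A \<in> sets Pred"
proof (cases "s < t")
  case True
  with assms have "{s<..t} \<times> A \<in> pred_gen" by (auto simp: pred_gen_def)
  then show ?thesis by (simp add: sets_Pred sigma_sets.Basic)
qed simp

lemma Pred_zero: "A \<in> sets (F 0) \<Longrightarrow> {0} \<times> A \<in> sets Pred"
  by (auto simp: sets_Pred pred_gen_def intro!: sigma_sets.Basic)

lemma Pred_after:
  assumes "0 \<le> s" "s \<le> T" "A \<in> sets (F s)"
  shows "{s<..T} \<times> A \<in> sets Pred"
  using assms by (intro Pred_rect) auto

lemma Pred_cylinder:
  assumes "A \<in> sets (F 0)" shows "{0..T} \<times> A \<in> sets Pred"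
proof -
  have "{0..T} \<times> A = {0} \<times> A \<union> {0<..T} \<times> A" using T_pos by auto
  moreover have "{0} \<times> A \<in> sets Pred" "{0<..T} \<times> A \<in> sets Pred"
    using assms T_pos by (auto intro: Pred_zero Pred_after)
  ultimately show ?thesis by simp
qed

lemma measurable_Pred:
  assumes "\<And>x. x \<in> space N \<Longrightarrow> \<phi> x \<in> {0..T} \<times> space M"
    and "\<And>A. A \<in> sets (F 0) \<Longrightarrow> {x\<in>space N. fst (\<phi> x) = 0 \<and> snd (\<phi> x) \<in> A} \<in> sets N"
    and "\<And>s t A. 0 \<le> s \<Longrightarrow> s < t \<Longrightarrow> t \<le> T \<Longrightarrow> A \<in> sets (F s) \<Longrightarrow>
           {x\<in>space N. s < fst (\<phi> x) \<and> fst (\<phi> x) \<le> t \<and> snd (\<phi> x) \<in> A} \<in> sets N"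
  shows "\<phi> \<in> measurable N Pred"
proof (rule measurable_sigma_sets[OF sets_Pred pred_gen_subset])
  show "\<phi> \<in> space N \<rightarrow> {0..T} \<times> space M" using assms(1) by auto
  fix B assume "B \<in> pred_gen"
  then consider A where "B = {0} \<times> A" "A \<in> sets (F 0)"
    | s t A where "B = {s<..t} \<times> A" "0 \<le> s" "s < t" "t \<le> T" "A \<in> sets (F s)"
    by (auto simp: pred_gen_def)
  then show "\<phi> -` B \<inter> space N \<in> sets N"
  proof cases
    case 1
    have "\<phi> -` B \<inter> space N = {x\<in>space N. fst (\<phi> x) = 0 \<and> snd (\<phi> x) \<in> A}"
      using 1 by (auto simp: mem_Times_iff)
    with assms(2) 1 show ?thesis by simp
  next
    case 2
    have "\<phi> -` B \<inter> space N = {x\<in>space N. s < fst (\<phi> x) \<and> fst (\<phi> x) \<le> t \<and> snd (\<phi> x) \<in> A}"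
      using 2 by (auto simp: mem_Times_iff)
    with assms(3) 2 show ?thesis by simp
  qed
qed

lemma measurable_Pair_Pred:
  assumes [measurable]: "f \<in> borel_measurable N" "g \<in> measurable N M"
    and f: "\<And>x. x \<in> space N \<Longrightarrow> f x \<in> {0..T}"
  shows "(\<lambda>x. (f x, g x)) \<in> measurable N Pred"
proof (rule measurable_Pred)
  fix x assume "x \<in> space N"
  then show "(f x, g x) \<in> {0..T} \<times> space M"
    using f measurable_space[OF assms(2)] by auto
next
  fix A assume "A \<in> sets (F 0)"
  then have [measurable]: "A \<in> sets M" using sets_F[of 0] T_pos by auto
  show "{x\<in>space N. fst (f x, g x) = 0 \<and> snd (f x, g x) \<in> A} \<in> sets N" by simp
next
  fix s t A assume "0 \<le> s" "s < t" "t \<le> T" "A \<in> sets (F s)"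
  then have [measurable]: "A \<in> sets M" using sets_F[of s] by auto
  show "{x\<in>space N. s < fst (f x, g x) \<and> fst (f x, g x) \<le> t \<and> snd (f x, g x) \<in> A} \<in> sets N"
    by simp
qed

text \<open>At a fixed time \<open>t\<close> a generating rectangle over \<open>{s<..u}\<close> is
  met only if \<open>s < t\<close>, and then its base in \<open>F s\<close> lies in
  \<open>F t\<close>. This is why predictable processes are adapted.\<close>

lemma Pred_section:
  assumes "t \<in> {0..T}" shows "(\<lambda>w. (t, w)) \<in> measurable (F t) Pred"
proof (rule measurable_Pred)
  fix A assume "A \<in> sets (F 0)"
  then have "A \<in> sets (F t)" using assms by (intro sets_F_mono[of 0 t]) auto
  then show "{w\<in>space (F t). fst (t, w) = 0 \<and> snd (t, w) \<in> A} \<in> sets (F t)"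
    using sets.sets_into_space by (cases "t = 0") (auto simp: Collect_conj_eq Int_absorb1)
next
  fix s u A assume "0 \<le> s" "s < u" "u \<le> T" "A \<in> sets (F s)"
  then have "A \<in> sets (F t)" if "s < t" using assms that by (intro sets_F_mono[of s t]) auto
  then show "{w\<in>space (F t). s < fst (t, w) \<and> fst (t, w) \<le> u \<and> snd (t, w) \<in> A} \<in> sets (F t)"
    using sets.sets_into_space by (cases "s < t \<and> t \<le> u") (auto simp: Collect_conj_eq Int_absorb1)
qed (use assms in \<open>auto simp: space_F\<close>)

lemma predictable_adapted:
  assumes "predictable X" shows "adapted_process F T X"
  unfolding adapted_process_def
proof
  fix t assume "t \<in> {0..T}"
  from measurable_comp[OF Pred_section[OF this] assms[unfolded predictable_process_def]]
  show "X t \<in> borel_measurable (F t)" by (simp add: comp_def)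
qed

text \<open>Viewed on the product, \<open>h\<close> alone gives cylinders that need not be
  predictable; only their parts inside \<open>Q\<close> have to be. Taking \<open>S = UNIV\<close>
  shows that the complement of \<open>Q\<close> is predictable too.\<close>

lemma Pred_If_measurable:
  fixes h :: "'a \<Rightarrow> real"
  assumes "\<And>S. S \<in> sets borel \<Longrightarrow> {p\<in>{0..T} \<times> space M. p \<in> Q \<and> h (snd p) \<in> S} \<in> sets Pred"
  shows "(\<lambda>p. if p \<in> Q then h (snd p) else 0) \<in> borel_measurable Pred"
proof (rule measurableI)
  fix S :: "real set" assume S: "S \<in> sets borel"
  define Z where "Z = {p\<in>{0..T} \<times> space M. p \<notin> Q}"
  have "Z = {0..T} \<times> space M - {p\<in>{0..T} \<times> space M. p \<in> Q \<and> h (snd p) \<in> UNIV}"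
    by (auto simp: Z_def)
  then have "Z \<in> sets Pred" using Pred_Compl[OF assms[of UNIV]] by simp
  moreover have "(\<lambda>p. if p \<in> Q then h (snd p) else 0) -` S \<inter> space Pred =
      {p\<in>{0..T} \<times> space M. p \<in> Q \<and> h (snd p) \<in> S} \<union> (if 0 \<in> S then Z else {})"
    by (auto simp: Z_def split: if_splits)
  ultimately show "(\<lambda>p. if p \<in> Q then h (snd p) else 0) -` S \<inter> space Pred \<in> sets Pred"
    using assms[OF S] by auto
qed auto

lemma fst_measurable_Pred [measurable]: "fst \<in> borel_measurable Pred"
proof (rule borel_measurableI_le)
  fix y :: real
  have "space M \<in> sets (F 0)" using sets.top[of "F 0"] space_F[of 0] T_pos by auto
  then have "{0<..min y T} \<times> space M \<in> sets Pred" "{0} \<times> space M \<in> sets Pred"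
    by (auto intro: Pred_rect Pred_zero)
  moreover have "{p\<in>space Pred. fst p \<le> y} =
      (if y < 0 then {} else {0} \<times> space M \<union> {0<..min y T} \<times> space M)"
    using T_pos by auto
  ultimately show "{p\<in>space Pred. fst p \<le> y} \<in> sets Pred" by auto
qed

text \<open>The value of \<open>X\<close> at a mesh time \<open>a\<close>, used only on
  \<open>{a<..T}\<close>, is a predictable process. Sampling at the mesh point strictly left of the
  current time glues countably many of these, and refining the mesh gives the left limit.\<close>

lemma left_limit_measurable_Pred:
  assumes ad: "adapted_process F T X" and cad: "cadlag_process M T X"
  shows "predictable (left_limit X)"
  unfolding predictable_process_def
proof (rule borel_measurable_LIMSEQ_real)
  define G where "G n i p = (if p \<in> {i / real (Suc n)<..T} \<times> space M \<and> 0 \<le> i / real (Suc n)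
     then X (i / real (Suc n)) (snd p) else 0)" for n :: nat and i :: real and p :: "real \<times> 'a"
  have G: "G n i \<in> borel_measurable Pred" for n i
  proof -
    let ?a = "i / real (Suc n)"
    have "(\<lambda>p. if p \<in> (if 0 \<le> ?a then {?a<..T} \<times> space M else {}) then X ?a (snd p) else 0)
        \<in> borel_measurable Pred"
    proof (rule Pred_If_measurable)
      fix S :: "real set" assume "S \<in> sets borel"
      consider "0 \<le> ?a" "?a \<le> T" | "?a < 0" | "T < ?a" by linarith
      then show "{p\<in>{0..T} \<times> space M. p \<in> (if 0 \<le> ?a then {?a<..T} \<times> space M else {}) \<and>
          X ?a (snd p) \<in> S} \<in> sets Pred"
      proof cases
        case 1
        have "X ?a \<in> borel_measurable (F ?a)" using ad 1 by (simp add: adapted_process_def)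
        from measurable_sets[OF this \<open>S \<in> sets borel\<close>]
        have "X ?a -` S \<inter> space M \<in> sets (F ?a)" using 1 space_F[of ?a] by simp
        then have "{?a<..T} \<times> (X ?a -` S \<inter> space M) \<in> sets Pred" using 1 by (intro Pred_after)
        also have "{?a<..T} \<times> (X ?a -` S \<inter> space M) = {p\<in>{0..T} \<times> space M. p \<in> (if 0 \<le> ?a then {?a<..T} \<times> space M else {}) \<and>
          X ?a (snd p) \<in> S}" using 1 by auto
        finally show ?thesis .
      qed auto
    qed
    also have "(\<lambda>p. if p \<in> (if 0 \<le> ?a then {?a<..T} \<times> space M else {}) then X ?a (snd p) else 0) = G n i"
      by (auto simp: G_def fun_eq_iff)
    finally show ?thesis .
  qed
  show "(\<lambda>p. G n (real_of_int (\<lceil>fst p * Suc n\<rceil> - 1)) p) \<in> borel_measurable Pred" for n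
    by (rule measurable_compose_countable[of "\<lambda>i. G n (real_of_int (i - 1))"])
       (auto intro: G)
  fix p assume p: "p \<in> space Pred"
  obtain t w where [simp]: "p = (t, w)" by (cases p)
  show "(\<lambda>n. G n (real_of_int (\<lceil>fst p * Suc n\<rceil> - 1)) p) \<longlonglongrightarrow> (case p of (t, w) \<Rightarrow> left_limit X t w)"
  proof (cases "t = 0")
    case True
    \<comment> \<open>At time 0 the mesh index is -1, so \<open>G\<close> takes its default 0, in
      accordance with the convention \<open>X\<^sub>0\<^sub>- = 0\<close>.\<close>
    then show ?thesis by (simp add: G_def left_limit_def)
  next
    case False
    then have t: "0 < t" "t \<le> T" "w \<in> space M" using p by auto
    have "G n (real_of_int (\<lceil>fst p * Suc n\<rceil> - 1)) p = X (left_grid n t) w" for n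
      using left_grid_bounds[of t n] t by (auto simp: G_def left_grid_def simp del: of_nat_Suc)
    then show ?thesis using cadlag_left_grid[OF cad t(3,1,2)] by simp
  qed
qed

section \<open>Events strictly before a stopping time, and random times inserted into
  processes\<close>

lemma sigma_before_subset:
  assumes "stopping \<tau>"
  shows "before_gen \<tau> \<subseteq> sets M"
proof -
  have [measurable]: "\<tau> \<in> borel_measurable M"
    using assms by (simp add: stop_time_def random_time_def)
  have "{w\<in>A. ereal t < \<tau> w} \<in> sets M" if "t \<in> {0..T}" "A \<in> sets (F t)" for t A
  proof -
    have [measurable]: "A \<in> sets M" using that by (rule sets_F)
    have "{w\<in>A. ereal t < \<tau> w} = A \<inter> {w\<in>space M. ereal t < \<tau> w}"
      using sets.sets_into_space[OF \<open>A \<in> sets M\<close>] by auto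
    then show ?thesis by simp
  qed
  moreover have "sets (F 0) \<subseteq> sets M" using sets_F[of 0] T_pos by auto
  ultimately show ?thesis by blast
qed

lemma
  assumes "stopping \<tau>"
  shows space_sigma_before: "space (before \<tau>) = space M"
    and sets_sigma_before: "sets (before \<tau>) = sigma_sets (space M) (before_gen \<tau>)"
proof -
  have "before_gen \<tau> \<subseteq> Pow (space M)"
    using sigma_before_subset[OF assms] sets.space_closed[of M] by (rule order_trans)
  then show "space (before \<tau>) = space M"
    "sets (before \<tau>) = sigma_sets (space M) (before_gen \<tau>)"
    unfolding sigma_before_def by (simp_all add: space_measure_of sets_measure_of)
qed

lemma subalgebra_sigma_before:
  assumes "stopping \<tau>" shows "subalgebra M (before \<tau>)"
  unfolding subalgebra_def
  using sets.sigma_sets_subset[OF sigma_before_subset[OF assms]]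
  by (simp add: space_sigma_before[OF assms] sets_sigma_before[OF assms])

lemma finite_measure_subalgebra_sigma_before:
  "stopping \<tau> \<Longrightarrow> finite_measure_subalgebra M (before \<tau>)"
  by (intro finite_measure_subalgebra.intro finite_measure_subalgebra_axioms.intro
      finite_measure_axioms subalgebra_sigma_before)

lemma F0_sigma_before:
  "stopping \<tau> \<Longrightarrow> A \<in> sets (F 0) \<Longrightarrow> A \<in> sets (before \<tau>)"
  by (simp add: sets_sigma_before sigma_sets.Basic)

lemma before_sigma_before:
  "stopping \<tau> \<Longrightarrow> t \<in> {0..T} \<Longrightarrow> A \<in> sets (F t) \<Longrightarrow>
    {w\<in>A. ereal t < \<tau> w} \<in> sets (before \<tau>)"
  by (subst sets_sigma_before) (auto intro!: sigma_sets.Basic)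

lemma after_Pred:
  assumes "predictable_time M F T \<tau>"
  shows "{(t, w). t \<in> {0..T} \<and> w \<in> space M \<and> \<tau> w \<le> ereal t} \<in> sets Pred"
proof -
  have "{(t, w). t \<in> {0..T} \<and> w \<in> space M \<and> \<tau> w \<le> ereal t} =
      {0..T} \<times> space M - {(t, w). t \<in> {0..T} \<and> w \<in> space M \<and> ereal t < \<tau> w}" by auto
  moreover have "{(t, w). t \<in> {0..T} \<and> w \<in> space M \<and> ereal t < \<tau> w} \<in> sets Pred"
    using assms by (simp add: predictable_time_def)
  ultimately show ?thesis using Pred_Compl by simp
qed

text \<open>Induction over the generators of the sigma-algebra before \<open>\<tau>\<close>. An
  event \<open>A\<close> of the form \<open>B\<close> intersected with \<open>u < \<tau>\<close>
  lies in \<open>F u\<close>, and on it \<open>\<tau> w \<le> ereal t\<close> forces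
  \<open>u < t\<close>; so it suffices to intersect the interval from \<open>\<tau>\<close> on with
  the predictable rectangle \<open>{u<..T} \<times> A\<close>.\<close>

lemma after_Int_Pred:
  assumes \<tau>: "predictable_time M F T \<tau>" and "A \<in> sets (before \<tau>)"
  shows "{(t, w). t \<in> {0..T} \<and> w \<in> A \<and> \<tau> w \<le> ereal t} \<in> sets Pred"
proof -
  let ?Q = "{(t, w). t \<in> {0..T} \<and> w \<in> space M \<and> \<tau> w \<le> ereal t}"
  have st: "stopping \<tau>" using \<tau> by (simp add: predictable_time_def)
  have sp: "A \<in> sets (before \<tau>) \<Longrightarrow> A \<subseteq> space M" for A
    using sets.sets_into_space space_sigma_before[OF st] by fastforce
  from assms(2) have "A \<in> sigma_sets (space M) (before_gen \<tau>)"
    by (simp add: sets_sigma_before[OF st])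
  then show ?thesis
  proof induction
    case (Basic A)
    then consider "A \<in> sets (F 0)"
      | u B where "A = {w\<in>B. ereal u < \<tau> w}" "u \<in> {0..T}" "B \<in> sets (F u)" by auto
    then show ?case
    proof cases
      case 1
      have "{(t, w). t \<in> {0..T} \<and> w \<in> A \<and> \<tau> w \<le> ereal t} = ?Q \<inter> {0..T} \<times> A"
        using sets.sets_into_space[OF 1] space_F[of 0] T_pos by auto
      then show ?thesis using after_Pred[OF \<tau>] Pred_cylinder[OF 1] by auto
    next
      case 2
      have "{w\<in>space M. \<tau> w \<le> ereal u} \<in> sets (F u)" using st 2 by (simp add: stop_time_def)
      then have "B - {w\<in>space M. \<tau> w \<le> ereal u} \<in> sets (F u)" using 2 by auto
      also have "B - {w\<in>space M. \<tau> w \<le> ereal u} = A"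
        using sets.sets_into_space[OF 2(3)] space_F[OF 2(2)] 2 by auto
      finally have "A \<in> sets (F u)" .
      then have "{u<..T} \<times> A \<in> sets Pred" using 2 by (intro Pred_after) auto
      moreover have "{(t, w). t \<in> {0..T} \<and> w \<in> A \<and> \<tau> w \<le> ereal t} = ?Q \<inter> {u<..T} \<times> A"
        using 2 sets.sets_into_space[OF 2(3)] space_F[OF 2(2)]
        by (auto dest: less_le_trans)
      ultimately show ?thesis using after_Pred[OF \<tau>] by auto
    qed
  next
    case Empty
    then show ?case by simp
  next
    case (Compl A)
    have "{(t, w). t \<in> {0..T} \<and> w \<in> space M - A \<and> \<tau> w \<le> ereal t} =
        ?Q - {(t, w). t \<in> {0..T} \<and> w \<in> A \<and> \<tau> w \<le> ereal t}" by auto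
    then show ?case using Compl.IH after_Pred[OF \<tau>] by auto
  next
    case (Union A)
    have "{(t, w). t \<in> {0..T} \<and> w \<in> (\<Union>i. A i) \<and> \<tau> w \<le> ereal t} =
        (\<Union>i. {(t, w). t \<in> {0..T} \<and> w \<in> A i \<and> \<tau> w \<le> ereal t})" by auto
    then show ?case using Union.IH by auto
  qed
qed

text \<open>A jump at a predictable time whose size is known strictly before that time is itself
  predictable. Each term of the compensating series has this form.\<close>

lemma predictable_after:
  fixes c :: "'a \<Rightarrow> real"
  assumes \<tau>: "predictable_time M F T \<tau>" and c: "c \<in> borel_measurable (before \<tau>)"
  shows "predictable (\<lambda>t w. c w * after \<tau> t w)"
proof -
  have st: "stopping \<tau>" using \<tau> by (simp add: predictable_time_def)
  have "(\<lambda>p. if p \<in> {(t, w). \<tau> w \<le> ereal t} then c (snd p) else 0) \<in> borel_measurable Pred"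
  proof (rule Pred_If_measurable)
    fix S :: "real set" assume "S \<in> sets borel"
    then have "c -` S \<inter> space M \<in> sets (before \<tau>)"
      using measurable_sets[OF c] space_sigma_before[OF st] by auto
    from after_Int_Pred[OF \<tau> this]
    show "{p\<in>{0..T} \<times> space M. p \<in> {(t, w). \<tau> w \<le> ereal t} \<and> c (snd p) \<in> S} \<in> sets Pred"
      by (rule back_subst[of "\<lambda>x. x \<in> sets Pred"]) auto
  qed
  then show ?thesis
    unfolding predictable_process_def
    by (rule back_subst[of "\<lambda>x. x \<in> borel_measurable Pred"]) (auto simp: fun_eq_iff)
qed


text \<open>Rounded up to a mesh, the random time takes countably many values; right-continuity
  recovers the value at the time itself.\<close>

lemma measurable_at_random_time:
  assumes "\<And>t. t \<in> {0..T} \<Longrightarrow> X t \<in> borel_measurable M" and cad: "cadlag_process M T X"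
    and [measurable]: "f \<in> borel_measurable M" and f: "\<And>w. w \<in> space M \<Longrightarrow> f w \<in> {0..T}"
  shows "(\<lambda>w. X (f w) w) \<in> borel_measurable M"
proof (rule borel_measurable_LIMSEQ_real[where u = "\<lambda>n w. X (right_grid T n (f w)) w"])
  show "(\<lambda>w. X (right_grid T n (f w)) w) \<in> borel_measurable M" for n
  proof -
    \<comment> \<open>The clamp into \<open>[0, T]\<close> gives every integer index an admissible
      time; at the indices that actually occur it agrees with \<open>right_grid\<close>.\<close>
    have "(\<lambda>w. (\<lambda>i w. X (max 0 (min T (real_of_int i / Suc n))) w) \<lceil>f w * Suc n\<rceil> w) \<in> borel_measurable M"
    proof (rule measurable_compose_countable[where f = "\<lambda>i. X (max 0 (min T (real_of_int i / Suc n)))"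
          and g = "\<lambda>w. \<lceil>f w * Suc n\<rceil>"])
      show "X (max 0 (min T (real_of_int i / Suc n))) \<in> borel_measurable M" for i
        using T_pos by (intro assms(1)) auto
    qed measurable
    then show ?thesis
    proof (rule measurable_cong[THEN iffD1, rotated])
      fix w assume "w \<in> space M"
      then show "X (max 0 (min T (real_of_int \<lceil>f w * Suc n\<rceil> / Suc n))) w = X (right_grid T n (f w)) w"
        using right_grid_bounds[of "f w" T n] f[of w] by (auto simp: right_grid_def max_def)
    qed
  qed
  show "(\<lambda>n. X (right_grid T n (f w)) w) \<longlonglongrightarrow> X (f w) w" if "w \<in> space M" for w
    using cadlag_right_grid[OF cad that] f[OF that] by auto
qed

text \<open>The left limit at a random time is a predictable process composed with
  \<open>w \<mapsto> (f w, w)\<close>. Infinite times are moved to 0 so that the pair stays in the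
  product; the final case distinction puts the jump 0 back there.\<close>

lemma jump_at_measurable:
  assumes ad: "adapted_process F T X" and cad: "cadlag_process M T X" and "random_time M T \<tau>"
  shows "jump_at X \<tau> \<in> borel_measurable M"
proof -
  define f where "f w = (if \<tau> w = \<infinity> then 0 else real_of_ereal (\<tau> w))" for w
  have [measurable]: "\<tau> \<in> borel_measurable M" and \<tau>: "\<And>w. w \<in> space M \<Longrightarrow> \<tau> w \<in> ereal ` {0..T} \<union> {\<infinity>}"
    using assms(3) by (auto simp: random_time_def)
  have [measurable]: "f \<in> borel_measurable M" unfolding f_def by simp
  have f: "f w \<in> {0..T}" if "w \<in> space M" for w
    using \<tau>[OF that] T_pos by (auto simp: f_def)
  have [measurable]: "(\<lambda>w. X (f w) w) \<in> borel_measurable M"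
    by (rule measurable_at_random_time[OF _ cad])
       (use ad f in \<open>auto simp: adapted_process_def intro: measurable_F_M\<close>)
  have "(\<lambda>w. (f w, w)) \<in> measurable M Pred" using f by (intro measurable_Pair_Pred) auto
  from measurable_comp[OF this left_limit_measurable_Pred[OF ad cad, unfolded predictable_process_def]]
  have [measurable]: "(\<lambda>w. left_limit X (f w) w) \<in> borel_measurable M" by (simp add: comp_def)
  have "(\<lambda>w. if \<tau> w = \<infinity> then 0 else X (f w) w - left_limit X (f w) w) \<in> borel_measurable M" by simp
  also have "(\<lambda>w. if \<tau> w = \<infinity> then 0 else X (f w) w - left_limit X (f w) w) = jump_at X \<tau>"
    by (auto simp: jump_at_def jump_def f_def fun_eq_iff)
  finally show ?thesis .
qed

end

subsection \<open>Stieltjes measures by time change\<close>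

context standard_filtration
begin

definition inverse_time :: "(real \<Rightarrow> 'a \<Rightarrow> real) \<Rightarrow> 'a \<Rightarrow> real \<Rightarrow> real" where
  "inverse_time P w u = Inf {t\<in>{0..T}. u \<le> P t w}"

text \<open>
  Under \<open>u \<mapsto> inverse_time P w u\<close>, Lebesgue measure on \<open>{P 0 w<..P T w}\<close> is mapped to the Stieltjes
  measure of the increasing path \<open>P\<close>; integrals against \<open>dP\<close> under the expectation thus become
  integrals over a measurable region of the product space.
\<close>

abbreviation clock_graph :: "(real \<Rightarrow> 'a \<Rightarrow> real) \<Rightarrow> ('a \<times> real) set" where
  "clock_graph P \<equiv> {(w, u). w \<in> space M \<and> P 0 w < u \<and> u \<le> P T w}"

definition clock_space :: "(real \<Rightarrow> 'a \<Rightarrow> real) \<Rightarrow> ('a \<times> real) measure" where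
  "clock_space P = restrict_space (M \<Otimes>\<^sub>M lborel) (clock_graph P)"

definition clock :: "(real \<Rightarrow> 'a \<Rightarrow> real) \<Rightarrow> 'a \<times> real \<Rightarrow> real \<times> 'a" where
  "clock P = (\<lambda>(w, u). (inverse_time P w u, w))"

text \<open>The Doleans measure of \<open>P\<close> on predictable sets:
  \<open>{s<..t} \<times> A\<close> with \<open>A\<close> in \<open>F s\<close> receives the
  expectation of the increment of \<open>P\<close> over \<open>A\<close>. Time 0 carries no mass,
  because the clock region lies strictly above \<open>P 0 w\<close>.\<close>

abbreviation "doleans P \<equiv> distr (clock_space P) Pred (clock P)"

text \<open>Adaptedness is left out on purpose: the variation process used later is defined through
  rational times after the current one, and all that enters is its integrals over events.\<close>

definition increasing_process :: "(real \<Rightarrow> 'a \<Rightarrow> real) \<Rightarrow> bool" where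
  "increasing_process P \<longleftrightarrow>
     (\<forall>w\<in>space M. mono_on {0..T} (\<lambda>t. P t w)) \<and>
     (\<forall>w\<in>space M. \<forall>t\<in>{0..<T}. ((\<lambda>s. P s w) \<longlongrightarrow> P t w) (at_right t)) \<and>
     (\<forall>t\<in>{0..T}. integrable M (P t))"

context
  fixes P :: "real \<Rightarrow> 'a \<Rightarrow> real"
  assumes incr: "increasing_process P"
begin

lemma increasing_mono: "w \<in> space M \<Longrightarrow> 0 \<le> s \<Longrightarrow> s \<le> t \<Longrightarrow> t \<le> T \<Longrightarrow> P s w \<le> P t w"
  using incr by (auto simp: increasing_process_def mono_on_def)

lemma increasing_integrable: "t \<in> {0..T} \<Longrightarrow> integrable M (P t)"
  using incr by (simp add: increasing_process_def)

lemma increasing_measurable: "t \<in> {0..T} \<Longrightarrow> P t \<in> borel_measurable M"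
  using increasing_integrable by blast

lemma increasing_endpoints [measurable]: "P 0 \<in> borel_measurable M" "P T \<in> borel_measurable M"
  using T_pos by (auto intro: increasing_measurable)

lemma clock_region [measurable]:
  "clock_graph P \<in> sets (M \<Otimes>\<^sub>M lborel)"
proof -
  have "{x\<in>space (M \<Otimes>\<^sub>M lborel). P 0 (fst x) < snd x \<and> snd x \<le> P T (fst x)} \<in> sets (M \<Otimes>\<^sub>M lborel)"
    by measurable
  then show ?thesis
    by (rule back_subst[of "\<lambda>x. x \<in> sets (M \<Otimes>\<^sub>M lborel)"]) (auto simp: space_pair_measure)
qed

lemma space_clock_space:
  "space (clock_space P) = clock_graph P"
  by (auto simp: clock_space_def space_restrict_space space_pair_measure)

lemma clock_space_fst [measurable]: "fst \<in> measurable (clock_space P) M"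
  unfolding clock_space_def by (intro measurable_restrict_space1) simp

lemma clock_space_snd [measurable]: "snd \<in> borel_measurable (clock_space P)"
  unfolding clock_space_def by (intro measurable_restrict_space1) (simp add: measurable_snd)

text \<open>The Galois connection between an increasing path and its inverse. Right-continuity makes
  the infimum attained, which gives the implication from left to right; at \<open>t = T\<close> the
  clock region itself gives the bound.\<close>

lemma inverse_time_le_iff:
  assumes x: "(w, u) \<in> space (clock_space P)" and t: "t \<in> {0..T}"
  shows "inverse_time P w u \<le> t \<longleftrightarrow> u \<le> P t w"
proof
  let ?S = "{t\<in>{0..T}. u \<le> P t w}"
  have w: "w \<in> space M" and T: "T \<in> ?S"
    using x T_pos by (auto simp: space_clock_space)
  have bdd: "bdd_below ?S" by (auto simp: bdd_below_def)
  show "inverse_time P w u \<le> t" if "u \<le> P t w"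
    unfolding inverse_time_def using t that by (intro cInf_lower bdd) auto
  assume le: "inverse_time P w u \<le> t"
  show "u \<le> P t w"
  proof (cases "t < T")
    case True
    have "u \<le> P s w" if "t < s" "s < T" for s
    proof -
      have "Inf ?S < s" using le that by (simp add: inverse_time_def)
      then obtain r where "r \<in> ?S" "r < s" using cInf_less_iff[OF _ bdd] T by blast
      with increasing_mono[OF w, of r s] that show ?thesis by auto
    qed
    then have "\<forall>\<^sub>F s in at_right t. u \<le> P s w"
      using True by (auto simp: eventually_at_right[of t T])
    moreover have "((\<lambda>s. P s w) \<longlongrightarrow> P t w) (at_right t)"
      using incr w t True by (auto simp: increasing_process_def)
    ultimately show ?thesis by (intro tendsto_lowerbound) auto
  qed (use t T in auto)
qed

lemma inverse_time_bounds:
  assumes "(w, u) \<in> space (clock_space P)"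
  shows "0 < inverse_time P w u" "inverse_time P w u \<le> T"
  using inverse_time_le_iff[OF assms, of 0] inverse_time_le_iff[OF assms, of T] assms T_pos
  by (auto simp: space_clock_space)

text \<open>Through \<open>inverse_time_le_iff\<close> a time interval becomes the strip between
  \<open>P s\<close> and \<open>P t\<close>, which is jointly measurable. The preimage of time 0 is
  empty.\<close>

lemma clock_measurable: "clock P \<in> measurable (clock_space P) Pred"
proof (rule measurable_Pred)
  fix x assume "x \<in> space (clock_space P)"
  then show "clock P x \<in> {0..T} \<times> space M"
    using inverse_time_bounds[of "fst x" "snd x"]
    by (cases x) (auto simp: clock_def space_clock_space)
next
  fix A
  have "{x\<in>space (clock_space P). fst (clock P x) = 0 \<and> snd (clock P x) \<in> A} = {}"
    using inverse_time_bounds by (fastforce simp: clock_def)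
  then show "{x\<in>space (clock_space P). fst (clock P x) = 0 \<and> snd (clock P x) \<in> A} \<in> sets (clock_space P)"
    by (simp only: sets.empty_sets)
next
  fix s t A assume st: "0 \<le> s" "s < t" "t \<le> T" and "A \<in> sets (F s)"
  then have [measurable]: "A \<in> sets M" using sets_F[of s] by auto
  have [measurable]: "P s \<in> borel_measurable M" "P t \<in> borel_measurable M"
    using st by (auto intro: increasing_measurable)
  have "{x\<in>space (clock_space P). s < fst (clock P x) \<and> fst (clock P x) \<le> t \<and> snd (clock P x) \<in> A} =
      {x\<in>space (clock_space P). P s (fst x) < snd x \<and> snd x \<le> P t (fst x) \<and> fst x \<in> A}"
    using st inverse_time_le_iff[of _ _ s] inverse_time_le_iff[of _ _ t]
    by (auto simp: clock_def not_le[symmetric])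
  then show "{x\<in>space (clock_space P). s < fst (clock P x) \<and> fst (clock P x) \<le> t \<and> snd (clock P x) \<in> A}
      \<in> sets (clock_space P)" by simp
qed

text \<open>Fubini: for fixed \<open>w\<close> the strip between \<open>P s w\<close> and
  \<open>P t w\<close> has Lebesgue measure \<open>P t w - P s w\<close>.\<close>

lemma
  fixes h :: "'a \<Rightarrow> real"
  assumes st: "0 \<le> s" "s \<le> t" "t \<le> T" and [measurable]: "h \<in> borel_measurable M"
    and h: "\<And>w. \<bar>h w\<bar> \<le> B"
  shows integrable_clock: "integrable (clock_space P)
      (\<lambda>x. indicator {P s (fst x)<..P t (fst x)} (snd x) * h (fst x))"
    and integral_clock: "(LINT x|clock_space P. indicator {P s (fst x)<..P t (fst x)} (snd x) * h (fst x)) =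
      (LINT w|M. h w * (P t w - P s w))"
proof -
  interpret L: pair_sigma_finite M lborel ..
  have [measurable]: "P s \<in> borel_measurable M" "P t \<in> borel_measurable M"
    using st by (auto intro: increasing_measurable)
  define f where "f w u = indicator {P s w<..P t w} u * h w" for w and u :: real
  have inner: "(\<integral>u. indicator {P s w<..P t w} u * c \<partial>lborel) = c * (P t w - P s w)"
    "integrable lborel (\<lambda>u. indicator {P s w<..P t w} u * c)" if "w \<in> space M" for w and c :: real
    using increasing_mono[OF that st] by auto
  have "(\<lambda>x. if P s (fst x) < snd x \<and> snd x \<le> P t (fst x) then h (fst x) else 0)
      \<in> borel_measurable (M \<Otimes>\<^sub>M lborel)"
    by measurable
  also have "(\<lambda>x. if P s (fst x) < snd x \<and> snd x \<le> P t (fst x) then h (fst x) else 0) =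
      (\<lambda>x. f (fst x) (snd x))" by (auto simp: f_def fun_eq_iff)
  finally have meas: "(\<lambda>x. f (fst x) (snd x)) \<in> borel_measurable (M \<Otimes>\<^sub>M lborel)" .
  have "integrable M (\<lambda>w. h w * (P t w - P s w))"
  proof (rule Bochner_Integration.integrable_bound)
    show "integrable M (\<lambda>w. B * (P t w - P s w))"
      using st increasing_integrable by auto
    show "AE w in M. norm (h w * (P t w - P s w)) \<le> norm (B * (P t w - P s w))"
      using h by (intro AE_I2) (auto simp: abs_mult intro!: mult_right_mono order_trans[OF h abs_ge_self])
  qed simp
  then have "integrable M (\<lambda>w. norm (h w * (P t w - P s w)))" by (rule integrable_norm)
  also have "?this \<longleftrightarrow> integrable M (\<lambda>w. \<integral>u. norm (f w u) \<partial>lborel)"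
  proof (rule Bochner_Integration.integrable_cong[OF refl])
    fix w assume w: "w \<in> space M"
    have "norm (f w u) = indicator {P s w<..P t w} u * \<bar>h w\<bar>" for u
      by (simp add: f_def abs_mult)
    then show "norm (h w * (P t w - P s w)) = (\<integral>u. norm (f w u) \<partial>lborel)"
      using inner(1)[OF w, of "\<bar>h w\<bar>"] increasing_mono[OF w st] by (simp add: abs_mult)
  qed
  finally have int: "integrable (M \<Otimes>\<^sub>M lborel) (case_prod f)"
    using meas inner(2) by (intro L.Fubini_integrable) (auto simp: case_prod_beta' f_def)
  \<comment> \<open>By monotonicity the strip lies inside the clock region, so restricting the
    product measure to that region changes nothing.\<close>
  have restrict: "indicator (clock_graph P) x *\<^sub>R f (fst x) (snd x)
      = case_prod f x" if "x \<in> space (M \<Otimes>\<^sub>M lborel)" for x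
    using that increasing_mono[of "fst x" 0 s] increasing_mono[of "fst x" t T] st
    by (auto simp: f_def space_pair_measure indicator_def split: if_splits)
  let ?R = "clock_graph P"
  have R: "?R \<inter> space (M \<Otimes>\<^sub>M lborel) \<in> sets (M \<Otimes>\<^sub>M lborel)"
    by (rule sets.Int[OF clock_region sets.top])
  have "integrable (M \<Otimes>\<^sub>M lborel) (\<lambda>x. indicator ?R x *\<^sub>R f (fst x) (snd x))"
    by (rule Bochner_Integration.integrable_cong[THEN iffD2, OF refl _ int]) (rule restrict)
  then have "integrable (clock_space P) (\<lambda>x. f (fst x) (snd x))"
    unfolding clock_space_def by (rule integrable_restrict_space[OF R, THEN iffD2])
  then show "integrable (clock_space P) (\<lambda>x. indicator {P s (fst x)<..P t (fst x)} (snd x) * h (fst x))"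
    by (simp add: f_def)
  have "(LINT x|clock_space P. f (fst x) (snd x)) = (\<integral>x. case_prod f x \<partial>(M \<Otimes>\<^sub>M lborel))"
    unfolding clock_space_def integral_restrict_space[OF R]
    by (rule Bochner_Integration.integral_cong[OF refl]) (rule restrict)
  also have "\<dots> = (\<integral>w. \<integral>u. f w u \<partial>lborel \<partial>M)"
    using L.integral_fst[OF int] by simp
  also have "\<dots> = (LINT w|M. h w * (P t w - P s w))"
    by (intro Bochner_Integration.integral_cong refl) (simp only: f_def inner)
  finally show "(LINT x|clock_space P. indicator {P s (fst x)<..P t (fst x)} (snd x) * h (fst x)) =
      (LINT w|M. h w * (P t w - P s w))" by (simp add: f_def)
qed

lemma emeasure_clock:
  assumes st: "0 \<le> s" "s \<le> t" "t \<le> T" and A [measurable]: "A \<in> sets M"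
  shows "emeasure (clock_space P) {x\<in>space (clock_space P). P s (fst x) < snd x \<and> snd x \<le> P t (fst x) \<and> fst x \<in> A}
    = ennreal (LINT w|M. indicator A w * (P t w - P s w))" (is "emeasure _ ?E = _")
proof -
  have [measurable]: "P s \<in> borel_measurable M" "P t \<in> borel_measurable M"
    using st by (auto intro: increasing_measurable)
  have bnd: "\<And>w. \<bar>indicator A w :: real\<bar> \<le> 1" by (simp add: indicator_def)
  have ind: "indicator {P s (fst x)<..P t (fst x)} (snd x) * indicator A (fst x) = (indicator ?E x :: real)"
    if "x \<in> space (clock_space P)" for x
    using that by (auto simp: indicator_def)
  have E: "?E \<in> sets (clock_space P)" by measurable
  have int: "integrable (clock_space P) (indicator ?E :: _ \<Rightarrow> real)"
    using integrable_clock[OF st borel_measurable_indicator[OF A] bnd] ind by (simp cong: Bochner_Integration.integrable_cong)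
  then have "emeasure (clock_space P) ?E \<noteq> \<infinity>"
    using E by (simp add: integrable_indicator_iff less_top)
  then have "emeasure (clock_space P) ?E = ennreal (LINT x|clock_space P. indicator ?E x)"
    using E by (simp add: emeasure_eq_ennreal_measure)
  also have "(LINT x|clock_space P. indicator ?E x) = (LINT w|M. indicator A w * (P t w - P s w))"
    using integral_clock[OF st borel_measurable_indicator[OF A] bnd] ind by (simp cong: Bochner_Integration.integral_cong)
  finally show ?thesis .
qed

lemma emeasure_distr_clock:
  assumes st: "0 \<le> s" "s < t" "t \<le> T" and A: "A \<in> sets (F s)"
  shows "emeasure (doleans P) ({s<..t} \<times> A)
    = ennreal (LINT w|M. indicator A w * (P t w - P s w))"
proof -
  have "clock P -` ({s<..t} \<times> A) \<inter> space (clock_space P) =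
      {x\<in>space (clock_space P). P s (fst x) < snd x \<and> snd x \<le> P t (fst x) \<and> fst x \<in> A}"
    using st inverse_time_le_iff[of _ _ s] inverse_time_le_iff[of _ _ t]
    by (auto simp: clock_def not_le[symmetric])
  then show ?thesis
    using st A sets_F[of s]
    by (subst emeasure_distr) (auto simp: clock_measurable Pred_rect emeasure_clock)
qed

lemma emeasure_distr_clock_zero:
  assumes A: "A \<in> sets (F 0)"
  shows "emeasure (doleans P) ({0} \<times> A) = 0"
proof -
  have "clock P -` ({0} \<times> A) \<inter> space (clock_space P) = {}"
    using inverse_time_bounds by (fastforce simp: clock_def)
  then show ?thesis
    using A by (subst emeasure_distr) (auto simp: clock_measurable Pred_zero)
qed

lemma finite_measure_clock: "finite_measure (clock_space P)"
proof
  have "space (clock_space P) = {x\<in>space (clock_space P). P 0 (fst x) < snd x \<and> snd x \<le> P T (fst x) \<and> fst x \<in> space M}"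
    by (auto simp: space_clock_space)
  then show "emeasure (clock_space P) (space (clock_space P)) \<noteq> \<infinity>"
    using emeasure_clock[of 0 T "space M"] T_pos by (metis ennreal_neq_top infinity_ennreal_def less_imp_le order_refl sets.top)
qed

end

section \<open>Doleans measures are determined by predictable rectangles\<close>

lemma pred_gen_cases [consumes 1, case_names zero interval]:
  assumes "B \<in> pred_gen"
  obtains A where "B = {0} \<times> A" "A \<in> sets (F 0)"
    | s t A where "B = {s<..t} \<times> A" "0 \<le> s" "s < t" "t \<le> T" "A \<in> sets (F s)"
  using assms by (auto simp: pred_gen_def)

text \<open>Two rectangles over intervals meet in a rectangle whose left end is the larger of the
  two left ends, and at that time both bases are already measurable.\<close>

lemma Int_stable_pred_gen: "Int_stable pred_gen"
proof (rule Int_stableI)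
  fix a b assume ab: "a \<in> pred_gen" "b \<in> pred_gen"
  have "{0} \<times> {} \<in> pred_gen" unfolding pred_gen_def by blast
  then have empty: "{} \<in> pred_gen" by simp
  from ab(1) show "a \<inter> b \<in> pred_gen"
  proof (cases rule: pred_gen_cases)
    case a: (zero A)
    from ab(2) show ?thesis
    proof (cases rule: pred_gen_cases)
      case (zero B)
      then have "a \<inter> b = {0} \<times> (A \<inter> B)" using a by auto
      then show ?thesis using zero a by (auto simp: pred_gen_def)
    next
      case (interval s t B)
      then have "a \<inter> b = {}" using a by auto
      then show ?thesis by (simp add: empty)
    qed
  next
    case a: (interval s t A)
    from ab(2) show ?thesis
    proof (cases rule: pred_gen_cases)
      case (zero B)
      then have "a \<inter> b = {}" using a by auto
      then show ?thesis by (simp add: empty)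
    next
      case 2: (interval s' t' B)
      have int: "a \<inter> b = {max s s'<..min t t'} \<times> (A \<inter> B)" using a 2 by auto
      show ?thesis
      proof (cases "max s s' < min t t'")
        case True
        have "A \<in> sets (F (max s s'))" "B \<in> sets (F (max s s'))"
          using a 2 True by (auto intro: sets_F_mono[of s] sets_F_mono[of s'])
        then have "A \<inter> B \<in> sets (F (max s s'))" by auto
        moreover have "0 \<le> max s s'" "min t t' \<le> T" using a 2 by auto
        ultimately show ?thesis using True unfolding int pred_gen_def by blast
      next
        case False
        then have "{max s s'<..min t t'} = {}" by simp
        with int have "a \<inter> b = {}" by (simp only: Sigma_empty1)
        then show ?thesis by (simp add: empty)
      qed
    qed
  qed
qed

text \<open>This is the monotone class step: finite measures that agree on an intersection-stable
  generator coincide, so integrals of all bounded predictable integrands agree at once.\<close>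

lemma distr_clock_eq:
  assumes P: "increasing_process P" and N: "increasing_process N"
    and eq: "\<And>s t A. 0 \<le> s \<Longrightarrow> s < t \<Longrightarrow> t \<le> T \<Longrightarrow> A \<in> sets (F s) \<Longrightarrow>
      (LINT w|M. indicator A w * (P t w - P s w)) = (LINT w|M. indicator A w * (N t w - N s w))"
  shows "doleans P = doleans N"
proof (rule measure_eqI_generator_eq[OF Int_stable_pred_gen pred_gen_subset])
  fix B assume "B \<in> pred_gen"
  then show "emeasure (doleans P) B = emeasure (doleans N) B"
    by (cases rule: pred_gen_cases) (simp_all add: emeasure_distr_clock_zero[OF P] emeasure_distr_clock_zero[OF N]
        emeasure_distr_clock[OF P] emeasure_distr_clock[OF N] eq)
next
  \<comment> \<open>Two generators already exhaust the space: time 0 and the interval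
    \<open>{0<..T}\<close>.\<close>
  let ?A = "\<lambda>i::nat. if i = 0 then {0} \<times> space M else {0<..T} \<times> space M"
  have "space M \<in> sets (F 0)" using sets.top[of "F 0"] space_F[of 0] T_pos by auto
  then show "range ?A \<subseteq> pred_gen" using T_pos by (auto simp: pred_gen_def)
  show "(\<Union>i. ?A i) = {0..T} \<times> space M"
    using T_pos by (auto simp: set_eq_iff intro: exI[of _ 0] exI[of _ 1] split: if_splits)
  interpret finite_measure "clock_space P" by (rule finite_measure_clock[OF P])
  interpret D: finite_measure "doleans P"
    by (rule finite_measure_distr[OF clock_measurable[OF P]])
  show "emeasure (doleans P) (?A i) \<noteq> \<infinity>" for i
    by simp
qed (simp_all add: sets_Pred)

end

text \<open>The difference quotient of \<open>x \<mapsto> sqrt (1 + x\<^sup>2)\<close>, written without division by \<open>y - x\<close>.\<close>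

definition slope :: "real \<Rightarrow> real \<Rightarrow> real" where
  "slope x y = (x + y) / (sqrt (1 + x\<^sup>2) + sqrt (1 + y\<^sup>2))"

section \<open>Elementary estimates for the convex function\<close>

lemma sqrt_one_plus_square_pos: "0 < sqrt (1 + x\<^sup>2)" for x :: real
  by (simp add: add_pos_nonneg)

lemma abs_le_sqrt_one_plus_square: "\<bar>x\<bar> \<le> sqrt (1 + x\<^sup>2)" for x :: real
  by (rule real_le_rsqrt) simp

lemma sqrt_one_plus_square_le: "sqrt (1 + x\<^sup>2) \<le> 1 + \<bar>x\<bar>" for x :: real
  by (rule real_le_lsqrt) (auto simp: power2_eq_square algebra_simps)

text \<open>The squares of the two roots differ by \<open>y\<^sup>2 - x\<^sup>2\<close>, so
  multiplying with the conjugate sum of the roots clears the denominator.\<close>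

lemma slope_mult: "slope x y * (y - x) = sqrt (1 + y\<^sup>2) - sqrt (1 + x\<^sup>2)"
proof -
  define a b where "a = sqrt (1 + x\<^sup>2)" and "b = sqrt (1 + y\<^sup>2)"
  have ab: "0 < a" "0 < b" unfolding a_def b_def by (rule sqrt_one_plus_square_pos)+
  have "a\<^sup>2 = 1 + x\<^sup>2" "b\<^sup>2 = 1 + y\<^sup>2" unfolding a_def b_def by (simp_all add: add_nonneg_nonneg)
  then have "(x + y) * (y - x) = (b - a) * (a + b)"
    by (simp add: power2_eq_square algebra_simps)
  then show ?thesis using ab unfolding slope_def a_def[symmetric] b_def[symmetric]
    by (simp add: field_simps)
qed

text \<open>Each root dominates the modulus of its argument. The constant 1 is the Lipschitz
  constant of the function.\<close>

lemma abs_slope_le: "\<bar>slope x y\<bar> \<le> 1"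
proof -
  have "\<bar>x + y\<bar> \<le> sqrt (1 + x\<^sup>2) + sqrt (1 + y\<^sup>2)"
    using abs_le_sqrt_one_plus_square[of x] abs_le_sqrt_one_plus_square[of y] by linarith
  moreover have "0 < sqrt (1 + x\<^sup>2) + sqrt (1 + y\<^sup>2)"
    by (intro add_pos_pos sqrt_one_plus_square_pos)
  ultimately show ?thesis by (simp add: slope_def abs_divide)
qed

lemma tendsto_slope:
  assumes "(f \<longlongrightarrow> x) G" "(g \<longlongrightarrow> y) G" shows "((\<lambda>n. slope (f n) (g n)) \<longlongrightarrow> slope x y) G"
proof -
  have "sqrt (1 + x\<^sup>2) + sqrt (1 + y\<^sup>2) \<noteq> 0"
    using add_pos_pos[OF sqrt_one_plus_square_pos sqrt_one_plus_square_pos, of x y] by simp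
  then show ?thesis unfolding slope_def by (intro tendsto_intros assms)
qed

lemma measurable_slope [measurable (raw)]:
  assumes [measurable]: "f \<in> borel_measurable N" "g \<in> borel_measurable N"
  shows "(\<lambda>x. slope (f x) (g x)) \<in> borel_measurable N"
  unfolding slope_def by measurable

section \<open>Riemann sums along a grid and the vanishing of predictable martingales\<close>

context standard_filtration
begin

text \<open>The cap makes the last of the \<open>grid_size\<close> cells end exactly at
  \<open>T\<close>, even if \<open>T\<close> is no multiple of the mesh.\<close>

definition grid :: "nat \<Rightarrow> nat \<Rightarrow> real" where
  "grid k i = min T (i / Suc k)"

definition grid_size :: "nat \<Rightarrow> nat" where
  "grid_size k = nat \<lceil>T * Suc k\<rceil>"

lemma grid_bounds: "grid k i \<in> {0..T}" "grid k i \<le> grid k (Suc i)"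
proof -
  show "grid k i \<in> {0..T}" using T_pos by (auto simp: grid_def)
  show "grid k i \<le> grid k (Suc i)"
    unfolding grid_def by (intro min.mono order_refl divide_right_mono) auto
qed

lemma grid_0: "grid k 0 = 0"
  using T_pos by (simp add: grid_def)

lemma grid_last: "grid k (grid_size k) = T"
proof -
  have "T * Suc k \<le> real (grid_size k)" unfolding grid_size_def by linarith
  then have "T \<le> grid_size k / Suc k" by (simp add: le_divide_eq)
  then show ?thesis by (simp add: grid_def)
qed

text \<open>Cells are open on the left and closed on the right, so every \<open>c\<close> in
  \<open>{0<..T}\<close> lies in exactly one of them, and its ends are the two mesh points used for
  sampling cadlag paths.\<close>

lemma grid_cell:
  assumes "0 < c" "c \<le> T"
  shows "grid k i < c \<and> c \<le> grid k (Suc i) \<longleftrightarrow> i = nat (\<lceil>c * Suc k\<rceil> - 1)"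
    and "nat (\<lceil>c * Suc k\<rceil> - 1) < grid_size k"
    and "grid k (nat (\<lceil>c * Suc k\<rceil> - 1)) = left_grid k c"
    and "grid k (Suc (nat (\<lceil>c * Suc k\<rceil> - 1))) = right_grid T k c"
proof -
  have pos: "0 < c * Suc k" using assms by simp
  then have 1: "1 \<le> \<lceil>c * Suc k\<rceil>" by linarith
  have "grid k i < c \<and> c \<le> grid k (Suc i) \<longleftrightarrow> i / Suc k < c \<and> c \<le> Suc i / Suc k"
    using assms by (auto simp: grid_def min_def)
  also have "\<dots> \<longleftrightarrow> real i < c * Suc k \<and> c * Suc k \<le> real i + 1"
    by (simp add: divide_less_eq le_divide_eq add.commute del: of_nat_Suc) (simp add: algebra_simps)
  also have "\<dots> \<longleftrightarrow> \<lceil>c * Suc k\<rceil> = int i + 1" by (simp add: ceiling_eq_iff del: of_nat_Suc)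
  also have "\<dots> \<longleftrightarrow> i = nat (\<lceil>c * Suc k\<rceil> - 1)" using 1 by auto
  finally show "grid k i < c \<and> c \<le> grid k (Suc i) \<longleftrightarrow> i = nat (\<lceil>c * Suc k\<rceil> - 1)" .
  have "c * Suc k \<le> T * Suc k" using assms by (intro mult_right_mono) auto
  then have "\<lceil>c * Suc k\<rceil> \<le> \<lceil>T * Suc k\<rceil>" by (rule ceiling_mono)
  then show "nat (\<lceil>c * Suc k\<rceil> - 1) < grid_size k" using 1 unfolding grid_size_def by linarith
  have "real (nat (\<lceil>c * Suc k\<rceil> - 1)) = real_of_int (\<lceil>c * Suc k\<rceil> - 1)" using 1 by simp
  then have "real (nat (\<lceil>c * Suc k\<rceil> - 1)) = real_of_int \<lceil>c * Suc k\<rceil> - 1"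
    "real (Suc (nat (\<lceil>c * Suc k\<rceil> - 1))) = real_of_int \<lceil>c * Suc k\<rceil>" by simp_all
  then show "grid k (nat (\<lceil>c * Suc k\<rceil> - 1)) = left_grid k c"
    "grid k (Suc (nat (\<lceil>c * Suc k\<rceil> - 1))) = right_grid T k c"
    using left_grid_bounds[of c k] assms unfolding grid_def left_grid_def right_grid_def by simp_all
qed

text \<open>On the clock space the Riemann sum is the integral of a step function: at
  \<open>(w, u)\<close> it evaluates \<open>slope\<close> at the ends of the cell containing the
  clock time \<open>c\<close>. These ends approach \<open>c\<close> strictly from the left and
  weakly from the right, so the values tend to \<open>slope\<close> of the left limit and the value
  at \<open>c\<close>. Since \<open>slope\<close> is bounded by 1 and the measure is finite,
  dominated convergence applies.\<close>

lemma Riemann_sums_tendsto: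
  assumes P: "increasing_process P"
    and Y: "\<And>t. t \<in> {0..T} \<Longrightarrow> Y t \<in> borel_measurable M"
    and D: "predictable D" and cad: "cadlag_process M T D"
    and \<kappa>: "\<And>w. w \<in> space M \<Longrightarrow> \<kappa> w \<in> {0..T}"
    and stopped: "\<And>w t. w \<in> space M \<Longrightarrow> t \<in> {0..T} \<Longrightarrow> Y t w = D (min t (\<kappa> w)) w"
    and flat: "\<And>w. w \<in> space M \<Longrightarrow> P T w = P (\<kappa> w) w"
  shows "(\<lambda>k. \<Sum>i<grid_size k. \<integral>w. slope (Y (grid k i) w) (Y (grid k (Suc i)) w) *
      (P (grid k (Suc i)) w - P (grid k i) w) \<partial>M) \<longlonglongrightarrow>
    (\<integral>p. slope (left_limit D (fst p) (snd p)) (D (fst p) (snd p)) \<partial>doleans P)"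
proof -
  interpret finite_measure "clock_space P" by (rule finite_measure_clock[OF P])
  define h where "h k i w = slope (Y (grid k i) w) (Y (grid k (Suc i)) w)" for k i w
  have h [measurable]: "h k i \<in> borel_measurable M" for k i
    unfolding h_def using grid_bounds by (intro measurable_slope Y) auto
  have h1: "\<bar>h k i w\<bar> \<le> 1" for k i w by (simp add: h_def abs_slope_le)
  define G where "G k x = (\<Sum>i<grid_size k.
      indicator {P (grid k i) (fst x)<..P (grid k (Suc i)) (fst x)} (snd x) * h k i (fst x))"
    for k and x :: "'a \<times> real"
  have gb: "0 \<le> grid k i" "grid k i \<le> grid k (Suc i)" "grid k (Suc i) \<le> T" for k i
    using grid_bounds[of k i] grid_bounds[of k "Suc i"] by auto
  have term_int: "integrable (clock_space P)
      (\<lambda>x. indicator {P (grid k i) (fst x)<..P (grid k (Suc i)) (fst x)} (snd x) * h k i (fst x))" for k i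
    by (rule integrable_clock[OF P gb h h1])
  have G_int: "integrable (clock_space P) (G k)" for k
    unfolding G_def by (intro Bochner_Integration.integrable_sum term_int)
  have G_eq: "(LINT x|clock_space P. G k x) =
      (\<Sum>i<grid_size k. \<integral>w. h k i w * (P (grid k (Suc i)) w - P (grid k i) w) \<partial>M)" for k
    unfolding G_def
    by (subst Bochner_Integration.integral_sum[OF term_int]) (simp add: integral_clock[OF P gb h h1])
  define H where "H p = slope (left_limit D (fst p) (snd p)) (D (fst p) (snd p))" for p
  have "predictable (left_limit D)"
    using predictable_adapted[OF D] cad by (rule left_limit_measurable_Pred)
  with D have H [measurable]: "H \<in> borel_measurable Pred"
    unfolding H_def predictable_process_def by (simp add: case_prod_beta')
  \<comment> \<open>Exactly one cell contains the clock time, so one term of the sum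
    survives.\<close>
  have G_val: "G k x = h k (nat (\<lceil>inverse_time P (fst x) (snd x) * Suc k\<rceil> - 1)) (fst x)"
    if x: "x \<in> space (clock_space P)" for k x
  proof -
    obtain w u where [simp]: "x = (w, u)" by (cases x)
    let ?c = "inverse_time P w u"
    have c: "0 < ?c" "?c \<le> T" using inverse_time_bounds[OF P, of w u] x by auto
    have "indicator {P (grid k i) w<..P (grid k (Suc i)) w} u =
        (of_bool (i = nat (\<lceil>?c * Suc k\<rceil> - 1)) :: real)" for i
      using grid_cell(1)[OF c, of k i] x grid_bounds(1)[of k]
        inverse_time_le_iff[OF P, of w u "grid k i"] inverse_time_le_iff[OF P, of w u "grid k (Suc i)"]
      by (auto simp: indicator_def)
    then show ?thesis
      using grid_cell(2)[OF c, of k] by (simp add: G_def if_distrib sum.delta cong: if_cong)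
  qed
  have lim: "(\<lambda>k. G k x) \<longlonglongrightarrow> H (clock P x)" if x: "x \<in> space (clock_space P)" for x
  proof -
    obtain w u where [simp]: "x = (w, u)" by (cases x)
    have w: "w \<in> space M" using x by (simp add: space_clock_space[OF P])
    define c where "c = inverse_time P w u"
    have c: "0 < c" "c \<le> T" using inverse_time_bounds[OF P, of w u] x by (auto simp: c_def)
    \<comment> \<open>As \<open>P\<close> does not grow after \<open>\<kappa>\<close>, the clock
      never runs past \<open>\<kappa>\<close>. There \<open>Y\<close> and \<open>D\<close> agree, so
      the limit can be stated with the predictable \<open>D\<close> in place of the stopped
      process.\<close>
    have "u \<le> P (\<kappa> w) w" using x flat[OF w] by (simp add: space_clock_space[OF P])
    then have c\<kappa>: "c \<le> \<kappa> w"
      unfolding c_def using x \<kappa>[OF w] by (subst inverse_time_le_iff[OF P]) auto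
    have "Y (left_grid k c) w = D (left_grid k c) w" for k
      using left_grid_bounds[OF c(1), of k] c c\<kappa> by (subst stopped[OF w]) auto
    then have left: "(\<lambda>k. Y (left_grid k c) w) \<longlonglongrightarrow> left_limit D c w"
      using cadlag_left_grid[OF cad w c] by simp
    have rg: "c \<le> right_grid T k c" "right_grid T k c \<le> T" for k
      using right_grid_bounds[of c T k] c by auto
    have "(\<lambda>k. D (min (right_grid T k c) (\<kappa> w)) w) \<longlonglongrightarrow> D c w"
    proof (cases "c < T")
      case True
      have "(\<lambda>k. min (right_grid T k c) (\<kappa> w)) \<longlonglongrightarrow> min c (\<kappa> w)"
        using c by (intro tendsto_min right_grid_tendsto tendsto_const) auto
      then show ?thesis
        using c\<kappa> rg True c
        by (intro tendsto_at_right_compose_le[where f = "\<lambda>s. D s w"] cadlag_right[OF cad w])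
           (auto simp: min_absorb1)
    next
      \<comment> \<open>Here \<open>c = T\<close>, where there is nothing to the right; the capped
        mesh point is constantly \<open>T\<close>.\<close>
      case False
      then have "min (right_grid T k c) (\<kappa> w) = c" for k using c\<kappa> rg[of k] c \<kappa>[OF w] by auto
      then show ?thesis by simp
    qed
    moreover have "Y (right_grid T k c) w = D (min (right_grid T k c) (\<kappa> w)) w" for k
      using rg[of k] c by (intro stopped[OF w]) auto
    ultimately have right: "(\<lambda>k. Y (right_grid T k c) w) \<longlonglongrightarrow> D c w" by simp
    have "G k x = slope (Y (left_grid k c) w) (Y (right_grid T k c) w)" for k
      using G_val[OF x, of k] grid_cell(3,4)[OF c, of k] by (simp add: h_def c_def)
    then show ?thesis
      using tendsto_slope[OF left right] by (simp add: H_def clock_def c_def)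
  qed
  have "(\<lambda>k. \<integral>x. G k x \<partial>clock_space P) \<longlonglongrightarrow> (LINT x|clock_space P. H (clock P x))"
  proof (rule integral_dominated_convergence[where w = "\<lambda>_. 1"])
    show "(\<lambda>x. H (clock P x)) \<in> borel_measurable (clock_space P)"
      using measurable_comp[OF clock_measurable[OF P] H] by (simp add: comp_def)
    show "AE x in clock_space P. norm (G k x) \<le> 1" for k
      using G_val h1 by (intro AE_I2) simp
  qed (use G_int lim in auto)
  also have "(LINT x|clock_space P. H (clock P x)) = (\<integral>p. H p \<partial>doleans P)"
    by (rule integral_distr[symmetric, OF clock_measurable[OF P] H])
  finally show ?thesis by (simp add: G_eq h_def H_def)
qed

text \<open>The martingale property says that \<open>P\<close> and \<open>N\<close> have the same
  Doleans measure. Their Riemann sums with weights \<open>slope\<close> therefore have the same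
  limit, while the difference of the two sums does not depend on the mesh at all.\<close>

lemma predictable_stopped_martingale:
  assumes P: "increasing_process P" and N: "increasing_process N"
    and diff: "\<And>w s t. w \<in> space M \<Longrightarrow> 0 \<le> s \<Longrightarrow> s \<le> t \<Longrightarrow> t \<le> T \<Longrightarrow>
        Y t w - Y s w = (P t w - P s w) - (N t w - N s w)"
    and Y: "\<And>t. t \<in> {0..T} \<Longrightarrow> integrable M (Y t)"
    and mart: "\<And>s t A. 0 \<le> s \<Longrightarrow> s < t \<Longrightarrow> t \<le> T \<Longrightarrow> A \<in> sets (F s) \<Longrightarrow>
        (int_on A (Y t)) = (int_on A (Y s))"
    and D: "predictable D" and cad: "cadlag_process M T D"
    and \<kappa>: "\<And>w. w \<in> space M \<Longrightarrow> \<kappa> w \<in> {0..T}"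
    and stopped: "\<And>w t. w \<in> space M \<Longrightarrow> t \<in> {0..T} \<Longrightarrow> Y t w = D (min t (\<kappa> w)) w"
    and flat: "\<And>w. w \<in> space M \<Longrightarrow> P T w = P (\<kappa> w) w" "\<And>w. w \<in> space M \<Longrightarrow> N T w = N (\<kappa> w) w"
    and zero: "\<And>w. w \<in> space M \<Longrightarrow> Y 0 w = 0"
  shows "AE w in M. Y T w = 0"
proof -
  let ?f = "\<lambda>x::real. sqrt (1 + x\<^sup>2)"
  have Ym [measurable]: "Y t \<in> borel_measurable M" if "t \<in> {0..T}" for t
    using Y[OF that] by blast
  have f_int: "integrable M (\<lambda>w. ?f (Y t w))" if "t \<in> {0..T}" for t
  proof (rule Bochner_Integration.integrable_bound)
    show "integrable M (\<lambda>w. 1 + \<bar>Y t w\<bar>)" using Y[OF that] by simp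
    show "(\<lambda>w. ?f (Y t w)) \<in> borel_measurable M" using Ym[OF that] by measurable
  qed (use sqrt_one_plus_square_le in \<open>auto simp: abs_of_nonneg\<close>)
  have incr_int: "integrable M (\<lambda>w. h w * (Q t w - Q s w))"
    if "h \<in> borel_measurable M" "\<And>w. \<bar>h w\<bar> \<le> 1" "increasing_process Q" "s \<in> {0..T}" "t \<in> {0..T}"
    for h :: "'a \<Rightarrow> real" and Q s t
  proof (rule Bochner_Integration.integrable_bound)
    show i: "integrable M (\<lambda>w. Q t w - Q s w)"
      using increasing_integrable[OF that(3)] that(4,5) by auto
    show "(\<lambda>w. h w * (Q t w - Q s w)) \<in> borel_measurable M"
      using that(1) borel_measurable_integrable[OF i] by measurable
    show "AE w in M. norm (h w * (Q t w - Q s w)) \<le> norm (Q t w - Q s w)"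
      using that(2) by (intro AE_I2) (auto simp: abs_mult intro!: mult_left_le_one_le)
  qed
  have eq: "doleans P = doleans N"
  proof (rule distr_clock_eq[OF P N])
    fix s t A assume st: "0 \<le> s" "s < t" "t \<le> T" and A: "A \<in> sets (F s)"
    then have AM: "A \<in> sets M" using sets_F[of s] by auto
    have Yi: "integrable M (\<lambda>w. indicator A w * Y r w)" if "r \<in> {0..T}" for r
      using integrable_mult_indicator[OF AM Y[OF that]] by simp
    have ii: "integrable M (\<lambda>w. indicator A w * (Q t w - Q s w))" if "increasing_process Q" for Q
      using AM st that by (intro incr_int) (auto simp: indicator_def)
    have "(LINT w|M. indicator A w * (P t w - P s w)) - (LINT w|M. indicator A w * (N t w - N s w))
        = (LINT w|M. indicator A w * Y t w - indicator A w * Y s w)"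
      unfolding Bochner_Integration.integral_diff[OF ii[OF P] ii[OF N], symmetric]
      using diff[of _ s t] st
      by (intro Bochner_Integration.integral_cong) (auto simp: right_diff_distrib[symmetric])
    also have "\<dots> = 0"
      using st mart[OF st A] by (subst Bochner_Integration.integral_diff) (auto intro: Yi)
    finally show "(LINT w|M. indicator A w * (P t w - P s w)) = (LINT w|M. indicator A w * (N t w - N s w))"
      by simp
  qed
  define h where "h k i w = slope (Y (grid k i) w) (Y (grid k (Suc i)) w)" for k i w
  define RS where "RS Q k = (\<Sum>i<grid_size k. \<integral>w. h k i w * (Q (grid k (Suc i)) w - Q (grid k i) w) \<partial>M)" for Q k
  \<comment> \<open>Both limits are integrals of one predictable function against one
    measure.\<close>
  have "(\<lambda>k. RS P k - RS N k) \<longlonglongrightarrow> 0"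
    using tendsto_diff[OF Riemann_sums_tendsto[OF P Ym D cad \<kappa> stopped flat(1)]
        Riemann_sums_tendsto[OF N Ym D cad \<kappa> stopped flat(2)]] eq
    by (simp add: RS_def h_def)
  \<comment> \<open>The increments of \<open>P\<close> minus those of \<open>N\<close> are those of
    \<open>Y\<close>, and \<open>slope\<close> turns them into increments of the convex function,
    which telescope. The 1 is its value at \<open>Y 0 w = 0\<close>.\<close>
  moreover have "RS P k - RS N k = (LINT w|M. ?f (Y T w)) - 1" for k
  proof -
    have h: "h k i \<in> borel_measurable M" "\<bar>h k i w\<bar> \<le> 1" for i w
      unfolding h_def using grid_bounds by (auto intro!: measurable_slope Ym abs_slope_le)
    have "RS P k - RS N k = (\<Sum>i<grid_size k. \<integral>w. h k i w * (P (grid k (Suc i)) w - P (grid k i) w)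
        - h k i w * (N (grid k (Suc i)) w - N (grid k i) w) \<partial>M)"
      unfolding RS_def sum_subtractf[symmetric]
      using h grid_bounds
      by (intro sum.cong refl Bochner_Integration.integral_diff[symmetric] incr_int P N) auto
    also have "\<dots> = (\<Sum>i<grid_size k. \<integral>w. ?f (Y (grid k (Suc i)) w) - ?f (Y (grid k i) w) \<partial>M)"
    proof (intro sum.cong refl Bochner_Integration.integral_cong)
      fix i w assume "w \<in> space M"
      with diff[of w "grid k i" "grid k (Suc i)"] grid_bounds[of k i] grid_bounds[of k "Suc i"]
      have "h k i w * (P (grid k (Suc i)) w - P (grid k i) w)
        - h k i w * (N (grid k (Suc i)) w - N (grid k i) w) =
        h k i w * (Y (grid k (Suc i)) w - Y (grid k i) w)" by (simp add: right_diff_distrib[symmetric])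
      then show "h k i w * (P (grid k (Suc i)) w - P (grid k i) w)
        - h k i w * (N (grid k (Suc i)) w - N (grid k i) w) = ?f (Y (grid k (Suc i)) w) - ?f (Y (grid k i) w)"
        by (simp add: h_def slope_mult)
    qed
    also have "\<dots> = (\<Sum>i<grid_size k. (LINT w|M. ?f (Y (grid k (Suc i)) w)) - (LINT w|M. ?f (Y (grid k i) w)))"
      using grid_bounds by (intro sum.cong refl Bochner_Integration.integral_diff f_int)
    also have "\<dots> = (LINT w|M. ?f (Y T w)) - (LINT w|M. ?f (Y 0 w))"
      by (subst sum_lessThan_telescope) (simp add: grid_last grid_0)
    also have "(LINT w|M. ?f (Y 0 w)) = (LINT w|M. 1)"
      by (intro Bochner_Integration.integral_cong) (simp_all add: zero)
    finally show ?thesis by (simp add: prob_space)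
  qed
  ultimately have "(LINT w|M. ?f (Y T w)) - 1 = 0" by (simp add: LIMSEQ_const_iff)
  moreover have "T \<in> {0..T}" using T_pos by simp
  ultimately have "(LINT w|M. ?f (Y T w) - 1) = 0"
    using f_int[of T] by (simp add: prob_space)
  moreover have "0 \<le> ?f x - 1" for x :: real by simp
  ultimately have "AE w in M. ?f (Y T w) - 1 = 0"
    using f_int[OF \<open>T \<in> {0..T}\<close>] by (subst (asm) integral_nonneg_eq_0_iff_AE) auto
  then show ?thesis by eventually_elim simp
qed

end

subsection \<open>Optional stopping\<close>

text \<open>Vitali convergence, with uniform integrability expressed by the excess over the level
  \<open>K\<close>. Fatou passes the bound on the excess to the limit, and cutting at level
  \<open>K\<close> leaves a bounded sequence.\<close>

lemma (in finite_measure) tendsto_integral_uniformly_integrable: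
  fixes f :: "nat \<Rightarrow> 'a \<Rightarrow> real"
  assumes f: "\<And>n. integrable M (f n)" and g [measurable]: "g \<in> borel_measurable M"
    and lim: "\<And>x. x \<in> space M \<Longrightarrow> (\<lambda>n. f n x) \<longlonglongrightarrow> g x"
    and tail: "\<And>n K. 0 \<le> K \<Longrightarrow> (LINT x|M. max 0 (\<bar>f n x\<bar> - K)) \<le> \<epsilon> K"
    and \<epsilon>: "(\<epsilon> \<longlongrightarrow> 0) at_top"
  shows "integrable M g" "(\<lambda>n. \<integral>x. f n x \<partial>M) \<longlonglongrightarrow> (LINT x|M. g x)"
proof -
  have [measurable]: "f n \<in> borel_measurable M" for n using f by blast
  have tail_int: "integrable M (\<lambda>x. max 0 (\<bar>h x\<bar> - K))" if "integrable M h" for h :: "'a \<Rightarrow> real" and K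
    using that by (intro integrable_max) auto
  have nn_tail: "(\<integral>\<^sup>+x. ennreal (max 0 (\<bar>g x\<bar> - K)) \<partial>M) \<le> ennreal (\<epsilon> K)" if "0 \<le> K" for K
  proof -
    have "(\<integral>\<^sup>+x. ennreal (max 0 (\<bar>g x\<bar> - K)) \<partial>M) =
        (\<integral>\<^sup>+x. liminf (\<lambda>n. ennreal (max 0 (\<bar>f n x\<bar> - K))) \<partial>M)"
    proof (rule nn_integral_cong)
      fix x assume "x \<in> space M"
      then have "(\<lambda>n. ennreal (max 0 (\<bar>f n x\<bar> - K))) \<longlonglongrightarrow> ennreal (max 0 (\<bar>g x\<bar> - K))"
        by (intro tendsto_intros lim)
      then show "ennreal (max 0 (\<bar>g x\<bar> - K)) = liminf (\<lambda>n. ennreal (max 0 (\<bar>f n x\<bar> - K)))"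
        by (simp add: lim_imp_Liminf)
    qed
    also have "\<dots> \<le> liminf (\<lambda>n. \<integral>\<^sup>+x. ennreal (max 0 (\<bar>f n x\<bar> - K)) \<partial>M)"
      by (rule nn_integral_liminf) measurable
    also have "\<dots> \<le> liminf (\<lambda>n. ennreal (\<epsilon> K))"
    proof (rule Liminf_mono, rule always_eventually, rule allI)
      fix n
      have "(\<integral>\<^sup>+x. ennreal (max 0 (\<bar>f n x\<bar> - K)) \<partial>M) = ennreal (LINT x|M. max 0 (\<bar>f n x\<bar> - K))"
        by (intro nn_integral_eq_integral tail_int f) auto
      with tail[OF that, of n] show "(\<integral>\<^sup>+x. ennreal (max 0 (\<bar>f n x\<bar> - K)) \<partial>M) \<le> ennreal (\<epsilon> K)"
        by (simp add: ennreal_leI)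
    qed
    finally show ?thesis by (simp add: Liminf_const)
  qed
  show int_g: "integrable M g"
  proof (rule integrableI_bounded)
    have "(\<integral>\<^sup>+x. ennreal (norm (g x)) \<partial>M) \<le> ennreal (\<epsilon> 0)" using nn_tail[of 0] by simp
    then show "(\<integral>\<^sup>+x. ennreal (norm (g x)) \<partial>M) < \<infinity>" by (simp add: le_less_trans ennreal_less_top)
  qed simp
  have tail_g: "(LINT x|M. max 0 (\<bar>g x\<bar> - K)) \<le> \<epsilon> K" if "0 \<le> K" for K
  proof -
    have "0 \<le> (LINT x|M. max 0 (\<bar>f 0 x\<bar> - K))" by (intro Bochner_Integration.integral_nonneg) auto
    then have "0 \<le> \<epsilon> K" using tail[OF that, of 0] by (rule order_trans)
    moreover have "(\<integral>\<^sup>+x. ennreal (max 0 (\<bar>g x\<bar> - K)) \<partial>M) = ennreal (LINT x|M. max 0 (\<bar>g x\<bar> - K))"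
      by (intro nn_integral_eq_integral tail_int int_g) auto
    ultimately show ?thesis using nn_tail[OF that] by simp
  qed
  \<comment> \<open>Clamping to \<open>[-K, K]\<close> changes a number by exactly its excess over
    \<open>K\<close>, so the tail bound is also the truncation error. The thirds of \<open>e\<close>
    below pay for the two truncations and the bounded limit.\<close>
  define c where "c K x = max (- K) (min K x)" for K x :: real
  have c_int: "integrable M (\<lambda>x. c K (h x))" if "h \<in> borel_measurable M" for h K
    by (rule integrable_const_bound[where B = "\<bar>K\<bar>"]) (use that in \<open>auto simp: c_def\<close>)
  have c_diff: "\<bar>(LINT x|M. h x) - (LINT x|M. c K (h x))\<bar> \<le> \<epsilon> K"
    if "integrable M h" "0 \<le> K" "(LINT x|M. max 0 (\<bar>h x\<bar> - K)) \<le> \<epsilon> K" for h K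
  proof -
    have "\<bar>\<integral>x. h x - c K (h x) \<partial>M\<bar> \<le> (LINT x|M. \<bar>h x - c K (h x)\<bar>)"
      by (rule integral_abs_bound)
    also have "\<dots> = (LINT x|M. max 0 (\<bar>h x\<bar> - K))"
      using that(2) by (intro Bochner_Integration.integral_cong refl) (auto simp: c_def max_def min_def)
    finally show ?thesis
      using that c_int[of h K] by simp
  qed
  show "(\<lambda>n. \<integral>x. f n x \<partial>M) \<longlonglongrightarrow> (LINT x|M. g x)"
  proof (rule tendstoI)
    fix e :: real assume e: "0 < e"
    have "\<forall>\<^sub>F K in at_top. \<epsilon> K < e / 3" using order_tendstoD(2)[OF \<epsilon>, of "e / 3"] e by simp
    then have "\<forall>\<^sub>F K in at_top. \<epsilon> K < e / 3 \<and> 0 \<le> K"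
      using eventually_ge_at_top[of "0::real"] by eventually_elim auto
    then obtain K where K: "\<epsilon> K < e / 3" "0 \<le> K" by (auto dest: eventually_happens)
    have "(\<lambda>n. \<integral>x. c K (f n x) \<partial>M) \<longlonglongrightarrow> (LINT x|M. c K (g x))"
    proof (rule integral_dominated_convergence[where w = "\<lambda>_. K"])
      show "AE x in M. (\<lambda>n. c K (f n x)) \<longlonglongrightarrow> c K (g x)"
        unfolding c_def by (intro AE_I2 tendsto_intros lim)
      show "AE x in M. norm (c K (f n x)) \<le> K" for n
        using K by (intro AE_I2) (auto simp: c_def)
    qed (auto simp: c_def)
    then have "\<forall>\<^sub>F n in sequentially. dist (LINT x|M. c K (f n x)) (LINT x|M. c K (g x)) < e / 3"
      using e by (intro tendstoD) auto
    then show "\<forall>\<^sub>F n in sequentially. dist (LINT x|M. f n x) (LINT x|M. g x) < e"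
    proof eventually_elim
      case (elim n)
      then show ?case
        using c_diff[OF f[of n] K(2) tail[OF K(2)]] c_diff[OF int_g K(2) tail_g[OF K(2)]] K(1)
        unfolding dist_real_def by linarith
    qed
  qed
qed

context standard_filtration
begin

lemma cadlag_martingale_integral:
  assumes X: "martingale X" and st: "0 \<le> s" "s \<le> t" "t \<le> T" and A: "A \<in> sets (F s)"
  shows "int_on A (X t) = int_on A (X s)"
proof -
  interpret C: finite_measure_subalgebra M "F s"
    using st by (intro finite_measure_subalgebra_F) auto
  have int: "integrable M (X t)" using X st by (auto simp: cadlag_martingale_def)
  have ae: "AE w in M. real_cond_exp M (F s) (X t) w = X s w"
    using X st by (auto simp: cadlag_martingale_def)
  have Xs: "X s \<in> borel_measurable M" and AM: "A \<in> sets M"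
    using X st A sets_F[of s] by (auto simp: cadlag_martingale_def)
  have "(int_on A (X t)) = (LINT w|M. indicator A w * real_cond_exp M (F s) (X t) w)"
    using C.real_cond_exp_intA[OF int A] by (simp add: set_lebesgue_integral_def)
  also have "\<dots> = (int_on A (X s))"
    using ae Xs AM by (intro integral_cong_AE) auto
  finally show ?thesis .
qed

lemma cadlag_martingaleI:
  assumes ad: "adapted_process F T X" and cad: "cadlag_process M T X"
    and int: "\<And>t. t \<in> {0..T} \<Longrightarrow> integrable M (X t)"
    and eq: "\<And>s t A. 0 \<le> s \<Longrightarrow> s \<le> t \<Longrightarrow> t \<le> T \<Longrightarrow> A \<in> sets (F s) \<Longrightarrow>
      (int_on A (X t)) = (int_on A (X s))"
  shows "martingale X"
  unfolding cadlag_martingale_def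
proof (intro conjI ballI impI)
  fix s t assume st: "s \<in> {0..T}" "t \<in> {0..T}" "s \<le> t"
  interpret C: finite_measure_subalgebra M "F s" using st by (intro finite_measure_subalgebra_F)
  show "AE w in M. real_cond_exp M (F s) (X t) w = X s w"
  proof (rule C.real_cond_exp_charact)
    show "(\<integral>w\<in>A. X t w \<partial>M) = (\<integral>w\<in>A. X s w \<partial>M)" if "A \<in> sets (F s)" for A
      using eq[of s t A] st that by (simp add: set_lebesgue_integral_def)
    show "X s \<in> borel_measurable (F s)" using ad st by (simp add: adapted_process_def)
  qed (use int st in auto)
qed (use assms in auto)

text \<open>The submartingale inequality for the excess of \<open>\<bar>X\<bar>\<close> over
  \<open>K\<close>. On the events \<open>K < X t w\<close> and \<open>X t w < - K\<close>, both
  known at \<open>t\<close>, the excess is affine in \<open>X\<close>, so the martingale property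
  applies; at time \<open>T\<close> the same affine expressions are dominated by the excess.\<close>

lemma cadlag_martingale_abs:
  assumes X: "martingale X" and t: "t \<in> {0..T}" and A: "A \<in> sets (F t)" and K: "0 \<le> K"
  shows "(LINT w|M. indicator A w * max 0 (\<bar>X t w\<bar> - K)) \<le> (LINT w|M. indicator A w * max 0 (\<bar>X T w\<bar> - K))"
proof -
  have int: "integrable M (X r)" if "r \<in> {0..T}" for r using X that by (auto simp: cadlag_martingale_def)
  have Xt [measurable]: "X t \<in> borel_measurable (F t)"
    using X t by (auto simp: cadlag_martingale_def adapted_process_def)
  have T: "T \<in> {0..T}" using T_pos by simp
  have AM: "A \<in> sets M" using A sets_F[OF t] by simp
  have A_sub: "A \<subseteq> space (F t)" using A by (rule sets.sets_into_space)
  have indint: "integrable M (\<lambda>w. indicator B w * f w)" if "B \<in> sets M" "integrable M f" for B and f :: "'a \<Rightarrow> real"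
    using integrable_mult_indicator[OF that] by simp
  define U V where "U = {w\<in>space (F t). K < X t w} \<inter> A" and "V = {w\<in>space (F t). X t w < - K} \<inter> A"
  have UV: "U \<in> sets (F t)" "V \<in> sets (F t)" using A by (auto simp: U_def V_def)
  have UVM: "U \<in> sets M" "V \<in> sets M" using UV sets_F[OF t] by auto
  have mart: "int_on B (X t) = int_on B (X T)" if "B \<in> sets (F t)" for B
    using cadlag_martingale_integral[OF X _ _ _ that, of T] t by auto
  have lin: "(LINT w|M. indicator U w * (X r w - K) + indicator V w * (- X r w - K)) =
      ((int_on U (X r)) - (LINT w|M. indicator U w * K)) +
      (- (int_on V (X r)) - (LINT w|M. indicator V w * K))"
    if "r \<in> {0..T}" for r
    using indint[OF UVM(1) int[OF that]] indint[OF UVM(2) int[OF that]]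
      indint[OF UVM(1), of "\<lambda>_. K"] indint[OF UVM(2), of "\<lambda>_. K"]
    by (simp add: right_diff_distrib)
  have "(LINT w|M. indicator A w * max 0 (\<bar>X t w\<bar> - K)) =
      (LINT w|M. indicator U w * (X t w - K) + indicator V w * (- X t w - K))"
    using K space_F[OF t]
    by (intro Bochner_Integration.integral_cong refl) (auto simp: U_def V_def indicator_def)
  also have "\<dots> = (LINT w|M. indicator U w * (X T w - K) + indicator V w * (- X T w - K))"
    unfolding lin[OF t] lin[OF T] using mart UV by simp
  also have "\<dots> \<le> (LINT w|M. indicator A w * max 0 (\<bar>X T w\<bar> - K))"
  proof (rule integral_mono)
    show "integrable M (\<lambda>w. indicator U w * (X T w - K) + indicator V w * (- X T w - K))"
      using UVM int[OF T] by (intro Bochner_Integration.integrable_add indint) auto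
    show "integrable M (\<lambda>w. indicator A w * max 0 (\<bar>X T w\<bar> - K))"
      using AM int[OF T] by (intro indint integrable_max) auto
    show "indicator U w * (X T w - K) + indicator V w * (- X T w - K) \<le>
        indicator A w * max 0 (\<bar>X T w\<bar> - K)" for w
      using K by (auto simp: U_def V_def indicator_def)
  qed
  finally show ?thesis .
qed

text \<open>The rounded time equals the right end of the cell containing \<open>r\<close>. Time 0
  needs its own term because the cells are open on the left.\<close>

lemma right_grid_sum:
  fixes \<phi> :: "real \<Rightarrow> real"
  assumes "r \<in> {0..T}"
  shows "\<phi> (right_grid T k r) = of_bool (r \<le> 0) * \<phi> 0 +
    (\<Sum>i<grid_size k. of_bool (grid k i < r \<and> r \<le> grid k (Suc i)) * \<phi> (grid k (Suc i)))"
proof (cases "r = 0")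
  case True
  then show ?thesis
    using T_pos grid_bounds(1)[of k] by (auto simp: right_grid_def not_less[symmetric])
next
  case False
  then have r: "0 < r" "r \<le> T" using assms by auto
  have "(\<Sum>i<grid_size k. of_bool (grid k i < r \<and> r \<le> grid k (Suc i)) * \<phi> (grid k (Suc i))) =
      (\<Sum>i<grid_size k. if i = nat (\<lceil>r * Suc k\<rceil> - 1) then \<phi> (grid k (Suc i)) else 0)"
    unfolding grid_cell(1)[OF r] by (intro sum.cong) auto
  then show ?thesis using r grid_cell(2,4)[OF r, of k] by (simp add: sum.delta del: of_nat_Suc)
qed

text \<open>The time is rounded up to a grid. For finitely many values the claim is the martingale
  property cell by cell, each cell being known at its right end; the excess of the sampled values is
  bounded by that of \<open>X T\<close>, which is the uniform integrability needed to refine the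
  grid.\<close>

lemma
  assumes X: "martingale X"
    and \<rho>: "\<And>w. w \<in> space M \<Longrightarrow> \<rho> w \<in> {0..T}"
    and stop: "\<And>t. t \<in> {0..T} \<Longrightarrow> {w\<in>space M. \<rho> w \<le> t} \<in> sets (F t)"
  shows optional_stopping_integrable: "integrable M (\<lambda>w. X (\<rho> w) w)"
    and optional_stopping: "(LINT w|M. X (\<rho> w) w) = (LINT w|M. X T w)"
proof -
  have T: "T \<in> {0..T}" and zero: "0 \<in> {0..T}" using T_pos by auto
  have int: "integrable M (X r)" if "r \<in> {0..T}" for r using X that by (auto simp: cadlag_martingale_def)
  have cad: "cadlag_process M T X" using X by (simp add: cadlag_martingale_def)
  define B where "B k i = {w\<in>space M. grid k i < \<rho> w \<and> \<rho> w \<le> grid k (Suc i)}" for k i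
  define B0 where "B0 = {w\<in>space M. \<rho> w \<le> 0}"
  have B0: "B0 \<in> sets (F 0)" unfolding B0_def by (rule stop[OF zero])
  have B: "B k i \<in> sets (F (grid k (Suc i)))" for k i
  proof -
    have "{w\<in>space M. \<rho> w \<le> grid k i} \<in> sets (F (grid k (Suc i)))"
      by (rule sets_F_mono[OF _ _ _ stop])
         (use grid_bounds(1)[of k i] grid_bounds(1)[of k "Suc i"] grid_bounds(2)[of k i] in auto)
    then have "{w\<in>space M. \<rho> w \<le> grid k (Suc i)} - {w\<in>space M. \<rho> w \<le> grid k i} \<in> sets (F (grid k (Suc i)))"
      by (rule sets.Diff[OF stop[OF grid_bounds(1)]])
    also have "{w\<in>space M. \<rho> w \<le> grid k (Suc i)} - {w\<in>space M. \<rho> w \<le> grid k i} = B k i"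
      by (auto simp: B_def)
    finally show ?thesis .
  qed
  have BM: "B0 \<in> sets M" "B k i \<in> sets M" for k i
    by (rule sets_F[OF zero B0] sets_F[OF grid_bounds(1) B])+
  \<comment> \<open>Stated for a general \<open>\<phi>\<close> since it serves the process, its
    terminal value and the excess over \<open>K\<close>.\<close>
  have decomp: "\<phi> w (right_grid T k (\<rho> w)) = indicator B0 w * \<phi> w 0 +
      (\<Sum>i<grid_size k. indicator (B k i) w * \<phi> w (grid k (Suc i)))"
    if "w \<in> space M" for \<phi> :: "'a \<Rightarrow> real \<Rightarrow> real" and k w
    using right_grid_sum[OF \<rho>[OF that], of "\<phi> w" k] that
    by (simp add: B0_def B_def indicator_def of_bool_def)
  have indint: "integrable M (\<lambda>w. indicator A w * f w)" if "A \<in> sets M" "integrable M f" for A and f :: "'a \<Rightarrow> real"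
    using integrable_mult_indicator[OF that] by simp
  have decomp_int: "integrable M (\<lambda>w. \<phi> w (right_grid T k (\<rho> w)))"
    "(LINT w|M. \<phi> w (right_grid T k (\<rho> w))) = (LINT w|M. indicator B0 w * \<phi> w 0) +
      (\<Sum>i<grid_size k. \<integral>w. indicator (B k i) w * \<phi> w (grid k (Suc i)) \<partial>M)"
    if \<phi>: "\<And>r. r \<in> {0..T} \<Longrightarrow> integrable M (\<lambda>w. \<phi> w r)" for \<phi> :: "'a \<Rightarrow> real \<Rightarrow> real" and k
  proof -
    have 0: "integrable M (\<lambda>w. indicator B0 w * \<phi> w 0)" using zero by (intro indint BM \<phi>)
    have i: "integrable M (\<lambda>w. indicator (B k i) w * \<phi> w (grid k (Suc i)))" for i
      by (intro indint BM \<phi> grid_bounds)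
    have cong: "integrable M (\<lambda>w. \<phi> w (right_grid T k (\<rho> w))) \<longleftrightarrow> integrable M (\<lambda>w. indicator B0 w * \<phi> w 0 +
      (\<Sum>i<grid_size k. indicator (B k i) w * \<phi> w (grid k (Suc i))))"
      by (intro Bochner_Integration.integrable_cong refl decomp)
    show "integrable M (\<lambda>w. \<phi> w (right_grid T k (\<rho> w)))"
      unfolding cong by (intro Bochner_Integration.integrable_add Bochner_Integration.integrable_sum 0 i)
    have "(LINT w|M. \<phi> w (right_grid T k (\<rho> w))) = (LINT w|M. indicator B0 w * \<phi> w 0 +
      (\<Sum>i<grid_size k. indicator (B k i) w * \<phi> w (grid k (Suc i))))"
      by (intro Bochner_Integration.integral_cong refl decomp)
    also have "\<dots> = (LINT w|M. indicator B0 w * \<phi> w 0) +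
      (LINT w|M. (\<Sum>i<grid_size k. indicator (B k i) w * \<phi> w (grid k (Suc i))))"
      by (intro Bochner_Integration.integral_add Bochner_Integration.integrable_sum 0 i)
    also have "(LINT w|M. (\<Sum>i<grid_size k. indicator (B k i) w * \<phi> w (grid k (Suc i)))) =
      (\<Sum>i<grid_size k. \<integral>w. indicator (B k i) w * \<phi> w (grid k (Suc i)) \<partial>M)"
      by (intro Bochner_Integration.integral_sum i)
    finally show "(LINT w|M. \<phi> w (right_grid T k (\<rho> w))) = (LINT w|M. indicator B0 w * \<phi> w 0) +
      (\<Sum>i<grid_size k. \<integral>w. indicator (B k i) w * \<phi> w (grid k (Suc i)) \<partial>M)" .
  qed
  have mart: "int_on A (X r) = int_on A (X T)"
    if "r \<in> {0..T}" "A \<in> sets (F r)" for r A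
    using cadlag_martingale_integral[OF X _ _ _ that(2), of T] that by auto
  \<comment> \<open>The decompositions of \<open>X\<close> and of the constant family
    \<open>X T\<close> are compared term by term.\<close>
  have eq: "(LINT w|M. X (right_grid T k (\<rho> w)) w) = (LINT w|M. X T w)" for k
    using decomp_int(2)[of "\<lambda>w r. X r w" k] decomp_int(2)[of "\<lambda>w r. X T w" k] int T
      mart[OF zero B0] mart[OF grid_bounds(1) B] by simp
  define \<epsilon> where "\<epsilon> K = (LINT w|M. max 0 (\<bar>X T w\<bar> - K))" for K
  have max_int: "integrable M (\<lambda>w. max 0 (\<bar>X r w\<bar> - K))" if "r \<in> {0..T}" for r K
    using int[OF that] by (intro integrable_max) auto
  have tail: "(LINT w|M. max 0 (\<bar>X (right_grid T k (\<rho> w)) w\<bar> - K)) \<le> \<epsilon> K" if "0 \<le> K" for k K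
  proof -
    have "(LINT w|M. max 0 (\<bar>X (right_grid T k (\<rho> w)) w\<bar> - K)) =
        (LINT w|M. indicator B0 w * max 0 (\<bar>X 0 w\<bar> - K)) +
        (\<Sum>i<grid_size k. \<integral>w. indicator (B k i) w * max 0 (\<bar>X (grid k (Suc i)) w\<bar> - K) \<partial>M)"
      using decomp_int(2)[of "\<lambda>w r. max 0 (\<bar>X r w\<bar> - K)" k] max_int by simp
    also have "\<dots> \<le> (LINT w|M. indicator B0 w * max 0 (\<bar>X T w\<bar> - K)) +
        (\<Sum>i<grid_size k. \<integral>w. indicator (B k i) w * max 0 (\<bar>X T w\<bar> - K) \<partial>M)"
      using that by (intro add_mono sum_mono cadlag_martingale_abs X B0 B grid_bounds zero)
    also have "\<dots> = \<epsilon> K"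
      using decomp_int(2)[of "\<lambda>w r. max 0 (\<bar>X T w\<bar> - K)" k] max_int[OF T] by (simp add: \<epsilon>_def)
    finally show ?thesis .
  qed
  have \<epsilon>: "(\<epsilon> \<longlongrightarrow> 0) at_top"
  proof -
    have "((\<lambda>K. \<integral>w. max 0 (\<bar>X T w\<bar> - K) \<partial>M) \<longlongrightarrow> (LINT w|M. 0)) at_top"
    proof (rule integral_dominated_convergence_at_top[where w = "\<lambda>w. \<bar>X T w\<bar>"])
      show "(\<lambda>w. max 0 (\<bar>X T w\<bar> - K)) \<in> borel_measurable M" for K using max_int[OF T] by blast
      show "AE w in M. ((\<lambda>K. max 0 (\<bar>X T w\<bar> - K)) \<longlongrightarrow> 0) at_top"
      proof (rule AE_I2)
        fix w
        have "\<forall>\<^sub>F K in at_top. max 0 (\<bar>X T w\<bar> - K) = 0"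
          using eventually_ge_at_top[of "\<bar>X T w\<bar>"] by eventually_elim simp
        then show "((\<lambda>K. max 0 (\<bar>X T w\<bar> - K)) \<longlongrightarrow> 0) at_top" by (rule tendsto_eventually)
      qed
      show "\<forall>\<^sub>F K in at_top. AE w in M. norm (max 0 (\<bar>X T w\<bar> - K)) \<le> \<bar>X T w\<bar>"
        using eventually_ge_at_top[of 0] by eventually_elim simp
    qed (use int[OF T] in auto)
    then show ?thesis by (simp add: \<epsilon>_def[abs_def])
  qed
  have [measurable]: "\<rho> \<in> borel_measurable M"
  proof (rule borel_measurableI_le)
    fix y
    consider "y < 0" | "y \<in> {0..T}" | "T < y" by fastforce
    then show "{w\<in>space M. \<rho> w \<le> y} \<in> sets M"
    proof cases
      case 1
      then have "{w\<in>space M. \<rho> w \<le> y} = {}" using \<rho> by fastforce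
      then show ?thesis by (simp only: sets.empty_sets)
    next
      case 2
      show ?thesis by (rule sets_F[OF 2 stop[OF 2]])
    next
      case 3
      then have "{w\<in>space M. \<rho> w \<le> y} = space M" using \<rho> by fastforce
      then show ?thesis by (simp only: sets.top)
    qed
  qed
  have meas: "(\<lambda>w. X (\<rho> w) w) \<in> borel_measurable M"
    by (rule measurable_at_random_time[OF _ cad]) (use int \<rho> in auto)
  have f_int: "integrable M (\<lambda>w. X (right_grid T k (\<rho> w)) w)" for k
    using decomp_int(1)[of "\<lambda>w r. X r w" k] int by simp
  have lim: "(\<lambda>k. X (right_grid T k (\<rho> w)) w) \<longlonglongrightarrow> X (\<rho> w) w" if "w \<in> space M" for w
    using cadlag_right_grid[OF cad that] \<rho>[OF that] by auto
  show "integrable M (\<lambda>w. X (\<rho> w) w)"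
    by (rule tendsto_integral_uniformly_integrable(1)[OF f_int meas lim tail \<epsilon>])
  have "(\<lambda>k. \<integral>w. X (right_grid T k (\<rho> w)) w \<partial>M) \<longlonglongrightarrow> (LINT w|M. X (\<rho> w) w)"
    by (rule tendsto_integral_uniformly_integrable(2)[OF f_int meas lim tail \<epsilon>])
  then show "(LINT w|M. X (\<rho> w) w) = (LINT w|M. X T w)"
    by (simp add: eq LIMSEQ_const_iff)
qed

definition stopped_time :: "('a \<Rightarrow> ereal) \<Rightarrow> real \<Rightarrow> 'a \<Rightarrow> real" where
  "stopped_time \<sigma> t w = real_of_ereal (min (ereal t) (\<sigma> w))"

lemma stopped_process_eq: "stopped_process X \<sigma> t w = X (stopped_time \<sigma> t w) w"
  by (simp add: stopped_process_def stopped_time_def)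

lemma
  assumes \<sigma>: "stopping \<sigma>" and "w \<in> space M" "t \<in> {0..T}"
  shows stopped_time_bounds: "stopped_time \<sigma> t w \<in> {0..t}"
    and stopped_time_le_iff: "stopped_time \<sigma> t w \<le> u \<longleftrightarrow> t \<le> u \<or> \<sigma> w \<le> ereal u"
    and stopped_time_min: "s \<in> {0..t} \<Longrightarrow> stopped_time \<sigma> s w = min s (stopped_time \<sigma> t w)"
proof -
  have "\<sigma> w \<in> ereal ` {0..T} \<union> {\<infinity>}" using assms by (auto simp: stop_time_def random_time_def)
  then consider r where "\<sigma> w = ereal r" "0 \<le> r" "r \<le> T" | "\<sigma> w = \<infinity>" by auto
  note cases = this
  show "stopped_time \<sigma> t w \<in> {0..t}" "stopped_time \<sigma> t w \<le> u \<longleftrightarrow> t \<le> u \<or> \<sigma> w \<le> ereal u"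
    using cases by (cases; use assms(3) in \<open>auto simp: stopped_time_def min_def\<close>)+
  show "stopped_time \<sigma> s w = min s (stopped_time \<sigma> t w)" if "s \<in> {0..t}"
    using cases by (cases; use assms(3) that in \<open>auto simp: stopped_time_def min_def\<close>)
qed

text \<open>The time that is \<open>s\<close> capped by \<open>\<sigma>\<close> on \<open>A\<close>
  and \<open>t\<close> capped by \<open>\<sigma>\<close> off \<open>A\<close> is again a stopping
  time, because \<open>A\<close> is known at \<open>s\<close>. Optional stopping gives it the
  expectation of \<open>X T\<close>.\<close>

lemma
  assumes X: "martingale X" and \<sigma>: "stopping \<sigma>"
  shows stopped_martingale_integrable: "t \<in> {0..T} \<Longrightarrow> integrable M (stopped_process X \<sigma> t)"
    and stopped_martingale: "0 \<le> s \<Longrightarrow> s \<le> t \<Longrightarrow> t \<le> T \<Longrightarrow> A \<in> sets (F s) \<Longrightarrow>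
      (int_on A (stopped_process X \<sigma> t)) = (int_on A (stopped_process X \<sigma> s))"
proof -
  have main: "integrable M (\<lambda>w. X (if w \<in> A then stopped_time \<sigma> s w else stopped_time \<sigma> t w) w)"
    "(LINT w|M. X (if w \<in> A then stopped_time \<sigma> s w else stopped_time \<sigma> t w) w) = (LINT w|M. X T w)"
    if st: "0 \<le> s" "s \<le> t" "t \<le> T" and A: "A \<in> sets (F s)" for s t A
  proof -
    let ?\<rho> = "\<lambda>w. if w \<in> A then stopped_time \<sigma> s w else stopped_time \<sigma> t w"
    have A_sub: "A \<subseteq> space M" using sets.sets_into_space[OF A] space_F[of s] st by auto
    have 1: "?\<rho> w \<in> {0..T}" if "w \<in> space M" for w
      using stopped_time_bounds[OF \<sigma> that, of s] stopped_time_bounds[OF \<sigma> that, of t] st by auto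
    have 2: "{w\<in>space M. ?\<rho> w \<le> u} \<in> sets (F u)" if u: "u \<in> {0..T}" for u
    proof -
      have \<sigma>u: "{w\<in>space M. \<sigma> w \<le> ereal u} \<in> sets (F u)" using \<sigma> u by (simp add: stop_time_def)
      have eq: "{w\<in>space M. ?\<rho> w \<le> u} =
          {w\<in>space M. \<sigma> w \<le> ereal u \<or> t \<le> u \<or> (w \<in> A \<and> s \<le> u)}"
        using st stopped_time_le_iff[OF \<sigma>] by (auto split: if_splits)
      consider "u < s" | "s \<le> u" "u < t" | "t \<le> u" by linarith
      then show ?thesis
      proof cases
        case 1
        then have "{w\<in>space M. ?\<rho> w \<le> u} = {w\<in>space M. \<sigma> w \<le> ereal u}" unfolding eq using st by auto
        then show ?thesis using \<sigma>u by (simp only:)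
      next
        case 2
        then have "{w\<in>space M. ?\<rho> w \<le> u} = {w\<in>space M. \<sigma> w \<le> ereal u} \<union> A"
          unfolding eq using A_sub by auto
        moreover have "A \<in> sets (F u)" using A st 2 u by (intro sets_F_mono[of s u]) auto
        ultimately show ?thesis using \<sigma>u by (simp only: sets.Un)
      next
        case 3
        then have "{w\<in>space M. ?\<rho> w \<le> u} = space (F u)" unfolding eq using space_F[OF u] by auto
        then show ?thesis by (simp only: sets.top)
      qed
    qed
    show "integrable M (\<lambda>w. X (?\<rho> w) w)" "(LINT w|M. X (?\<rho> w) w) = (LINT w|M. X T w)"
      by (rule optional_stopping_integrable[OF X 1 2] optional_stopping[OF X 1 2]; assumption)+
  qed
  show int: "integrable M (stopped_process X \<sigma> t)" if "t \<in> {0..T}" for t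
    using main(1)[of t t "{}"] that by (simp add: stopped_process_eq[abs_def])
  assume st: "0 \<le> s" "s \<le> t" "t \<le> T" and A: "A \<in> sets (F s)"
  then have AM: "A \<in> sets M" using sets_F[of s] by auto
  have i: "integrable M (\<lambda>w. indicator A w * stopped_process X \<sigma> r w)" if "r \<in> {0..T}" for r
    using integrable_mult_indicator[OF AM int[OF that]] by simp
  have "(LINT w|M. stopped_process X \<sigma> t w) - (int_on A (stopped_process X \<sigma> t))
      + (int_on A (stopped_process X \<sigma> s)) =
      (LINT w|M. stopped_process X \<sigma> t w - indicator A w * stopped_process X \<sigma> t w
        + indicator A w * stopped_process X \<sigma> s w)"
    using st i[of s] i[of t] int[of t] by simp
  also have "\<dots> = (LINT w|M. X (if w \<in> A then stopped_time \<sigma> s w else stopped_time \<sigma> t w) w)"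
    by (intro Bochner_Integration.integral_cong) (auto simp: stopped_process_eq)
  \<comment> \<open>The empty event gives the comparison time \<open>t\<close> capped by
    \<open>\<sigma>\<close>, with the same expectation; the parts off \<open>A\<close>
    cancel.\<close>
  also have "\<dots> = (LINT w|M. X (if w \<in> {} then stopped_time \<sigma> s w else stopped_time \<sigma> t w) w)"
    using main(2)[OF st A] main(2)[OF st, of "{}"] by simp
  also have "\<dots> = (LINT w|M. stopped_process X \<sigma> t w)"
    by (simp add: stopped_process_eq)
  finally show "(int_on A (stopped_process X \<sigma> t)) =
      (int_on A (stopped_process X \<sigma> s))" by simp
qed

end

subsection \<open>Predictable local martingales of finite variation\<close>

context standard_filtration
begin

lemma stop_time_min:
  assumes "stopping \<sigma>" "stopping \<tau>"
  shows "stopping (\<lambda>w. min (\<sigma> w) (\<tau> w))"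
  unfolding stop_time_def random_time_def
proof (intro conjI ballI)
  have [measurable]: "\<sigma> \<in> borel_measurable M" "\<tau> \<in> borel_measurable M"
    using assms by (auto simp: stop_time_def random_time_def)
  show "(\<lambda>w. min (\<sigma> w) (\<tau> w)) \<in> borel_measurable M" by measurable
  fix w assume "w \<in> space M"
  then have "\<sigma> w \<in> ereal ` {0..T} \<union> {\<infinity>}" "\<tau> w \<in> ereal ` {0..T} \<union> {\<infinity>}"
    using assms by (auto simp: stop_time_def random_time_def)
  then show "min (\<sigma> w) (\<tau> w) \<in> ereal ` {0..T} \<union> {\<infinity>}" unfolding min_def by presburger
next
  fix t assume t: "t \<in> {0..T}"
  have "{w\<in>space M. min (\<sigma> w) (\<tau> w) \<le> ereal t} =
      {w\<in>space M. \<sigma> w \<le> ereal t} \<union> {w\<in>space M. \<tau> w \<le> ereal t}"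
    by (auto simp: min_le_iff_disj)
  then show "{w\<in>space M. min (\<sigma> w) (\<tau> w) \<le> ereal t} \<in> sets (F t)"
    using assms t by (auto simp: stop_time_def)
qed

lemma stop_time_const:
  assumes "r \<in> {0..T}" shows "stopping (\<lambda>_. ereal r)"
  unfolding stop_time_def random_time_def
proof (intro conjI ballI)
  fix t assume t: "t \<in> {0..T}"
  have "{w\<in>space M. ereal r \<le> ereal t} = (if r \<le> t then space (F t) else {})"
    using space_F[OF t] by auto
  then show "{w\<in>space M. ereal r \<le> ereal t} \<in> sets (F t)" by (simp only: sets.top sets.empty_sets split: if_split) simp
qed (use assms in auto)

lemma stopped_stopped_process:
  assumes "stopping \<rho>" "stopping \<tau>" "w \<in> space M" "t \<in> {0..T}"
  shows "stopped_process (stopped_process X \<rho>) \<tau> t w = stopped_process X (\<lambda>w. min (\<rho> w) (\<tau> w)) t w"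
proof -
  have "\<tau> w \<in> ereal ` {0..T} \<union> {\<infinity>}"
    using assms by (auto simp: stop_time_def random_time_def)
  then have "ereal (real_of_ereal (min (ereal t) (\<tau> w))) = min (ereal t) (\<tau> w)"
    by (auto simp: min_def)
  then show ?thesis by (simp add: stopped_process_def ac_simps)
qed

text \<open>Stopped at the minimum of \<open>\<rho>\<close> and \<open>\<tau>\<close>,
  \<open>D\<close> becomes a difference of two stopped martingales, so \<open>Y\<close> is
  integrable with constant expectations over past events. Its total variation is at most
  \<open>2 * k + \<bar>Y T w\<bar>\<close>, hence integrable, although the jump at the stopping time
  has no bound.\<close>

lemma stopped_difference_zero:
  assumes X1: "martingale X1" and \<rho>: "stopping \<rho>"
    and X2: "martingale (stopped_process X2 \<rho>)" and \<tau>: "stopping \<tau>"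
    and D: "predictable D" and cad: "cadlag_process M T D"
    and D0: "\<And>w. w \<in> space M \<Longrightarrow> D 0 w = 0"
    and eq: "AE w in M. \<forall>t\<in>{0..T}. D t w = X1 t w - X2 t w"
    and bound: "\<And>w ts. w \<in> space M \<Longrightarrow> sorted ts \<Longrightarrow>
      set ts \<subseteq> \<rat> \<inter> {0..<stopped_time (\<lambda>w. min (\<rho> w) (\<tau> w)) T w} \<Longrightarrow> list_var (\<lambda>t. D t w) ts \<le> k"
  shows "AE w in M. D (stopped_time (\<lambda>w. min (\<rho> w) (\<tau> w)) T w) w = 0"
proof -
  let ?\<kappa> = "\<lambda>w. min (\<rho> w) (\<tau> w)"
  have \<kappa>: "stopping ?\<kappa>" by (rule stop_time_min[OF \<rho> \<tau>])
  have T: "T \<in> {0..T}" and T0: "0 \<in> {0..T}" using T_pos by auto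
  define r where "r = stopped_time ?\<kappa> T"
  have r: "r w \<in> {0..T}" if "w \<in> space M" for w
    unfolding r_def by (rule stopped_time_bounds[OF \<kappa> that T])
  define Y where "Y = stopped_process D ?\<kappa>"
  have Y: "Y t w = D (min t (r w)) w" if "w \<in> space M" "t \<in> {0..T}" for t w
    unfolding Y_def stopped_process_eq r_def using stopped_time_min[OF \<kappa> that(1) T that(2)] by simp
  have Y_eq: "AE w in M. Y t w = stopped_process X1 ?\<kappa> t w - stopped_process (stopped_process X2 \<rho>) \<tau> t w"
    if t: "t \<in> {0..T}" for t
    using eq AE_space
  proof eventually_elim
    case (elim w)
    have "stopped_time ?\<kappa> t w \<in> {0..T}" using stopped_time_bounds[OF \<kappa> elim(2) t] t by auto
    with elim(1) show ?case
      unfolding stopped_stopped_process[OF \<rho> \<tau> elim(2) t] Y_def by (simp add: stopped_process_eq)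
  qed
  have i1: "integrable M (stopped_process X1 ?\<kappa> t)" if "t \<in> {0..T}" for t
    by (rule stopped_martingale_integrable[OF X1 \<kappa> that])
  have i2: "integrable M (stopped_process (stopped_process X2 \<rho>) \<tau> t)" if "t \<in> {0..T}" for t
    by (rule stopped_martingale_integrable[OF X2 \<tau> that])
  have \<kappa>_meas: "?\<kappa> \<in> borel_measurable M" using \<kappa> by (simp add: stop_time_def random_time_def)
  have Ym: "Y t \<in> borel_measurable M" if t: "t \<in> {0..T}" for t
    unfolding Y_def stopped_process_eq[abs_def]
  proof (rule measurable_at_random_time[OF _ cad])
    show "D s \<in> borel_measurable M" if "s \<in> {0..T}" for s
      using predictable_adapted[OF D] that by (auto simp: adapted_process_def intro: measurable_F_M)
    show "stopped_time ?\<kappa> t \<in> borel_measurable M"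
      unfolding stopped_time_def using \<kappa>_meas by measurable
    show "stopped_time ?\<kappa> t w \<in> {0..T}" if "w \<in> space M" for w
      using stopped_time_bounds[OF \<kappa> that t] t by auto
  qed
  have Yi: "integrable M (Y t)" if t: "t \<in> {0..T}" for t
    using integrable_cong_AE[OF Ym[OF t] _ Y_eq[OF t]] i1[OF t] i2[OF t] by auto
  have mart: "int_on A (Y t) = int_on A (Y s)"
    if st: "0 \<le> s" "s < t" "t \<le> T" and A: "A \<in> sets (F s)" for s t A
  proof -
    have AM [measurable]: "A \<in> sets M" using A sets_F[of s] st by auto
    have E: "(int_on A (Y q)) = (int_on A (stopped_process X1 ?\<kappa> q))
        - (int_on A (stopped_process (stopped_process X2 \<rho>) \<tau> q))" if q: "q \<in> {0..T}" for q
    proof -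
      have [measurable]: "Y q \<in> borel_measurable M" "stopped_process X1 ?\<kappa> q \<in> borel_measurable M"
        "stopped_process (stopped_process X2 \<rho>) \<tau> q \<in> borel_measurable M"
        using Ym[OF q] i1[OF q] i2[OF q] by auto
      have "(int_on A (Y q)) = (LINT w|M. indicator A w * stopped_process X1 ?\<kappa> q w
          - indicator A w * stopped_process (stopped_process X2 \<rho>) \<tau> q w)"
        using Y_eq[OF q] by (intro integral_cong_AE) (auto simp: right_diff_distrib)
      then show ?thesis
        using integrable_mult_indicator[OF AM i1[OF q]] integrable_mult_indicator[OF AM i2[OF q]] by simp
    qed
    show ?thesis
      using st stopped_martingale[OF X1 \<kappa> _ _ _ A, of t] stopped_martingale[OF X2 \<tau> _ _ _ A, of t]
      by (simp add: E)
  qed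
  \<comment> \<open>The stopped path continued as a constant to all later times, since the variation
    functional looks at rationals beyond \<open>T\<close>.\<close>
  define f where "f w t = D (min t (r w)) w" for w t
  have fY: "f w t = Y t w" if "w \<in> space M" "t \<in> {0..T}" for w t
    using Y[OF that] by (simp add: f_def)
  have f_clip: "f w t = Y (min t T) w" if "w \<in> space M" "0 \<le> t" for w t
  proof -
    have "min (min t T) (r w) = min t (r w)" using r[OF that(1)] by auto
    then show ?thesis using Y[OF that(1), of "min t T"] that T_pos by (simp add: f_def)
  qed
  have lv: "list_var (f w) ts \<le> 2 * k + \<bar>Y T w\<bar>" if "w \<in> space M" "ts \<in> rat_lists q" for w ts q
  proof -
    have "list_var (\<lambda>t. D (min t (r w)) w) ts \<le> 2 * k + \<bar>D (r w) w\<bar>"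
      using bound[OF that(1)] r[OF that(1)] D0[OF that(1)] that(2)
      by (intro list_var_stopped_le[where f = "\<lambda>t. D t w"]) (auto simp: rat_lists_def r_def)
    then show ?thesis using Y[OF that(1) T] r[OF that(1)] by (simp add: f_def[abs_def] min_absorb2)
  qed
  have f_right: "(f w \<longlongrightarrow> f w t) (at_right t)" if "w \<in> space M" "0 \<le> t" for w t
  proof (cases "t < r w")
    case True
    have "((\<lambda>s. D s w) \<longlongrightarrow> D t w) (at_right t)"
      using that True r[OF that(1)] by (intro cadlag_right[OF cad]) auto
    moreover have "\<forall>\<^sub>F s in at_right t. D s w = f w s"
      using True by (auto simp: f_def eventually_at_right[of t "r w"] intro!: exI[of _ "r w"])
    ultimately show ?thesis using True by (auto simp: f_def min_absorb1 intro: Lim_transform_eventually)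
  next
    case False
    then have "\<forall>\<^sub>F s in at_right t. f w s = f w t"
      by (auto simp: f_def eventually_at_filter min_def)
    then show ?thesis by (rule tendsto_eventually)
  qed
  define P where "P t w = right_var (f w) t" for t w
  \<comment> \<open>\<open>P\<close> is the full variation, whose increments dominate those of
    \<open>Y\<close> in modulus; hence \<open>P\<close> minus \<open>Y\<close> is increasing as
    well.\<close>
  define N where "N t w = P t w - Y t w" for t w
  have Pm: "P t \<in> borel_measurable M" for t
    unfolding P_def right_var_def rat_var_def
  proof (intro borel_measurable_cINF_real borel_measurable_cSUP)
    fix q ts assume "ts \<in> rat_lists q"
    then have pos: "0 \<le> ts ! i" if "i < length ts" for i
      using \<open>ts \<in> rat_lists q\<close> nth_mem[OF that] by (auto simp: rat_lists_def)
    have fm: "(\<lambda>w. f w a) \<in> borel_measurable M" if "0 \<le> a" for a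
    proof -
      have "Y (min a T) \<in> borel_measurable M" using that T_pos by (intro Ym) auto
      also have "?this \<longleftrightarrow> ?thesis" using f_clip that by (intro measurable_cong) auto
      finally show ?thesis .
    qed
    show "(\<lambda>w. list_var (f w) ts) \<in> borel_measurable M"
      unfolding list_var_sum
      by (intro borel_measurable_sum borel_measurable_abs borel_measurable_diff fm pos) auto
  next
    fix q w assume "w \<in> space M"
    then show "bdd_above ((\<lambda>ts. list_var (f w) ts) ` rat_lists q)"
      using lv by (auto simp: bdd_above_def)
  qed (auto simp: countable_rat countable_rat_lists intro: countable_Int1)
  have Pi: "integrable M (P t)" for t
  proof (rule Bochner_Integration.integrable_bound)
    show "integrable M (\<lambda>w. 2 * k + \<bar>Y T w\<bar>)" using Yi[OF T] by simp
    show "AE w in M. norm (P t w) \<le> norm (2 * k + \<bar>Y T w\<bar>)"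
    proof (rule AE_I2)
      fix w assume w: "w \<in> space M"
      have "0 \<le> P t w" "P t w \<le> 2 * k + \<bar>Y T w\<bar>"
        unfolding P_def by (rule right_var_bounds[OF lv[OF w]]; assumption)+
      then show "norm (P t w) \<le> norm (2 * k + \<bar>Y T w\<bar>)" by simp
    qed
  qed (rule Pm)
  have incP: "increasing_process P"
    unfolding increasing_process_def
  proof (intro conjI ballI)
    fix w assume w: "w \<in> space M"
    show "mono_on {0..T} (\<lambda>t. P t w)"
      unfolding P_def using right_var_mono[OF lv[OF w]] by (intro mono_onI) auto
    fix t
    show "((\<lambda>s. P s w) \<longlongrightarrow> P t w) (at_right t)"
      unfolding P_def by (rule right_var_right_continuous[OF lv[OF w]])
  qed (rule Pi)
  have Y_incr: "\<bar>Y t w - Y s w\<bar> \<le> P t w - P s w" if "w \<in> space M" "0 \<le> s" "s \<le> t" "t \<le> T" for w s t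
    using right_var_increment[OF lv[OF that(1)] f_right[OF that(1)] that(2,3)] that
      fY[OF that(1), of s] fY[OF that(1), of t] by (simp add: P_def)
  have incN: "increasing_process N"
    unfolding increasing_process_def
  proof (intro conjI ballI)
    fix w assume w: "w \<in> space M"
    show "mono_on {0..T} (\<lambda>t. N t w)"
    proof (rule mono_onI)
      fix s t assume "s \<in> {0..T}" "t \<in> {0..T}" "s \<le> t"
      then show "N s w \<le> N t w" using Y_incr[OF w, of s t] by (simp add: N_def)
    qed
    fix t assume t: "t \<in> {0..<T}"
    have "\<forall>\<^sub>F s in at_right t. f w s = Y s w"
      using t fY[OF w] by (auto simp: eventually_at_right[of t T] intro!: exI[of _ T])
    then have "((\<lambda>s. Y s w) \<longlongrightarrow> Y t w) (at_right t)"
      using f_right[OF w, of t] t fY[OF w, of t] by (auto intro: Lim_transform_eventually)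
    then show "((\<lambda>s. N s w) \<longlongrightarrow> N t w) (at_right t)"
      unfolding N_def P_def by (intro tendsto_diff right_var_right_continuous[OF lv[OF w]])
  next
    fix t assume "t \<in> {0..T}"
    then show "integrable M (N t)" unfolding N_def using Pi Yi by auto
  qed
  have flatP: "P T w = P (r w) w" if "w \<in> space M" for w
    unfolding P_def using r[OF that]
    by (intro right_var_flat[OF lv[OF that]]) (auto simp: f_def min_absorb2)
  have "AE w in M. Y T w = 0"
  proof (rule predictable_stopped_martingale[OF incP incN _ Yi mart D cad r Y flatP])
    show "N T w = N (r w) w" if "w \<in> space M" for w
      using flatP[OF that] Y[OF that T] Y[OF that r[OF that]] r[OF that] by (simp add: N_def)
    show "Y 0 w = 0" if "w \<in> space M" for w
      using Y[OF that T0] r[OF that] D0[OF that] by (simp add: min_absorb1)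
  qed (auto simp: N_def)
  then show ?thesis by (simp add: Y_def stopped_process_eq)
qed

section \<open>Localisation of the variation and uniqueness of the compensator\<close>

lemma stop_time_Inf_rat:
  assumes E: "\<And>q. q \<in> {0..<T} \<Longrightarrow> E q \<in> sets (F q)"
  shows "stopping (\<lambda>w. INF q\<in>\<rat> \<inter> {0..<T}. if w \<in> E q then ereal q else \<infinity>)"
proof -
  let ?Q = "\<rat> \<inter> {0..<T}"
  define \<sigma> where "\<sigma> w = (INF q\<in>?Q. if w \<in> E q then ereal q else \<infinity>)" for w
  have EM: "E q \<in> sets M" if "q \<in> ?Q" for q using that E[of q] sets_F[of q] by auto
  have less_iff: "\<sigma> w < ereal t \<longleftrightarrow> (\<exists>q\<in>?Q. w \<in> E q \<and> q < t)" for w t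
    unfolding \<sigma>_def INF_less_iff by (auto split: if_splits)
  have less: "{w\<in>space M. \<sigma> w < ereal t} \<in> sets (F t)" if t: "t \<in> {0..T}" for t
  proof -
    have sub: "E q \<subseteq> space M" if "q \<in> ?Q" for q
      by (rule sets.sets_into_space[OF EM[OF that]])
    have "{w\<in>space M. \<sigma> w < ereal t} = {w\<in>space M. \<exists>q\<in>?Q. w \<in> E q \<and> q < t}"
      by (simp only: less_iff)
    also have "\<dots> = (\<Union>q\<in>?Q \<inter> {..<t}. E q)"
      using sub by blast
    finally have "{w\<in>space M. \<sigma> w < ereal t} = (\<Union>q\<in>?Q \<inter> {..<t}. E q)" .
    moreover have "E q \<in> sets (F t)" if "q \<in> ?Q \<inter> {..<t}" for q
      using that t by (intro sets_F_mono[of q t] E) auto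
    moreover have "countable (?Q \<inter> {..<t})" by (intro countable_Int1 countable_rat)
    ultimately show ?thesis by (simp only:) (intro sets.countable_UN'; blast)
  qed
  have val: "\<sigma> w = \<infinity> \<or> (0 \<le> \<sigma> w \<and> \<sigma> w < ereal T)" for w
  proof (cases "\<exists>q\<in>?Q. w \<in> E q")
    case True
    then have "\<exists>q\<in>?Q. w \<in> E q \<and> q < T" by auto
    then have "\<sigma> w < ereal T" by (simp only: less_iff)
    moreover have "0 \<le> \<sigma> w" unfolding \<sigma>_def by (intro INF_greatest) auto
    ultimately show ?thesis by simp
  next
    case False
    then have "\<sigma> w = (INF q\<in>?Q. \<infinity>)" unfolding \<sigma>_def by (intro INF_cong) auto
    moreover have "?Q \<noteq> {}" using T_pos by auto
    ultimately show ?thesis by simp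
  qed
  have "stopping \<sigma>"
    unfolding stop_time_def random_time_def
  proof (intro conjI ballI)
    show "\<sigma> \<in> borel_measurable M"
      unfolding \<sigma>_def using EM by (intro borel_measurable_INF countable_Int1 countable_rat) auto
    show "\<sigma> w \<in> ereal ` {0..T} \<union> {\<infinity>}" for w
      using val[of w] by (cases "\<sigma> w") auto
    fix t assume t: "t \<in> {0..T}"
    show "{w\<in>space M. \<sigma> w \<le> ereal t} \<in> sets (F t)"
    proof (cases "t = T")
      case True
      \<comment> \<open>Right-continuity of the filtration, which settles \<open>t < T\<close>, is
        void at \<open>T\<close>. Only rationals below \<open>T\<close> compete in the infimum, so a
        finite value is strictly below \<open>T\<close>.\<close>
      have "\<sigma> w \<le> ereal T \<longleftrightarrow> \<sigma> w < ereal T" for w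
        using val[of w] by auto
      then have "{w\<in>space M. \<sigma> w \<le> ereal t} = {w\<in>space M. \<sigma> w < ereal t}"
        by (simp only: True)
      with less[OF t] show ?thesis by (simp only:)
    next
      case False
      show ?thesis
      proof (rule sets_F_right)
        fix s assume s: "t < s" "s \<le> T"
        let ?t = "\<lambda>n::nat. t + (s - t) / Suc n"
        have tn: "t < ?t n" "?t n \<le> s" for n
          using s divide_left_mono[of 1 "real (Suc n)" "s - t"] by (auto simp del: of_nat_Suc)
        have lim: "?t \<longlonglongrightarrow> t"
          using tendsto_add[OF tendsto_const LIMSEQ_Suc[OF lim_const_over_n[of "s - t"]], of t] by simp
        have "{w\<in>space M. \<sigma> w \<le> ereal t} = (\<Inter>n. {w\<in>space M. \<sigma> w < ereal (?t n)})"
        proof (intro equalityI subsetI)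
          fix w assume "w \<in> {w\<in>space M. \<sigma> w \<le> ereal t}"
          then have "w \<in> space M" "\<sigma> w \<le> ereal t" by blast+
          moreover have "\<sigma> w < ereal (?t n)" for n
            using \<open>\<sigma> w \<le> ereal t\<close> by (rule le_less_trans) (use tn(1) in simp)
          ultimately show "w \<in> (\<Inter>n. {w\<in>space M. \<sigma> w < ereal (?t n)})" by blast
        next
          fix w assume *: "w \<in> (\<Inter>n. {w\<in>space M. \<sigma> w < ereal (?t n)})"
          then have "\<sigma> w \<le> ereal (?t n)" for n by (intro less_imp_le) blast
          then have "\<sigma> w \<le> ereal t"
            by (intro tendsto_lowerbound[OF tendsto_ereal[OF lim]] always_eventually allI) simp_all
          with * show "w \<in> {w\<in>space M. \<sigma> w \<le> ereal t}" by blast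
        qed
        moreover have "{w\<in>space M. \<sigma> w < ereal (?t n)} \<in> sets (F s)" for n
          using tn[of n] t s by (intro sets_F_mono[of "?t n" s] less) auto
        then have "(\<Inter>n. {w\<in>space M. \<sigma> w < ereal (?t n)}) \<in> sets (F s)"
          by (intro sets.countable_INT) blast+
        ultimately show "{w\<in>space M. \<sigma> w \<le> ereal t} \<in> sets (F s)" by (simp only:)
      qed (use t False in auto)
    qed
  qed
  then show ?thesis by (simp only: \<sigma>_def[abs_def])
qed


lemma predictable_process_indicator:
  assumes X: "predictable X" and G: "G \<in> sets (F 0)"
  shows "predictable (\<lambda>t w. X t w * indicator G w)"
proof -
  have "(\<lambda>p. indicator ({0..T} \<times> G) p :: real) \<in> borel_measurable Pred"
    by (intro borel_measurable_indicator Pred_cylinder G)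
  then have "(\<lambda>p. (case p of (t, w) \<Rightarrow> X t w) * indicator ({0..T} \<times> G) p) \<in> borel_measurable Pred"
    using X unfolding predictable_process_def by (intro borel_measurable_times)
  also have "?this \<longleftrightarrow> ?thesis"
    unfolding predictable_process_def by (intro measurable_cong) (auto simp: indicator_def)
  finally show ?thesis .
qed

text \<open>Localisation by the first time at which the rational variation exceeds \<open>k\<close>:
  strictly before it the variation is at most \<open>k\<close>. Stopping in addition at a constant
  \<open>t\<close> yields \<open>D t w = 0\<close> at countably many \<open>t\<close>, and
  right-continuity gives the rest.\<close>

lemma predictable_difference_zero:
  assumes X1: "martingale X1" and X2: "local_martingale M F T X2"
    and D: "predictable D" and cad: "cadlag_process M T D"
    and eq: "\<And>w t. D t w = X1 t w - X2 t w"
    and fv: "AE w in M. bounded_list_var T (\<lambda>t. D t w)"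
    and D0: "AE w in M. D 0 w = 0"
  shows "AE w in M. \<forall>t\<in>{0..T}. D t w = 0"
proof -
  have T: "T \<in> {0..T}" using T_pos by simp
  define good where "good w \<longleftrightarrow> D 0 w = 0 \<and>
    bounded_list_var T (\<lambda>t. D t w)" for w
  have good: "AE w in M. good w" using fv D0 unfolding good_def by eventually_elim simp
  \<comment> \<open>Exceptional paths are replaced by 0. Completeness puts this event into
    \<open>F 0\<close>, so the modified process stays predictable.\<close>
  define G where "G = space M - {w\<in>space M. \<not> good w}"
  have G: "G \<in> sets (F 0)"
    unfolding G_def using null_sets_F0[OF AE_null_set[OF good]] sets.compl_sets[of _ "F 0"] space_F[of 0] T_pos
    by auto
  have in_G: "w \<in> G \<longleftrightarrow> w \<in> space M \<and> good w" for w by (auto simp: G_def)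
  define D' where "D' t w = D t w * indicator G w" for t w
  have D': "predictable D'" unfolding D'_def by (rule predictable_process_indicator[OF D G])
  have cad': "cadlag_process M T D'" unfolding D'_def by (rule cadlag_mult_const[OF cad])
  have D'0: "D' 0 w = 0" for w by (simp add: D'_def indicator_def in_G good_def)
  have eq': "AE w in M. \<forall>t\<in>{0..T}. D' t w = X1 t w - X2 t w"
    using good AE_space by eventually_elim (simp add: D'_def in_G eq)
  have var: "bounded_list_var T (\<lambda>t. D' t w)" for w
  proof (cases "w \<in> G")
    case True
    then show ?thesis by (simp add: D'_def in_G good_def)
  next
    case False
    have "list_var (\<lambda>t. 0) ts = 0" for ts by (simp add: list_var_sum)
    with False show ?thesis by (auto simp: D'_def)
  qed
  \<comment> \<open>Only values at rational times up to \<open>q\<close> enter, so the event is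
    known at \<open>q\<close>.\<close>
  define E where "E k q = {w\<in>space M. \<exists>ts\<in>rat_lists q. real k < list_var (\<lambda>t. D' t w) ts}" for k :: nat and q
  have E: "E k q \<in> sets (F q)" if q: "q \<in> {0..<T}" for k q
  proof -
    have [measurable]: "(\<lambda>w. list_var (\<lambda>t. D' t w) ts) \<in> borel_measurable (F q)" if "ts \<in> rat_lists q" for ts
      unfolding list_var_sum
    proof (intro borel_measurable_sum borel_measurable_abs borel_measurable_diff)
      have "D' (ts ! i) \<in> borel_measurable (F q)" if "i < length ts" for i
      proof -
        have i: "ts ! i \<in> {0..q}" using nth_mem[OF that] \<open>ts \<in> rat_lists q\<close> by (auto simp: rat_lists_def)
        then have "D' (ts ! i) \<in> borel_measurable (F (ts ! i))"
          using predictable_adapted[OF D'] q by (simp add: adapted_process_def)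
        then show ?thesis using i q by (intro measurable_F_mono[of "ts ! i" q]) auto
      qed
      then show "D' (ts ! Suc i) \<in> borel_measurable (F q)" "D' (ts ! i) \<in> borel_measurable (F q)"
        if "i \<in> {..<length ts - 1}" for i using that by auto
    qed
    have sets: "{w\<in>space (F q). real k < list_var (\<lambda>t. D' t w) ts} \<in> sets (F q)" if "ts \<in> rat_lists q" for ts
      using that by measurable
    have "E k q = (\<Union>ts\<in>rat_lists q. {w\<in>space (F q). real k < list_var (\<lambda>t. D' t w) ts})"
      using space_F[of q] q by (auto simp: E_def)
    also have "\<dots> \<in> sets (F q)"
      using sets by (intro sets.countable_UN' countable_rat_lists) auto
    finally show ?thesis .
  qed
  define \<sigma> where "\<sigma> k w = (INF q\<in>\<rat> \<inter> {0..<T}. if w \<in> E k q then ereal q else \<infinity>)" for k w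
  have \<sigma>: "stopping (\<sigma> k)" for k
    unfolding \<sigma>_def[abs_def] by (rule stop_time_Inf_rat[OF E])
  from X2 obtain \<rho> where \<rho>: "\<And>j. stopping (\<rho> j)"
      "AE w in M. incseq (\<lambda>j. \<rho> j w) \<and> (\<exists>j::nat. ereal T \<le> \<rho> j w)"
      "\<And>j. martingale (stopped_process X2 (\<rho> j))"
    unfolding local_martingale_def by blast
  have zero: "AE w in M. D' (stopped_time (\<lambda>w. min (\<rho> j w) (min (\<sigma> k w) (ereal t))) T w) w = 0"
    if t: "t \<in> {0..T}" for j k t
  proof (rule stopped_difference_zero[OF X1 \<rho>(1) \<rho>(3) stop_time_min[OF \<sigma> stop_time_const[OF t]] D' cad' D'0 eq'])
    fix w ts
    let ?\<kappa> = "\<lambda>w. min (\<rho> j w) (min (\<sigma> k w) (ereal t))"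
    assume w: "w \<in> space M" and ts: "sorted ts" "set ts \<subseteq> \<rat> \<inter> {0..<stopped_time ?\<kappa> T w}"
    have \<kappa>: "stopping ?\<kappa>" by (intro stop_time_min \<rho> \<sigma> stop_time_const t)
    show "list_var (\<lambda>t. D' t w) ts \<le> real k"
    proof (rule ccontr)
      assume *: "\<not> list_var (\<lambda>t. D' t w) ts \<le> real k"
      then have "ts \<noteq> []" by auto
      define q where "q = last ts"
      have q: "q \<in> \<rat>" "0 \<le> q" "q < stopped_time ?\<kappa> T w"
        using last_in_set[OF \<open>ts \<noteq> []\<close>] ts(2) by (auto simp: q_def)
      have "ts = butlast ts @ [q]" using \<open>ts \<noteq> []\<close> by (simp add: q_def)
      then have "x \<le> q" if "x \<in> set ts" for x
        using ts(1) that by (metis Un_iff empty_iff insert_iff list.set order_refl set_append sorted_append)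
      then have "ts \<in> rat_lists q" using ts by (auto simp: rat_lists_def)
      with * w have "w \<in> E k q" unfolding E_def not_le by blast
      moreover have "q < T" using q(3) stopped_time_bounds[OF \<kappa> w T] by auto
      ultimately have "\<sigma> k w \<le> ereal q"
        unfolding \<sigma>_def using q by (intro INF_lower2[of q]) auto
      then have "stopped_time ?\<kappa> T w \<le> q"
        using stopped_time_le_iff[OF \<kappa> w T, of q] by (auto simp: min_le_iff_disj)
      with q(3) show False by simp
    qed
  qed
  \<comment> \<open>\<open>T\<close> is added by hand: it may be irrational, and no later time
    approximates it.\<close>
  let ?Q = "insert T (\<rat> \<inter> {0..T})"
  have "AE w in M. \<forall>t\<in>?Q. \<forall>j k. D' (stopped_time (\<lambda>w. min (\<rho> j w) (min (\<sigma> k w) (ereal t))) T w) w = 0"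
    using zero T by (subst AE_ball_countable) (auto simp: AE_all_countable intro!: countable_Int1 countable_rat)
  then show ?thesis
    using good \<rho>(2) AE_space
  proof eventually_elim
    case (elim w)
    from elim(3) obtain j where j: "ereal T \<le> \<rho> j w" by auto
    from var[of w] obtain K where K: "\<And>ts. sorted ts \<Longrightarrow> set ts \<subseteq> {0..T} \<Longrightarrow> list_var (\<lambda>t. D' t w) ts \<le> K"
      by auto
    obtain k :: nat where k: "K \<le> real k" using real_arch_simple by blast
    have "w \<notin> E k q" if "q < T" for q
    proof
      assume "w \<in> E k q"
      then obtain ts where "ts \<in> rat_lists q" "real k < list_var (\<lambda>t. D' t w) ts" by (auto simp: E_def)
      then show False using K[of ts] k that by (fastforce simp: rat_lists_def)
    qed
    \<comment> \<open>Once \<open>k\<close> exceeds the variation of this path, the level is never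
      passed and \<open>\<sigma> k w\<close> is infinite.\<close>
    then have "\<sigma> k w = (INF q\<in>\<rat> \<inter> {0..<T}. \<infinity>)" unfolding \<sigma>_def by (intro INF_cong) auto
    moreover have "\<rat> \<inter> {0..<T} \<noteq> {}" using T_pos by auto
    ultimately have sig_top: "\<sigma> k w = \<infinity>" by simp
    have zero: "D t w = 0" if t: "t \<in> ?Q" for t
    proof -
      have "t \<le> T" using t by auto
      then have "ereal t \<le> \<rho> j w" using j by (metis ereal_less_eq(3) order_trans)
      then have "stopped_time (\<lambda>w. min (\<rho> j w) (min (\<sigma> k w) (ereal t))) T w = t"
        using \<open>t \<le> T\<close> by (simp add: stopped_time_def sig_top min_absorb2)
      then have "D' t w = 0" using elim(1) t by metis
      then show ?thesis using elim by (simp add: D'_def in_G)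
    qed
    show "\<forall>t\<in>{0..T}. D t w = 0"
    proof
      fix t assume t: "t \<in> {0..T}"
      show "D t w = 0"
      proof (cases "t = T")
        case True
        then show ?thesis using zero by simp
      next
        case False
        then have "t < T" using t by simp
        obtain p where p: "\<And>n. p n \<in> \<rat>" "\<And>n. t < p n" "p \<longlonglongrightarrow> t"
          using rat_seq_above by blast
        have lim: "(\<lambda>n. D (p n) w) \<longlonglongrightarrow> D t w"
          using \<open>t < T\<close> t elim(4) p by (intro tendsto_at_right_compose[OF cadlag_right[OF cad]]) auto
        have "\<forall>\<^sub>F n in sequentially. p n < T" using order_tendstoD(2)[OF p(3) \<open>t < T\<close>] .
        then have "\<forall>\<^sub>F n in sequentially. D (p n) w = 0"
        proof eventually_elim
          case (elim n)
          show ?case using p(1,2)[of n] elim t by (intro zero) auto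
        qed
        then have "(\<lambda>n. D (p n) w) \<longlonglongrightarrow> 0" by (rule tendsto_eventually)
        with lim show ?thesis by (rule LIMSEQ_unique)
      qed
    qed
  qed
qed

lemma finite_variation_diff:
  assumes "finite_variation M T X" "finite_variation M T Y"
  shows "AE w in M. bounded_list_var T (\<lambda>t. X t w - Y t w)"
  using assms unfolding finite_variation_def
proof eventually_elim
  case (elim w)
  have le: "list_var f ts \<le> enn2real (path_variation T f)"
    if "path_variation T f < \<infinity>" "sorted ts" "set ts \<subseteq> {0..T}" for f ts
    using list_var_le_path_variation[OF that(2,3), of f] that(1) list_var_nonneg[of f ts]
    by (metis enn2real_ennreal enn2real_mono infinity_ennreal_def)
  have "list_var (\<lambda>t. X t w - Y t w) ts \<le>
      enn2real (path_variation T (\<lambda>t. X t w)) + enn2real (path_variation T (\<lambda>t. Y t w))"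
    if "sorted ts" "set ts \<subseteq> {0..T}" for ts
    by (rule order_trans[OF list_var_diff add_mono[OF le[OF elim(1) that] le[OF elim(2) that]]])
  then show ?case by blast
qed

text \<open>\<open>B - B'\<close> is the martingale \<open>U - B'\<close> minus the local martingale
  \<open>U - B\<close>, so only the latter has to be localised.\<close>

lemma compensator_unique:
  assumes B: "is_compensator M F T U B" and B': "is_compensator M F T U B'"
    and mart: "martingale (\<lambda>t w. U t w - B' t w)"
  shows "AE w in M. \<forall>t\<in>{0..T}. B t w = B' t w"
proof -
  have "AE w in M. \<forall>t\<in>{0..T}. B t w - B' t w = 0"
  proof (rule predictable_difference_zero[OF mart, of "\<lambda>t w. U t w - B t w"])
    show "predictable (\<lambda>t w. B t w - B' t w)"
      using B B' by (auto simp: is_compensator_def predictable_process_def case_prod_beta')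
    show "cadlag_process M T (\<lambda>t w. B t w - B' t w)"
      using B B' by (auto simp: is_compensator_def intro: cadlag_diff)
    show "AE w in M. bounded_list_var T (\<lambda>t. B t w - B' t w)"
      using B B' by (intro finite_variation_diff) (simp_all add: is_compensator_def)
    have "AE w in M. B 0 w = U 0 w" "AE w in M. B' 0 w = U 0 w"
      using B B' by (auto simp: is_compensator_def)
    then show "AE w in M. B 0 w - B' 0 w = 0" by eventually_elim simp
  qed (use B in \<open>auto simp: is_compensator_def\<close>)
  then show ?thesis by eventually_elim simp
qed

end

subsection \<open>Compensating a series of single jumps\<close>

context
  fixes c :: "nat \<Rightarrow> real" and \<tau> :: "nat \<Rightarrow> ereal"
  assumes summable_c: "summable (\<lambda>k. \<bar>c k\<bar>)"
begin

lemma summable_jump_series: "summable (\<lambda>k. \<bar>c k * of_bool (b k)\<bar>)"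
  using summable_c by (rule summable_comparison_test'[of _ 0]) (auto simp: abs_mult)

text \<open>Tannery's theorem with the summable bound \<open>\<bar>c k\<bar>\<close>: near the limit
  point each single term is eventually constant.\<close>

lemma jump_series_tendsto:
  assumes "\<And>k. \<forall>\<^sub>F s in G. (\<tau> k \<le> ereal s) = b k" "G \<noteq> bot"
  shows "((\<lambda>s. \<Sum>k. c k * of_bool (\<tau> k \<le> ereal s)) \<longlongrightarrow> (\<Sum>k. c k * of_bool (b k))) G"
proof -
  have "((\<lambda>s. c k * of_bool (\<tau> k \<le> ereal s)) \<longlongrightarrow> c k * of_bool (b k)) G" for k
    by (rule tendsto_eventually) (use assms(1)[of k] in \<open>eventually_elim, simp\<close>)
  moreover have "\<forall>\<^sub>F (k, s) in at_top \<times>\<^sub>F G. norm (c k * of_bool (\<tau> k \<le> ereal s)) \<le> \<bar>c k\<bar>"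
    by (rule always_eventually) (auto simp: abs_mult)
  ultimately show ?thesis
    using tannerys_theorem[OF _ _ summable_c assms(2), of "\<lambda>k s. c k * of_bool (\<tau> k \<le> ereal s)"
        "\<lambda>k. c k * of_bool (b k)"] by blast
qed

lemma jump_series_right:
  "((\<lambda>s. \<Sum>k. c k * of_bool (\<tau> k \<le> ereal s)) \<longlongrightarrow> (\<Sum>k. c k * of_bool (\<tau> k \<le> ereal t))) (at_right t)"
proof (rule jump_series_tendsto)
  fix k
  show "\<forall>\<^sub>F s in at_right t. (\<tau> k \<le> ereal s) = (\<tau> k \<le> ereal t)"
  proof (cases "\<tau> k \<le> ereal t")
    case True
    then have "\<tau> k \<le> ereal s" if "t < s" for s using that by (metis ereal_less_eq(3) less_imp_le order_trans)
    with True show ?thesis by (auto simp: eventually_at_filter)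
  next
    case False
    then obtain z where z: "ereal t < ereal z" "ereal z < \<tau> k" using ereal_dense2[of "ereal t" "\<tau> k"] by (auto simp: not_le)
    then have "\<not> \<tau> k \<le> ereal s" if "s < z" for s
      using that by (metis ereal_less_eq(3) leD less_imp_le order_trans)
    with False z show ?thesis by (auto simp: eventually_at_right[of t z])
  qed
qed simp

lemma jump_series_left:
  "((\<lambda>s. \<Sum>k. c k * of_bool (\<tau> k \<le> ereal s)) \<longlongrightarrow> (\<Sum>k. c k * of_bool (\<tau> k < ereal t))) (at_left t)"
proof (rule jump_series_tendsto)
  fix k
  show "\<forall>\<^sub>F s in at_left t. (\<tau> k \<le> ereal s) = (\<tau> k < ereal t)"
  proof (cases "\<tau> k < ereal t")
    case True
    then obtain z where z: "\<tau> k < ereal z" "ereal z < ereal t" using ereal_dense2 by blast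
    then have "\<tau> k \<le> ereal s" if "z < s" for s
      using that by (metis ereal_less_eq(3) less_imp_le order_trans)
    with True z show ?thesis by (auto simp: eventually_at_left[of z t])
  next
    case False
    then have "\<not> \<tau> k \<le> ereal s" if "s < t" for s
      using that by (metis ereal_less(2) less_ereal.simps(1) not_less order_le_less_trans)
    with False show ?thesis by (auto simp: eventually_at_filter)
  qed
qed simp

text \<open>The increasing series with the terms \<open>\<bar>c k\<bar>\<close> dominates every
  increment of the signed one.\<close>

lemma list_var_jump_series:
  assumes "sorted ts"
  shows "list_var (\<lambda>s. \<Sum>k. c k * of_bool (\<tau> k \<le> ereal s)) ts \<le> (\<Sum>k. \<bar>c k\<bar>)"
proof (cases ts)
  case Nil
  then show ?thesis using summable_c by (simp add: suminf_nonneg)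
next
  case (Cons a us)
  define w where "w s = (\<Sum>k. \<bar>c k\<bar> * of_bool (\<tau> k \<le> ereal s))" for s
  have w: "summable (\<lambda>k. \<bar>c k\<bar> * of_bool (\<tau> k \<le> ereal s))" for s
    using summable_jump_series[of "\<lambda>k. \<tau> k \<le> ereal s"] by (simp add: abs_mult)
  have s: "summable (\<lambda>k. c k * of_bool (\<tau> k \<le> ereal s))" for s
    by (rule summable_rabs_cancel[OF summable_jump_series])
  have "\<bar>(\<Sum>k. c k * of_bool (\<tau> k \<le> ereal r)) - (\<Sum>k. c k * of_bool (\<tau> k \<le> ereal q))\<bar> \<le> w r - w q"
    if "q \<le> r" for q r
  proof -
    have le: "\<tau> k \<le> ereal r" if "\<tau> k \<le> ereal q" for k
      using that \<open>q \<le> r\<close> by (metis ereal_less_eq(3) order_trans)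
    have eq: "\<bar>c k * of_bool (\<tau> k \<le> ereal r) - c k * of_bool (\<tau> k \<le> ereal q)\<bar> =
        \<bar>c k\<bar> * of_bool (\<tau> k \<le> ereal r) - \<bar>c k\<bar> * of_bool (\<tau> k \<le> ereal q)" for k
      using le[of k] by auto
    have "\<bar>\<Sum>k. c k * of_bool (\<tau> k \<le> ereal r) - c k * of_bool (\<tau> k \<le> ereal q)\<bar> \<le>
        (\<Sum>k. \<bar>c k * of_bool (\<tau> k \<le> ereal r) - c k * of_bool (\<tau> k \<le> ereal q)\<bar>)"
      by (rule summable_rabs) (simp only: eq summable_diff[OF w w])
    also have "\<dots> = w r - w q"
      unfolding eq w_def by (rule suminf_diff[OF w w, symmetric])
    finally show ?thesis by (simp only: suminf_diff[OF s s])
  qed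
  then have "list_var (\<lambda>s. \<Sum>k. c k * of_bool (\<tau> k \<le> ereal s)) (a # us) \<le> w (last (a # us)) - w a"
    using assms Cons by (intro list_var_le_increment[where S = UNIV]) auto
  also have "\<dots> \<le> w (last (a # us))" using w by (simp add: w_def suminf_nonneg)
  also have "\<dots> \<le> (\<Sum>k. \<bar>c k\<bar>)" unfolding w_def by (intro suminf_le w summable_c) auto
  finally show ?thesis using Cons by simp
qed

end

text \<open>Tonelli: the series of moduli has a finite integral, hence is finite almost
  everywhere.\<close>

lemma AE_summable_of_summable_integral:
  fixes f :: "nat \<Rightarrow> 'a \<Rightarrow> real"
  assumes f: "\<And>k. integrable M (f k)" and sum: "summable (\<lambda>k. \<integral>x. \<bar>f k x\<bar> \<partial>M)"
  shows "AE x in M. summable (\<lambda>k. \<bar>f k x\<bar>)"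
proof -
  have [measurable]: "f k \<in> borel_measurable M" for k using f by blast
  have nn: "(\<integral>\<^sup>+x. ennreal \<bar>f k x\<bar> \<partial>M) = ennreal (LINT x|M. \<bar>f k x\<bar>)" for k
    by (rule nn_integral_eq_integral[OF integrable_abs[OF f]]) simp
  have "(\<integral>\<^sup>+x. (\<Sum>k. ennreal \<bar>f k x\<bar>) \<partial>M) = (\<Sum>k. \<integral>\<^sup>+x. ennreal \<bar>f k x\<bar> \<partial>M)"
    by (rule nn_integral_suminf) simp
  also have "\<dots> = (\<Sum>k. ennreal (LINT x|M. \<bar>f k x\<bar>))"
    by (simp only: nn)
  finally have "(\<integral>\<^sup>+x. (\<Sum>k. ennreal \<bar>f k x\<bar>) \<partial>M) = (\<Sum>k. ennreal (LINT x|M. \<bar>f k x\<bar>))" .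
  moreover have "(\<Sum>k. ennreal (LINT x|M. \<bar>f k x\<bar>)) \<noteq> top"
    by (rule ennreal_suminf_neq_top[OF sum]) (rule Bochner_Integration.integral_nonneg, simp)
  ultimately have "(\<integral>\<^sup>+x. (\<Sum>k. ennreal \<bar>f k x\<bar>) \<partial>M) \<noteq> \<infinity>"
    by (simp only: infinity_ennreal_def not_False_eq_True)
  then have "AE x in M. (\<Sum>k. ennreal \<bar>f k x\<bar>) \<noteq> \<infinity>"
    by (rule nn_integral_PInf_AE[rotated]) measurable
  then show ?thesis
  proof eventually_elim
    case (elim x)
    then show ?case by (intro summable_suminf_not_top) auto
  qed
qed

section \<open>Conditional expectations before the jump times, and the compensating series\<close>

context standard_filtration
begin

lemma integral_abs_real_cond_exp:
  assumes "stopping \<tau>" and Z: "integrable M Z"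
  shows "integrable M (real_cond_exp M (before \<tau>) Z)"
    and "(LINT w|M. \<bar>real_cond_exp M (before \<tau>) Z w\<bar>) \<le> (LINT w|M. \<bar>Z w\<bar>)"
proof -
  interpret C: finite_measure_subalgebra M "before \<tau>"
    by (rule finite_measure_subalgebra_sigma_before[OF assms(1)])
  let ?c = "real_cond_exp M (before \<tau>) Z"
  show int: "integrable M ?c" by (rule C.real_cond_exp_int(1)[OF Z])
  have Zm: "Z \<in> borel_measurable M" using Z by blast
  have "ennreal (LINT w|M. \<bar>?c w\<bar>) = (\<integral>\<^sup>+w. ennreal \<bar>?c w\<bar> \<partial>M)"
    using int by (intro nn_integral_eq_integral[symmetric]) auto
  also have "\<dots> \<le> (\<integral>\<^sup>+w. nn_cond_exp M (before \<tau>) (\<lambda>w. ennreal \<bar>Z w\<bar>) w \<partial>M)"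
    using C.real_cond_exp_abs[OF Zm] by (rule nn_integral_mono_AE)
  also have "\<dots> = (\<integral>\<^sup>+w. ennreal \<bar>Z w\<bar> \<partial>M)"
    using C.nn_cond_exp_intg[of "\<lambda>_. 1" "\<lambda>w. ennreal \<bar>Z w\<bar>"] Zm by simp
  also have "\<dots> = ennreal (LINT w|M. \<bar>Z w\<bar>)"
    using Z by (intro nn_integral_eq_integral) auto
  finally show "(LINT w|M. \<bar>?c w\<bar>) \<le> (LINT w|M. \<bar>Z w\<bar>)"
    by (simp add: ennreal_le_iff)
qed

lemma integral_real_cond_exp_before:
  assumes \<tau>: "stopping \<tau>" and Z: "integrable M Z"
    and st: "0 \<le> s" "s \<le> t" "t \<le> T" and A: "A \<in> sets (F s)"
  shows "(LINT w|M. indicator A w * (real_cond_exp M (before \<tau>) Z w * of_bool (ereal s < \<tau> w \<and> \<tau> w \<le> ereal t))) =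
    (LINT w|M. indicator A w * (Z w * of_bool (ereal s < \<tau> w \<and> \<tau> w \<le> ereal t)))"
proof -
  interpret C: finite_measure_subalgebra M "before \<tau>"
    by (rule finite_measure_subalgebra_sigma_before[OF \<tau>])
  define H where "H = {w\<in>A. ereal s < \<tau> w} - {w\<in>space (F t). ereal t < \<tau> w}"
  have "H \<in> sets (before \<tau>)"
    unfolding H_def using st A by (intro sets.Diff before_sigma_before \<tau>) auto
  from C.real_cond_exp_intA[OF Z this]
  have "(LINT w|M. indicator H w * real_cond_exp M (before \<tau>) Z w) = (int_on H Z)"
    by (simp add: set_lebesgue_integral_def)
  moreover have "(LINT w|M. indicator A w * (f w * of_bool (ereal s < \<tau> w \<and> \<tau> w \<le> ereal t))) =
      (LINT w|M. indicator H w * f w)" for f :: "'a \<Rightarrow> real"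
    using space_F[of t] st
    by (intro Bochner_Integration.integral_cong refl) (auto simp: H_def indicator_def)
  ultimately show ?thesis by simp
qed

text \<open>Summability of the expected moduli survives conditioning, so sums, integrals and the
  compensation of single jumps may be interchanged. The condition on time 0 says that a jump
  occurring there is already known; conditioning leaves it unchanged, which gives
  \<open>B 0 w = U 0 w\<close>.\<close>

lemma compensator_series:
  fixes Z :: "nat \<Rightarrow> 'a \<Rightarrow> real" and \<tau> :: "nat \<Rightarrow> 'a \<Rightarrow> ereal"
  defines "c \<equiv> \<lambda>k. real_cond_exp M (before (\<tau> k)) (Z k)"
  assumes \<tau>: "\<And>k. predictable_time M F T (\<tau> k)" and Z: "\<And>k. integrable M (Z k)"
    and sum_Z: "summable (\<lambda>k. \<integral>w. \<bar>Z k w\<bar> \<partial>M)"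
    and Z0: "\<And>k. (\<lambda>w. after (\<tau> k) 0 w * Z k w) \<in> borel_measurable (F 0)"
    and ad: "adapted_process F T U" and cad: "cadlag_process M T U"
    and U: "AE w in M. \<forall>t\<in>{0..T}. (\<lambda>k. Z k w * after (\<tau> k) t w) sums U t w"
  obtains B where "is_compensator M F T U B" "martingale (\<lambda>t w. U t w - B t w)"
    "AE w in M. summable (\<lambda>k. \<bar>c k w\<bar>)"
    "AE w in M. \<forall>t\<in>{0..T}. B t w = (\<Sum>k. c k w * after (\<tau> k) t w)"
proof -
  have st: "stopping (\<tau> k)" for k using \<tau>[of k] by (simp add: predictable_time_def)
  have zero: "0 \<in> {0..T}" using T_pos by simp
  have \<tau>m [measurable]: "\<tau> k \<in> borel_measurable M" for k using st[of k] by (simp add: stop_time_def random_time_def)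
  have ci: "integrable M (c k)" for k unfolding c_def by (rule integral_abs_real_cond_exp(1)[OF st Z])
  have c_le: "(LINT w|M. \<bar>c k w\<bar>) \<le> (LINT w|M. \<bar>Z k w\<bar>)" for k
    unfolding c_def by (rule integral_abs_real_cond_exp(2)[OF st Z])
  have sum_c: "summable (\<lambda>k. \<integral>w. \<bar>c k w\<bar> \<partial>M)"
    using sum_Z by (rule summable_comparison_test'[of _ 0]) (simp add: c_le)
  have ae_c: "AE w in M. summable (\<lambda>k. \<bar>c k w\<bar>)" by (rule AE_summable_of_summable_integral[OF ci sum_c])
  have ae_Z: "AE w in M. summable (\<lambda>k. \<bar>Z k w\<bar>)" by (rule AE_summable_of_summable_integral[OF Z sum_Z])
  \<comment> \<open>Null sets belong to \<open>F 0\<close>, hence to every sigma-algebra before a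
    stopping time. Coefficients cut off outside \<open>G\<close> keep their measurability, and then
    every path of the series is cadlag, not just almost every one.\<close>
  define G where "G = space M - {w\<in>space M. \<not> summable (\<lambda>k. \<bar>c k w\<bar>)}"
  have G: "G \<in> sets (F 0)"
    unfolding G_def using null_sets_F0[OF AE_null_set[OF ae_c]] sets.compl_sets[of _ "F 0"] space_F[OF zero]
    by auto
  have GM [measurable]: "G \<in> sets M" by (rule sets_F[OF zero G])
  have ae_G: "AE w in M. w \<in> G" using ae_c AE_space by eventually_elim (simp add: G_def)
  define c' where "c' k w = c k w * indicator G w" for k w
  have c'_sum: "summable (\<lambda>k. \<bar>c' k w\<bar>)" for w
    by (cases "w \<in> G") (auto simp: c'_def G_def)
  have c'i: "integrable M (c' k)" for k
    using integrable_mult_indicator[OF GM ci[of k]] by (simp add: c'_def[abs_def] mult.commute)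
  have c'_eq: "AE w in M. c' k w = c k w" for k using ae_G by eventually_elim (simp add: c'_def)
  have c'_meas: "c' k \<in> borel_measurable (before (\<tau> k))" for k
    unfolding c'_def c_def
    by (intro borel_measurable_times borel_measurable_cond_exp borel_measurable_indicator F0_sigma_before st G)
  define B where "B t w = (\<Sum>k. c' k w * after (\<tau> k) t w)" for t w
  have B_pred: "predictable B"
  proof -
    have "(\<lambda>p. \<Sum>k. (case p of (t, w) \<Rightarrow> c' k w * after (\<tau> k) t w)) \<in> borel_measurable Pred"
      using predictable_after[OF \<tau> c'_meas] unfolding predictable_process_def
      by (intro borel_measurable_suminf)
    then show ?thesis unfolding predictable_process_def B_def by (simp add: case_prod_beta')
  qed
  have B_cad: "cadlag_process M T B"
    unfolding cadlag_process_def B_def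
    by (intro ballI conjI exI; rule jump_series_right[OF c'_sum] jump_series_left[OF c'_sum])
  have B_fv: "finite_variation M T B"
    unfolding finite_variation_def
  proof (rule AE_I2)
    fix w
    have "path_variation T (\<lambda>t. B t w) \<le> ennreal (\<Sum>k. \<bar>c' k w\<bar>)"
      unfolding B_def by (intro path_variation_le list_var_jump_series c'_sum)
    then show "path_variation T (\<lambda>t. B t w) < \<infinity>" by (simp add: le_less_trans ennreal_less_top)
  qed
  have B_eq: "AE w in M. \<forall>t\<in>{0..T}. B t w = (\<Sum>k. c k w * after (\<tau> k) t w)"
    using ae_G by eventually_elim (simp add: B_def c'_def)
  \<comment> \<open>On \<open>\<tau> k = 0\<close> the term is measurable before
    \<open>\<tau> k\<close>, so it is its own conditional expectation; the indicator of this event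
    can be pulled out.\<close>
  have c0: "AE w in M. after (\<tau> k) 0 w * Z k w = after (\<tau> k) 0 w * c k w" for k
  proof -
    interpret C: finite_measure_subalgebra M "before (\<tau> k)"
      by (rule finite_measure_subalgebra_sigma_before[OF st])
    define b where "b w = (after (\<tau> k) 0 w :: real)" for w
    have "\<forall>t\<in>{0..T}. {w\<in>space M. \<tau> k w \<le> ereal t} \<in> sets (F t)"
      using st[of k] unfolding stop_time_def by (rule conjunct2)
    from F0_sigma_before[OF st[of k] bspec[OF this zero]]
    have "{w\<in>space (before (\<tau> k)). \<tau> k w \<le> ereal 0} \<in> sets (before (\<tau> k))"
      unfolding space_sigma_before[OF st[of k]] .
    then have b: "b \<in> borel_measurable (before (\<tau> k))"
      unfolding b_def of_bool_def by (intro measurable_If) auto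
    have bZ: "(\<lambda>w. b w * Z k w) \<in> borel_measurable (before (\<tau> k))"
    proof -
      have "subalgebra (before (\<tau> k)) (F 0)"
        using F0_sigma_before[OF st] by (auto simp: subalgebra_def space_sigma_before[OF st] space_F[OF zero])
      then show ?thesis using Z0[of k] unfolding b_def by (rule measurable_from_subalg)
    qed
    have bZi: "integrable M (\<lambda>w. b w * Z k w)"
    proof (rule Bochner_Integration.integrable_bound[OF Z[of k]])
      show "(\<lambda>w. b w * Z k w) \<in> borel_measurable M" by (rule measurable_from_subalg[OF C.subalg bZ])
    qed (simp add: b_def abs_mult)
    have "AE w in M. real_cond_exp M (before (\<tau> k)) (\<lambda>w. b w * Z k w) w = b w * c k w"
      unfolding c_def using Z[of k] by (intro C.real_cond_exp_mult b bZi) auto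
    moreover have "AE w in M. real_cond_exp M (before (\<tau> k)) (\<lambda>w. b w * Z k w) w = b w * Z k w"
      by (rule C.real_cond_exp_F_meas[OF bZi bZ])
    ultimately show ?thesis unfolding b_def by eventually_elim simp
  qed
  have B0: "AE w in M. B 0 w = U 0 w"
  proof -
    have "AE w in M. \<forall>k. after (\<tau> k) 0 w * Z k w = after (\<tau> k) 0 w * c k w"
      using c0 by (simp add: AE_all_countable)
    then show ?thesis using B_eq U
    proof eventually_elim
      case (elim w)
      have "B 0 w = (\<Sum>k. c k w * after (\<tau> k) 0 w)" using elim(2) zero by blast
      also have "\<dots> = (\<Sum>k. Z k w * after (\<tau> k) 0 w)"
        using elim(1) by (intro suminf_cong) (simp only: mult.commute)
      also have "\<dots> = U 0 w" using elim(3) zero by (intro sums_unique[symmetric]) blast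
      finally show ?case .
    qed
  qed
  define d where "d k w = Z k w - c' k w" for k w
  have di: "integrable M (d k)" for k unfolding d_def by (intro Bochner_Integration.integrable_diff Z c'i)
  have c'_le: "(LINT w|M. \<bar>c' k w\<bar>) \<le> (LINT w|M. \<bar>Z k w\<bar>)" for k
  proof -
    have "(LINT w|M. \<bar>c' k w\<bar>) = (LINT w|M. \<bar>c k w\<bar>)"
      using c'_eq[of k] c'i[of k] ci[of k] by (intro integral_cong_AE) auto
    with c_le[of k] show ?thesis by simp
  qed
  have d_le: "(LINT w|M. \<bar>d k w\<bar>) \<le> 2 * (LINT w|M. \<bar>Z k w\<bar>)" for k
  proof -
    have "(LINT w|M. \<bar>d k w\<bar>) \<le> (LINT w|M. \<bar>Z k w\<bar> + \<bar>c' k w\<bar>)"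
      using di Z c'i by (intro integral_mono) (auto simp: d_def)
    also have "\<dots> = (LINT w|M. \<bar>Z k w\<bar>) + (LINT w|M. \<bar>c' k w\<bar>)"
      using Z c'i by (intro Bochner_Integration.integral_add) auto
    finally show ?thesis using c'_le[of k] by simp
  qed
  have ae_d: "AE w in M. summable (\<lambda>k. \<bar>d k w\<bar>)"
    using ae_Z
  proof eventually_elim
    case (elim w)
    show ?case
      by (rule summable_comparison_test'[OF summable_add[OF elim c'_sum[of w]], of 0]) (simp add: d_def)
  qed
  have X_eq: "AE w in M. \<forall>t\<in>{0..T}. U t w - B t w = (\<Sum>k. d k w * after (\<tau> k) t w)"
    using U
  proof eventually_elim
    case (elim w)
    show ?case
    proof
      fix t assume "t \<in> {0..T}"
      then have "(\<lambda>k. Z k w * after (\<tau> k) t w) sums U t w" using elim by blast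
      moreover have "(\<lambda>k. c' k w * after (\<tau> k) t w) sums B t w"
        unfolding B_def by (intro summable_sums summable_rabs_cancel[OF summable_jump_series[OF c'_sum]])
      ultimately have "(\<lambda>k. Z k w * after (\<tau> k) t w - c' k w * after (\<tau> k) t w)
          sums (U t w - B t w)" by (rule sums_diff)
      then show "U t w - B t w = (\<Sum>k. d k w * after (\<tau> k) t w)"
        by (simp add: d_def left_diff_distrib sums_unique)
    qed
  qed
  have series_int: "integrable M (\<lambda>w. h w * (U t w - B t w))"
    "(LINT w|M. h w * (U t w - B t w)) = (\<Sum>k. \<integral>w. h w * (d k w * after (\<tau> k) t w) \<partial>M)"
    if t: "t \<in> {0..T}" and h [measurable]: "h \<in> borel_measurable M" and h1: "\<And>w. \<bar>h w\<bar> \<le> 1" for h t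
  proof -
    have Um: "U t \<in> borel_measurable M" "B t \<in> borel_measurable M"
      using ad predictable_adapted[OF B_pred] t by (auto simp: adapted_process_def intro: measurable_F_M)
    let ?f = "\<lambda>k w. h w * (d k w * after (\<tau> k) t w)"
    have dm [measurable]: "d k \<in> borel_measurable M" for k using di[of k] by blast
    have f_le: "\<bar>?f k w\<bar> \<le> \<bar>d k w\<bar>" for k w
      using h1[of w] by (auto simp: abs_mult intro!: mult_left_le_one_le)
    have fm: "?f k \<in> borel_measurable M" for k by measurable
    have fi: "integrable M (?f k)" for k
      by (rule Bochner_Integration.integrable_bound[OF di[of k] fm]) (use f_le in auto)
    have f_sum: "AE w in M. summable (\<lambda>k. norm (?f k w))"
      using ae_d
    proof eventually_elim
      case (elim w)
      then show ?case by (rule summable_comparison_test'[of _ 0]) (use f_le in auto)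
    qed
    have f_isum: "summable (\<lambda>k. \<integral>w. norm (?f k w) \<partial>M)"
    proof (rule summable_comparison_test'[OF summable_mult[OF sum_Z, of 2], of 0])
      fix k
      have "(LINT w|M. norm (?f k w)) \<le> (LINT w|M. \<bar>d k w\<bar>)"
        using fi[of k] di[of k] f_le by (intro integral_mono) auto
      with d_le[of k] show "norm (LINT w|M. norm (?f k w)) \<le> 2 * (LINT w|M. \<bar>Z k w\<bar>)" by simp
    qed
    have eq: "AE w in M. h w * (U t w - B t w) = (\<Sum>k. ?f k w)"
      using X_eq ae_d
    proof eventually_elim
      case (elim w)
      then show ?case
        using t suminf_mult[OF summable_rabs_cancel[OF summable_jump_series[OF elim(2)]], of "h w"] by simp
    qed
    have m: "(\<lambda>w. h w * (U t w - B t w)) \<in> borel_measurable M" "(\<lambda>w. \<Sum>k. ?f k w) \<in> borel_measurable M"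
      using Um by measurable
    show "integrable M (\<lambda>w. h w * (U t w - B t w))"
      using integrable_suminf[OF fi f_sum f_isum] integrable_cong_AE[OF m eq] by simp
    show "(LINT w|M. h w * (U t w - B t w)) = (\<Sum>k. \<integral>w. ?f k w \<partial>M)"
      using integral_cong_AE[OF m eq] integral_suminf[OF fi f_sum f_isum] by simp
  qed
  have mart: "martingale (\<lambda>t w. U t w - B t w)"
  proof (rule cadlag_martingaleI)
    show "adapted_process F T (\<lambda>t w. U t w - B t w)"
      using ad predictable_adapted[OF B_pred] unfolding adapted_process_def
      by (intro ballI borel_measurable_diff) blast+
    show "cadlag_process M T (\<lambda>t w. U t w - B t w)" by (rule cadlag_diff[OF cad B_cad])
    show "integrable M (\<lambda>w. U t w - B t w)" if "t \<in> {0..T}" for t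
      using series_int(1)[OF that, of "\<lambda>_. 1"] by simp
    fix s t A assume stT: "0 \<le> s" "s \<le> t" "t \<le> T" and A: "A \<in> sets (F s)"
    then have AM [measurable]: "A \<in> sets M" using sets_F[of s] by auto
    have ind: "\<bar>indicator A w :: real\<bar> \<le> 1" for w by (simp add: indicator_def)
    \<comment> \<open>Each compensated single jump is a martingale by itself;
      \<open>series_int\<close> then sums the identities.\<close>
    have "(LINT w|M. indicator A w * (d k w * after (\<tau> k) t w)) =
        (LINT w|M. indicator A w * (d k w * after (\<tau> k) s w))" for k
    proof -
      have i: "integrable M (\<lambda>w. indicator A w * (f w * of_bool (b w)))"
        if "integrable M f" "Measurable.pred M b" for f :: "'a \<Rightarrow> real" and b
      proof (rule Bochner_Integration.integrable_bound[OF that(1)])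
        show "(\<lambda>w. indicator A w * (f w * of_bool (b w))) \<in> borel_measurable M"
          using borel_measurable_integrable[OF that(1)] that(2) by measurable
      qed (auto simp: indicator_def)
      let ?b = "\<lambda>w. ereal s < \<tau> k w \<and> \<tau> k w \<le> ereal t"
      have "(LINT w|M. indicator A w * (d k w * after (\<tau> k) t w)) -
          (LINT w|M. indicator A w * (d k w * after (\<tau> k) s w)) =
          (LINT w|M. indicator A w * (d k w * after (\<tau> k) t w) -
            indicator A w * (d k w * after (\<tau> k) s w))"
        by (intro Bochner_Integration.integral_diff[symmetric] i di) measurable
      also have "\<dots> = (LINT w|M. indicator A w * (Z k w * of_bool (?b w)) - indicator A w * (c' k w * of_bool (?b w)))"
      proof (intro Bochner_Integration.integral_cong refl)
        fix w
        have "\<tau> k w \<le> ereal t" if "\<tau> k w \<le> ereal s"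
          using that stT(2) by (metis ereal_less_eq(3) order_trans)
        then show "indicator A w * (d k w * after (\<tau> k) t w) - indicator A w * (d k w * after (\<tau> k) s w)
            = indicator A w * (Z k w * of_bool (?b w)) - indicator A w * (c' k w * of_bool (?b w))"
          by (auto simp: d_def indicator_def)
      qed
      also have "\<dots> = (LINT w|M. indicator A w * (Z k w * of_bool (?b w))) - (LINT w|M. indicator A w * (c' k w * of_bool (?b w)))"
        by (intro Bochner_Integration.integral_diff i Z c'i) measurable
      also have "(LINT w|M. indicator A w * (c' k w * of_bool (?b w))) = (LINT w|M. indicator A w * (c k w * of_bool (?b w)))"
      proof (rule integral_cong_AE)
        show "AE w in M. indicator A w * (c' k w * of_bool (?b w)) = indicator A w * (c k w * of_bool (?b w))"
          using c'_eq[of k] by eventually_elim simp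
      qed (intro borel_measurable_integrable i ci c'i; measurable)+
      also have "\<dots> = (LINT w|M. indicator A w * (Z k w * of_bool (?b w)))"
        unfolding c_def by (rule integral_real_cond_exp_before[OF st Z stT A])
      finally show ?thesis by simp
    qed
    then show "(LINT w|M. indicator A w * (U t w - B t w)) = (LINT w|M. indicator A w * (U s w - B s w))"
      using stT ind by (subst (1 2) series_int(2)) auto
  qed
  \<comment> \<open>The compensated process is a true martingale, so it is localised by the times
    that are identically infinite.\<close>
  have "local_martingale M F T (\<lambda>t w. U t w - B t w)"
    unfolding local_martingale_def
  proof (intro conjI exI[of _ "\<lambda>(k::nat) w. \<infinity>"] allI)
    show "stopping (\<lambda>w. \<infinity>)" by (simp add: stop_time_def random_time_def)
    have "stopped_process X (\<lambda>w. \<infinity>) = X" for X :: "real \<Rightarrow> 'a \<Rightarrow> real"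
      by (simp add: stopped_process_def fun_eq_iff)
    with mart show "martingale (stopped_process (\<lambda>t w. U t w - B t w) (\<lambda>w. \<infinity>))" by simp
  qed (use mart in \<open>auto simp: cadlag_martingale_def incseq_def\<close>)
  with B_pred B_cad B_fv B0 have "is_compensator M F T U B" by (simp add: is_compensator_def)
  then show thesis using mart ae_c B_eq by (rule that)
qed

end

subsection \<open>Jumps along the enveloping sequences\<close>

text \<open>Absolute summability along one enumeration of the pairs makes the family unconditionally
  summable, which allows summing first over \<open>m\<close> and then over \<open>n\<close>.\<close>

lemma sums_prod_decode:
  fixes f :: "nat \<times> nat \<Rightarrow> real"
  assumes f: "summable (\<lambda>k. \<bar>f (prod_decode k)\<bar>)"
  shows "summable (\<lambda>m. f (n, m))" "(\<lambda>n. \<Sum>m. f (n, m)) sums (\<Sum>k. f (prod_decode k))"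
proof -
  have "((\<lambda>k. f (prod_decode k)) has_sum (\<Sum>k. f (prod_decode k))) UNIV"
    using f summable_sums[OF summable_rabs_cancel[OF f]] by (intro norm_summable_imp_has_sum) simp_all
  then have sum: "(f has_sum (\<Sum>k. f (prod_decode k))) (UNIV \<times> UNIV)"
    using has_sum_reindex_bij_betw[OF bij_prod_decode, of f] by simp
  have s: "(\<lambda>m. f (n, m)) summable_on UNIV" for n
    by (rule summable_on_SigmaD1[where A = UNIV and B = "\<lambda>_. UNIV"]) (use has_sum_imp_summable[OF sum] in simp_all)
  have inner: "((\<lambda>m. f (n, m)) has_sum (\<Sum>m. f (n, m))) UNIV" for n
    using has_sum_infsum[OF s[of n]] sums_unique[OF has_sum_imp_sums[OF has_sum_infsum[OF s[of n]]]] by simp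
  show "summable (\<lambda>m. f (n, m))" by (rule sums_summable[OF has_sum_imp_sums[OF inner]])
  show "(\<lambda>n. \<Sum>m. f (n, m)) sums (\<Sum>k. f (prod_decode k))"
    by (rule has_sum_imp_sums[OF has_sum_SigmaD[OF sum inner]])
qed

text \<open>Each jump time \<open>s\<close> is paired with a point \<open>p\<close> just before it,
  at which the path is close to its left limit. Keeping \<open>p\<close> to the right of the
  preceding jump time makes the pairs line up as one partition.\<close>

lemma sum_list_jump_le:
  assumes cad: "cadlag_process M T X" and w: "w \<in> space M"
    and "0 \<le> a" "sorted_wrt (<) ss" "set ss \<subseteq> {a<..T}" "0 < e"
  shows "\<exists>ts. sorted ts \<and> set ts \<subseteq> {a<..T} \<and>
    (\<Sum>s\<leftarrow>ss. \<bar>jump X s w\<bar>) \<le> list_var (\<lambda>t. X t w) ts + e"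
  using assms(3-)
proof (induction ss arbitrary: a e)
  case Nil
  then show ?case by (intro exI[of _ "[]"]) simp
next
  case (Cons s ss)
  have s: "a < s" "s \<le> T" "0 < s" using Cons.prems by auto
  have "set ss \<subseteq> {s<..T}" using Cons.prems by fastforce
  \<comment> \<open>Half of the error is left to the remaining jumps, the other half pays for the
    choice of \<open>p\<close>.\<close>
  then obtain ts where ts: "sorted ts" "set ts \<subseteq> {s<..T}"
      "(\<Sum>s\<leftarrow>ss. \<bar>jump X s w\<bar>) \<le> list_var (\<lambda>t. X t w) ts + e / 2"
    using Cons.IH[of s "e / 2"] Cons.prems s by auto
  have "\<forall>\<^sub>F p in at_left s. dist (X p w) (left_limit X s w) < e / 2"
    using cadlag_left[OF cad w s(3,2)] Cons.prems(4) by (intro tendstoD) auto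
  moreover have "\<forall>\<^sub>F p in at_left s. p \<in> {a<..<s}"
    by (rule eventually_at_left_real[OF s(1)])
  ultimately have "\<forall>\<^sub>F p in at_left s. dist (X p w) (left_limit X s w) < e / 2 \<and> p \<in> {a<..<s}"
    by eventually_elim simp
  then obtain p where p: "dist (X p w) (left_limit X s w) < e / 2" "a < p" "p < s"
    using eventually_happens[of _ "at_left s"] by auto
  have "list_var (\<lambda>t. X t w) ts \<le> list_var (\<lambda>t. X t w) (s # ts)" by (cases ts) auto
  moreover have "\<bar>jump X s w\<bar> \<le> \<bar>X s w - X p w\<bar> + e / 2"
    using p(1) unfolding jump_def dist_real_def by linarith
  ultimately have "(\<Sum>s\<leftarrow>s # ss. \<bar>jump X s w\<bar>) \<le> list_var (\<lambda>t. X t w) (p # s # ts) + e"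
    using ts(3) by simp
  moreover have "sorted (p # s # ts)" "set (p # s # ts) \<subseteq> {a<..T}"
    using ts p s by fastforce+
  ultimately show ?case by blast
qed

text \<open>The jump at 0 is \<open>X 0 w\<close> by convention. Partitions of \<open>{0..T}\<close>
  do not see it, whence the extra summand; all other jumps are approximated by increments.\<close>

lemma sum_jump_le_variation:
  assumes cad: "cadlag_process M T X" and w: "w \<in> space M" and S: "finite S" "S \<subseteq> {0..T}"
  shows "ennreal (\<Sum>s\<in>S. \<bar>jump X s w\<bar>) \<le> ennreal \<bar>X 0 w\<bar> + path_variation T (\<lambda>t. X t w)"
proof (rule ennreal_le_epsilon)
  fix e :: real assume e: "0 < e"
  let ?ss = "sorted_list_of_set (S - {0})"
  have "sorted_wrt (<) ?ss" "set ?ss \<subseteq> {0<..T}" using S by auto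
  from sum_list_jump_le[OF cad w order_refl this e]
  obtain ts where ts: "sorted ts" "set ts \<subseteq> {0<..T}"
      "(\<Sum>s\<leftarrow>?ss. \<bar>jump X s w\<bar>) \<le> list_var (\<lambda>t. X t w) ts + e" by blast
  have "(\<Sum>s\<in>S. \<bar>jump X s w\<bar>) \<le> \<bar>jump X 0 w\<bar> + (\<Sum>s\<in>S - {0}. \<bar>jump X s w\<bar>)"
    using S(1) by (cases "0 \<in> S") (auto simp: sum.remove)
  also have "(\<Sum>s\<in>S - {0}. \<bar>jump X s w\<bar>) = (\<Sum>s\<leftarrow>?ss. \<bar>jump X s w\<bar>)"
    using S(1) by (subst sum_list_distinct_conv_sum_set) auto
  also have "jump X 0 w = X 0 w" by (simp add: jump_def left_limit_def)
  finally have "(\<Sum>s\<in>S. \<bar>jump X s w\<bar>) \<le> \<bar>X 0 w\<bar> + list_var (\<lambda>t. X t w) ts + e"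
    using ts(3) by simp
  then have "ennreal (\<Sum>s\<in>S. \<bar>jump X s w\<bar>) \<le> ennreal \<bar>X 0 w\<bar> + ennreal (list_var (\<lambda>t. X t w) ts) + ennreal e"
    using e list_var_nonneg[of "\<lambda>t. X t w" ts] by (simp add: ennreal_plus[symmetric] ennreal_leI del: ennreal_plus)
  also have "ennreal (list_var (\<lambda>t. X t w) ts) \<le> path_variation T (\<lambda>t. X t w)"
    using ts by (intro list_var_le_path_variation) auto
  finally show "ennreal (\<Sum>s\<in>S. \<bar>jump X s w\<bar>) \<le> ennreal \<bar>X 0 w\<bar> + path_variation T (\<lambda>t. X t w) + ennreal e"
    by (simp add: add_left_mono add_right_mono)
qed

lemma disjoint_time_graphs:
  assumes "disjoint_family (\<lambda>n. time_graph M (f n))" "w \<in> space M" "f n w = ereal t" "f n' w = ereal t"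
  shows "n = n'"
proof (rule ccontr)
  assume "n \<noteq> n'"
  then have "time_graph M (f n) \<inter> time_graph M (f n') = {}"
    using assms(1) by (auto simp: disjoint_family_on_def)
  moreover have "(t, w) \<in> time_graph M (f n) \<inter> time_graph M (f n')"
    using assms by (simp add: time_graph_def)
  ultimately show False by blast
qed

context standard_filtration
begin

context
  fixes U :: "real \<Rightarrow> 'a \<Rightarrow> real" and \<eta> :: "nat \<Rightarrow> 'a \<Rightarrow> ereal" and \<eta>' :: "nat \<Rightarrow> nat \<Rightarrow> 'a \<Rightarrow> ereal"
  assumes ad: "adapted_process F T U" and pj: "pure_jump_process M T U"
    and iv: "integrable_variation M T U"
    and \<eta>: "jump_time_sequence M F T U \<eta>"
    and \<eta>': "\<And>n. enveloping_sequence M F T (\<eta> n) (\<eta>' n)"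
begin

definition env_jump :: "nat \<times> nat \<Rightarrow> 'a \<Rightarrow> real" where
  "env_jump = (\<lambda>(n, m) w. jump_at U (\<eta>' n m) w * of_bool (\<eta> n w = \<eta>' n m w))"

abbreviation "env_nth k \<equiv> env_jump (prod_decode k)"

text \<open>Infinite times are excluded: two times may agree at infinity for many pairs at once, and
  there \<open>jump_at\<close> is 0 anyway.\<close>

definition hits :: "'a \<Rightarrow> (nat \<times> nat) set" where
  "hits w = {(n, m). \<eta> n w = \<eta>' n m w \<and> \<eta> n w \<noteq> \<infinity>}"

definition hit_time :: "'a \<Rightarrow> nat \<times> nat \<Rightarrow> real" where
  "hit_time w p = real_of_ereal (\<eta> (fst p) w)"

lemma cadlag_U: "cadlag_process M T U"
  using pj by (simp add: pure_jump_process_def)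

lemma stop_\<eta>: "stopping (\<eta> n)"
  using \<eta> by (simp add: jump_time_sequence_def)

lemma predictable_\<eta>': "predictable_time M F T (\<eta>' n m)"
  using \<eta>' by (simp add: enveloping_sequence_def)

lemma stop_\<eta>': "stopping (\<eta>' n m)"
  using predictable_\<eta>' by (simp add: predictable_time_def)

lemma hits_iff:
  assumes "w \<in> space M"
  shows "(n, m) \<in> hits w \<longleftrightarrow> (\<exists>s\<in>{0..T}. \<eta> n w = ereal s \<and> \<eta>' n m w = ereal s)"
proof -
  have "\<eta> n w \<in> ereal ` {0..T} \<union> {\<infinity>}"
    using stop_\<eta>[of n] assms by (auto simp: stop_time_def random_time_def)
  then show ?thesis by (auto simp: hits_def)
qed

lemma hit_time_bounds: "w \<in> space M \<Longrightarrow> p \<in> hits w \<Longrightarrow> hit_time w p \<in> {0..T}"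
  by (cases p) (auto simp: hits_iff hit_time_def)

text \<open>A common finite time forces equal \<open>n\<close>, since the graphs of the jump times
  are disjoint, and then equal \<open>m\<close>, since the graphs within one enveloping sequence are
  disjoint.\<close>

lemma inj_hit_time:
  assumes w: "w \<in> space M" shows "inj_on (hit_time w) (hits w)"
proof (rule inj_onI)
  fix p q assume pq: "p \<in> hits w" "q \<in> hits w" "hit_time w p = hit_time w q"
  obtain n m n' m' where [simp]: "p = (n, m)" "q = (n', m')" by (cases p, cases q) blast
  obtain s where s: "\<eta> n w = ereal s" "\<eta>' n m w = ereal s" using pq(1) by (auto simp: hits_iff[OF w])
  obtain s' where s': "\<eta> n' w = ereal s'" "\<eta>' n' m' w = ereal s'" using pq(2) by (auto simp: hits_iff[OF w])
  have "s = s'" using pq(3) s s' by (simp add: hit_time_def)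
  note s' = s'[folded \<open>s = s'\<close>]
  have "disjoint_family (\<lambda>n. time_graph M (\<eta> n))" using \<eta> by (simp add: jump_time_sequence_def)
  from disjoint_time_graphs[OF this w s(1) s'(1)] have n: "n = n'" .
  have "disjoint_family (\<lambda>m. time_graph M (\<eta>' n m))" using \<eta>'[of n] by (simp add: enveloping_sequence_def)
  from disjoint_time_graphs[OF this w s(2) s'(2)[folded n]] n show "p = q" by simp
qed

lemma env_jump_eq:
  assumes w: "w \<in> space M"
  shows "env_jump p w = (if p \<in> hits w then jump U (hit_time w p) w else 0)"
proof (cases p)
  case (Pair n m)
  show ?thesis
    by (auto simp: Pair env_jump_def hits_def hit_time_def jump_at_def)
qed

text \<open>The jumps up to \<open>t\<close> are reindexed by the pairs that hit them. No nonzero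
  jump is lost, because the jump times exhaust the jumps and each graph is enveloped; none is
  counted twice, by \<open>inj_hit_time\<close>.\<close>

lemma env_jump_after:
  assumes w: "w \<in> space M" and t: "t \<in> {0..T}"
    and sum: "((\<lambda>s. jump U s w) has_sum x) {0..t}"
    and exhaust: "\<And>s. s \<in> {0..T} \<Longrightarrow> U s w \<noteq> left_limit U s w \<Longrightarrow> \<exists>n. \<eta> n w = ereal s"
  shows "((\<lambda>(n, m). env_jump (n, m) w * after (\<eta>' n m) t w) has_sum x) UNIV"
proof -
  let ?I = "{p\<in>hits w. hit_time w p \<le> t}"
  have "((\<lambda>s. jump U s w) has_sum x) (hit_time w ` ?I)"
  proof (rule has_sum_cong_neutral[THEN iffD1, OF _ _ _ sum])
    fix s assume s: "s \<in> {0..t} - hit_time w ` ?I"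
    show "jump U s w = 0"
    proof (rule ccontr)
      assume "jump U s w \<noteq> 0"
      then obtain n where n: "\<eta> n w = ereal s" using exhaust[of s] s t by (auto simp: jump_def)
      then have "(s, w) \<in> time_graph M (\<eta> n)" using w by (simp add: time_graph_def)
      then obtain m where "(s, w) \<in> time_graph M (\<eta>' n m)"
        using \<eta>'[of n] unfolding enveloping_sequence_def by blast
      then have "(n, m) \<in> hits w" using n by (simp add: hits_def time_graph_def)
      moreover have "hit_time w (n, m) = s" using n by (simp add: hit_time_def)
      ultimately show False using s by (auto simp: image_iff)
    qed
  next
    fix s assume "s \<in> hit_time w ` ?I - {0..t}"
    then show "jump U s w = 0" using hit_time_bounds[OF w] by fastforce
  qed auto
  then have "((\<lambda>p. jump U (hit_time w p) w) has_sum x) ?I"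
    by (subst (asm) has_sum_reindex) (auto simp: o_def intro: inj_on_subset[OF inj_hit_time[OF w]])
  then show ?thesis
  proof (rule has_sum_cong_neutral[THEN iffD1, rotated -1])
    fix p assume "p \<in> UNIV - ?I"
    then show "(case p of (n, m) \<Rightarrow> env_jump (n, m) w * after (\<eta>' n m) t w) = 0"
      by (cases p) (auto simp: env_jump_eq[OF w] hits_iff[OF w] hit_time_def)
  next
    fix p assume "p \<in> ?I \<inter> UNIV"
    then show "jump U (hit_time w p) w = (case p of (n, m) \<Rightarrow> env_jump (n, m) w * after (\<eta>' n m) t w)"
      by (cases p) (auto simp: env_jump_eq[OF w] hits_iff[OF w] hit_time_def)
  qed auto
qed

text \<open>Distinct pairs with a hit belong to distinct times, so their jumps are jumps of one path
  and bounded by its variation.\<close>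

lemma sum_env_jump_le:
  assumes w: "w \<in> space M" and "finite P"
  shows "ennreal (\<Sum>p\<in>P. \<bar>env_jump p w\<bar>) \<le> ennreal \<bar>U 0 w\<bar> + path_variation T (\<lambda>t. U t w)"
proof -
  have "(\<Sum>p\<in>P. \<bar>env_jump p w\<bar>) = (\<Sum>p\<in>P \<inter> hits w. \<bar>jump U (hit_time w p) w\<bar>)"
    using assms(2) by (intro sum.mono_neutral_cong_right) (auto simp: env_jump_eq[OF w])
  also have "\<dots> = (\<Sum>s\<in>hit_time w ` (P \<inter> hits w). \<bar>jump U s w\<bar>)"
    using inj_on_subset[OF inj_hit_time[OF w], of "P \<inter> hits w"] by (subst sum.reindex) auto
  finally have eq: "(\<Sum>p\<in>P. \<bar>env_jump p w\<bar>) = (\<Sum>s\<in>hit_time w ` (P \<inter> hits w). \<bar>jump U s w\<bar>)" .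
  have "hit_time w ` (P \<inter> hits w) \<subseteq> {0..T}" using hit_time_bounds[OF w] by blast
  then show ?thesis unfolding eq using assms(2) by (intro sum_jump_le_variation[OF cadlag_U w]) auto
qed

lemma env_jump_measurable [measurable]: "env_jump p \<in> borel_measurable M"
proof (cases p)
  case (Pair n m)
  have [measurable]: "\<eta> n \<in> borel_measurable M" "\<eta>' n m \<in> borel_measurable M"
    using stop_\<eta>[of n] stop_\<eta>'[of n m] by (auto simp: stop_time_def random_time_def)
  have [measurable]: "jump_at U (\<eta>' n m) \<in> borel_measurable M"
    using stop_\<eta>'[of n m] by (intro jump_at_measurable ad cadlag_U) (simp add: stop_time_def)
  show ?thesis unfolding Pair env_jump_def prod.case by measurable
qed

lemma
  shows env_jump_integrable: "integrable M (env_nth k)"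
    and env_jump_summable: "summable (\<lambda>k. \<integral>w. \<bar>env_nth k w\<bar> \<partial>M)"
proof -
  have "(\<Sum>k. ennreal \<bar>env_nth k w\<bar>) \<le> ennreal \<bar>U 0 w\<bar> + path_variation T (\<lambda>t. U t w)"
    if w: "w \<in> space M" for w
  proof (rule suminf_le_const)
    fix n
    have "(\<Sum>k<n. ennreal \<bar>env_nth k w\<bar>) = ennreal (\<Sum>p\<in>prod_decode ` {..<n}. \<bar>env_jump p w\<bar>)"
      by (subst sum.reindex) (auto simp: inj_prod_decode sum_ennreal)
    also have "\<dots> \<le> ennreal \<bar>U 0 w\<bar> + path_variation T (\<lambda>t. U t w)"
      by (rule sum_env_jump_le[OF w]) simp
    finally show "(\<Sum>k<n. ennreal \<bar>env_nth k w\<bar>) \<le> \<dots>" .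
  qed simp
  then have "(\<integral>\<^sup>+w. (\<Sum>k. ennreal \<bar>env_nth k w\<bar>) \<partial>M) \<le>
      (\<integral>\<^sup>+w. ennreal \<bar>U 0 w\<bar> + path_variation T (\<lambda>t. U t w) \<partial>M)"
    by (rule nn_integral_mono)
  also have "\<dots> < \<infinity>" using iv by (simp add: integrable_variation_def)
  also have "(\<integral>\<^sup>+w. (\<Sum>k. ennreal \<bar>env_nth k w\<bar>) \<partial>M) =
      (\<Sum>k. \<integral>\<^sup>+w. ennreal \<bar>env_nth k w\<bar> \<partial>M)"
    by (rule nn_integral_suminf) measurable
  finally have fin: "(\<Sum>k. \<integral>\<^sup>+w. ennreal \<bar>env_nth k w\<bar> \<partial>M) < \<infinity>" .
  have int: "integrable M (env_nth k)" for k
  proof (rule integrableI_bounded)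
    have "(\<integral>\<^sup>+w. ennreal \<bar>env_nth k w\<bar> \<partial>M) \<le> (\<Sum>k. \<integral>\<^sup>+w. ennreal \<bar>env_nth k w\<bar> \<partial>M)"
      using sum_le_suminf[of "\<lambda>k. \<integral>\<^sup>+w. ennreal \<bar>env_nth k w\<bar> \<partial>M" "{k}"] by simp
    with fin show "(\<integral>\<^sup>+w. ennreal (norm (env_nth k w)) \<partial>M) < \<infinity>"
      by (simp add: le_less_trans)
  qed measurable
  then show "integrable M (env_nth k)" .
  have nn: "(\<integral>\<^sup>+w. ennreal \<bar>env_nth k w\<bar> \<partial>M) = ennreal (LINT w|M. \<bar>env_nth k w\<bar>)" for k
    by (rule nn_integral_eq_integral[OF integrable_abs[OF int]]) simp
  have "(\<Sum>k. ennreal (LINT w|M. \<bar>env_nth k w\<bar>)) < \<infinity>"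
    using fin unfolding nn .
  then show "summable (\<lambda>k. \<integral>w. \<bar>env_nth k w\<bar> \<partial>M)"
    by (intro summable_suminf_not_top) (auto simp: less_top)
qed

text \<open>On the event that both times are 0, which lies in \<open>F 0\<close>, the jump is
  \<open>U 0\<close>; elsewhere the product vanishes.\<close>

lemma env_jump_zero:
  "(\<lambda>w. after (\<eta>' n m) 0 w * env_jump (n, m) w) \<in> borel_measurable (F 0)"
proof -
  have zero: "0 \<in> {0..T}" using T_pos by simp
  let ?S = "{w\<in>space M. \<eta> n w \<le> ereal 0} \<inter> {w\<in>space M. \<eta>' n m w \<le> ereal 0}"
  have "\<forall>t\<in>{0..T}. {w\<in>space M. \<eta> n w \<le> ereal t} \<in> sets (F t)"
    "\<forall>t\<in>{0..T}. {w\<in>space M. \<eta>' n m w \<le> ereal t} \<in> sets (F t)"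
    using stop_\<eta>[of n] stop_\<eta>'[of n m] unfolding stop_time_def by blast+
  then have "?S \<in> sets (F 0)" using zero by blast
  moreover have "U 0 \<in> borel_measurable (F 0)" using ad zero by (simp add: adapted_process_def)
  ultimately have "(\<lambda>w. U 0 w * indicator ?S w) \<in> borel_measurable (F 0)"
    by (intro borel_measurable_times borel_measurable_indicator)
  also have "?this \<longleftrightarrow> ?thesis"
  proof (rule measurable_cong)
    fix w assume "w \<in> space (F 0)"
    then have w: "w \<in> space M" using space_F[OF zero] by simp
    have val: "\<eta> n w \<in> ereal ` {0..T} \<union> {\<infinity>}" "\<eta>' n m w \<in> ereal ` {0..T} \<union> {\<infinity>}"
      using stop_\<eta>[of n] stop_\<eta>'[of n m] w by (auto simp: stop_time_def random_time_def)
    show "U 0 w * indicator ?S w = after (\<eta>' n m) 0 w * env_jump (n, m) w"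
      using val w by (auto simp: env_jump_def jump_at_def jump_def left_limit_def indicator_def zero_ereal_def)
  qed
  finally show ?thesis .
qed

text \<open>The pairs are enumerated to obtain one series, which is compensated; absolute
  summability then restores the iterated sum over \<open>n\<close> and \<open>m\<close>.\<close>

lemma compensator_of_env_jumps:
  obtains B where "is_compensator M F T U B" "martingale (\<lambda>t w. U t w - B t w)"
    "AE w in M. \<forall>t\<in>{0..T}.
      (\<forall>n. summable (\<lambda>m. real_cond_exp M (before (\<eta>' n m)) (env_jump (n, m)) w * after (\<eta>' n m) t w)) \<and>
      (\<lambda>n. \<Sum>m. real_cond_exp M (before (\<eta>' n m)) (env_jump (n, m)) w * after (\<eta>' n m) t w) sums B t w"
proof -
  define \<tau> where "\<tau> p = \<eta>' (fst p) (snd p)" for p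
  have U: "AE w in M. \<forall>t\<in>{0..T}. (\<lambda>k. env_nth k w * after (\<tau> (prod_decode k)) t w) sums U t w"
  proof -
    have "AE w in M. \<forall>t\<in>{0..T}. ((\<lambda>s. jump U s w) has_sum U t w) {0..t}"
      using pj by (simp add: pure_jump_process_def)
    moreover have "AE w in M. \<forall>t\<in>{0..T}. U t w \<noteq> left_limit U t w \<longrightarrow> (\<exists>n. \<eta> n w = ereal t)"
      using \<eta> by (simp add: jump_time_sequence_def)
    ultimately show ?thesis
      using AE_space
    proof eventually_elim
      case (elim w)
      show ?case
      proof
        fix t assume t: "t \<in> {0..T}"
        have "((\<lambda>(n, m). env_jump (n, m) w * after (\<eta>' n m) t w) has_sum U t w) UNIV"
          using elim t by (intro env_jump_after) auto
        then have "((\<lambda>p. env_jump p w * after (\<tau> p) t w) has_sum U t w) UNIV"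
          by (simp add: \<tau>_def case_prod_beta')
        then have "((\<lambda>k. env_nth k w * after (\<tau> (prod_decode k)) t w) has_sum U t w) UNIV"
          by (rule has_sum_reindex_bij_betw[OF bij_prod_decode, THEN iffD2])
        then show "(\<lambda>k. env_nth k w * after (\<tau> (prod_decode k)) t w) sums U t w"
          by (rule has_sum_imp_sums)
      qed
    qed
  qed
  have \<tau>: "predictable_time M F T (\<tau> p)" for p unfolding \<tau>_def by (rule predictable_\<eta>')
  have zero: "(\<lambda>w. after (\<tau> p) 0 w * env_jump p w) \<in> borel_measurable (F 0)" for p
    using env_jump_zero[of "fst p" "snd p"] by (simp add: \<tau>_def)
  define c where "c p = real_cond_exp M (before (\<tau> p)) (env_jump p)" for p
  from compensator_series[OF \<tau> env_jump_integrable env_jump_summable zero ad cadlag_U U]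
  obtain B where B: "is_compensator M F T U B" "martingale (\<lambda>t w. U t w - B t w)"
      "AE w in M. summable (\<lambda>k. \<bar>c (prod_decode k) w\<bar>)"
      "AE w in M. \<forall>t\<in>{0..T}. B t w = (\<Sum>k. c (prod_decode k) w * after (\<tau> (prod_decode k)) t w)"
    unfolding c_def by blast
  from B(3,4) have "AE w in M. \<forall>t\<in>{0..T}.
      (\<forall>n. summable (\<lambda>m. c (n, m) w * after (\<tau> (n, m)) t w)) \<and>
      (\<lambda>n. \<Sum>m. c (n, m) w * after (\<tau> (n, m)) t w) sums B t w"
  proof eventually_elim
    case (elim w)
    show ?case
    proof
      fix t assume t: "t \<in> {0..T}"
      have "summable (\<lambda>k. \<bar>c (prod_decode k) w * after (\<tau> (prod_decode k)) t w\<bar>)"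
        by (rule summable_jump_series[OF elim(1)])
      from sums_prod_decode[of "\<lambda>p. c p w * after (\<tau> p) t w", OF this] elim(2) t
      show "(\<forall>n. summable (\<lambda>m. c (n, m) w * after (\<tau> (n, m)) t w)) \<and>
          (\<lambda>n. \<Sum>m. c (n, m) w * after (\<tau> (n, m)) t w) sums B t w" by simp
    qed
  qed
  with B(1,2) show thesis by (intro that) (simp_all add: c_def \<tau>_def)
qed

end

end

theorem lemma2p13:
  fixes R :: "'a measure" and \<A> :: "real \<Rightarrow> 'a measure" and T :: real
    and U :: "real \<Rightarrow> 'a \<Rightarrow> real"
    and \<eta> :: "nat \<Rightarrow> 'a \<Rightarrow> ereal" and \<eta>' :: "nat \<Rightarrow> nat \<Rightarrow> 'a \<Rightarrow> ereal"
  assumes "standard_filtered_prob_space R \<A> T"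
    and "adapted_process \<A> T U"
    and "pure_jump_process R T U"
    and "integrable_variation R T U"
    and "accessible_jump_times_only R \<A> T U"
    and "jump_time_sequence R \<A> T U \<eta>"
    and "\<And>n. enveloping_sequence R \<A> T (\<eta> n) (\<eta>' n)"
  defines "c \<equiv> \<lambda>n m. real_cond_exp R (sigma_before R \<A> T (\<eta>' n m))
                 (\<lambda>\<omega>. jump_at U (\<eta>' n m) \<omega> * of_bool (\<eta> n \<omega> = \<eta>' n m \<omega>))"
  shows "(\<exists>B. is_compensator R \<A> T U B) \<and>
    (\<forall>B. is_compensator R \<A> T U B \<longrightarrow>
      (AE \<omega> in R. \<forall>t\<in>{0..T}.
         (\<forall>n. summable (\<lambda>m. c n m \<omega> * of_bool (\<eta>' n m \<omega> \<le> ereal t))) \<and>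
         (\<lambda>n. \<Sum>m. c n m \<omega> * of_bool (\<eta>' n m \<omega> \<le> ereal t)) sums B t \<omega>))"
proof -
  interpret standard_filtration R \<A> T by unfold_locales (rule assms(1))
  have c: "c n m = real_cond_exp R (sigma_before R \<A> T (\<eta>' n m)) (env_jump U \<eta> \<eta>' (n, m))" for n m
    unfolding c_def env_jump_def[OF assms(2,3,4,6,7)] by simp
  obtain B where B: "is_compensator R \<A> T U B" "cadlag_martingale R \<A> T (\<lambda>t \<omega>. U t \<omega> - B t \<omega>)"
    "AE \<omega> in R. \<forall>t\<in>{0..T}.
      (\<forall>n. summable (\<lambda>m. c n m \<omega> * of_bool (\<eta>' n m \<omega> \<le> ereal t))) \<and>
      (\<lambda>n. \<Sum>m. c n m \<omega> * of_bool (\<eta>' n m \<omega> \<le> ereal t)) sums B t \<omega>"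
    unfolding c by (rule compensator_of_env_jumps[OF assms(2,3,4,6,7)])
  show ?thesis
  proof (intro conjI allI impI)
    show "\<exists>B. is_compensator R \<A> T U B" using B(1) by blast
    fix B' assume "is_compensator R \<A> T U B'"
    \<comment> \<open>The formula is known for the constructed \<open>B\<close>; uniqueness up to
      indistinguishability carries it to every compensator.\<close>
    from compensator_unique[OF this B(1,2)] B(3)
    show "AE \<omega> in R. \<forall>t\<in>{0..T}.
         (\<forall>n. summable (\<lambda>m. c n m \<omega> * of_bool (\<eta>' n m \<omega> \<le> ereal t))) \<and>
         (\<lambda>n. \<Sum>m. c n m \<omega> * of_bool (\<eta>' n m \<omega> \<le> ereal t)) sums B' t \<omega>"
      by eventually_elim simp
  qed
qed

end
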